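(* The spaces $\mathcal{P}_{0,d}$ and $\mathcal{H}_T$ coincide.
   Context: $T>0$, $d\in\mathbb{N}$; $\mathcal{F}$ is the Fourier transform on $\mathbb{R}^d$, $\tilde g(x)=g(-x)$, $\mathcal{S}(\mathbb{R}^d)$ is the Schwartz space. $\Gamma$ is a nonnegative, nonnegative definite tempered measure on $\mathbb{R}^d$ and $\mu$ is the nonnegative tempered measure with $\mathcal{F}\mu=\Gamma$. $\mathcal{H}$ is the completion of $\mathcal{S}(\mathbb{R}^d)$ under $\langle\phi,\psi\rangle_0=\int(\phi\ast\tilde\psi)(x)\Gamma(dx)=\int\mathcal{F}\phi(\xi)\overline{\mathcal{F}\psi(\xi)}\mu(d\xi)$, and $\mathcal{H}_T=L^2([0,T];\mathcal{H})$. $(\mathcal{F}_t)$ is the natural filtration of the martingale measure $M_t(A)=F(1_{[0,t]}1_A)$, where $F$ is a centered Gaussian process with covariance $E[F(\phi)F(\psi)]=\int_0^\infty\int(\phi(t)\ast\tilde\psi(t))(x)\Gamma(dx)dt$. $\mathcal{E}$ is the set of simple processes, i.e. finite sums of $1_{(a,b]}(t)1_A(x)X$ with $0\le a<b\le T$, $A$ a bounded Borel set, $X$ bounded and $\mathcal{F}_a$-measurable. $\mathcal{P}_0$ is the completion of $\mathcal{E}$ under $\|g\|_0^2=E\big[\int_0^T\int|\mathcal{F}g(s)(\xi)|^2\mu(d\xi)ds\big]$, and $\mathcal{P}_{0,d}$ is the subset of $\mathcal{P}_0$ consisting of deterministic elements (the closure of the deterministic simple functions). Elements of both spaces are identified through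 $g\mapsto\mathcal{F}g$ with elements of $L^2([0,T]\times\mathbb{R}^d,ds\otimes\mu(d\xi))$, both norms being the norm of that space; "coincide" means that under this identification they are the same space. *)

theory Defs
  imports "HOL-Probability.Probability"
begin

section \<open>Schwartz functions, Fourier transform, tempered measures\<close>

primrec iter_partial :: "'a::euclidean_space list \<Rightarrow> ('a \<Rightarrow> real) \<Rightarrow> 'a \<Rightarrow> real" where
  "iter_partial [] f = f"
| "iter_partial (b # bs) f = (\<lambda>x. frechet_derivative (iter_partial bs f) (at x) b)"

text \<open>A multi-index is a list of elements of \<open>Basis\<close>. All test functions are real-valued,
  in accordance with the convention that the tilde operation on functions involves no complex
  conjugation; so the spaces below are real vector spaces.\<close>

definition schwartz :: "('a::euclidean_space \<Rightarrow> real) set" where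
  "schwartz = {f. \<forall>bs. set bs \<subseteq> Basis \<longrightarrow>
      (\<forall>x. iter_partial bs f differentiable (at x)) \<and>
      (\<forall>k::nat. bounded (range (\<lambda>x. norm x ^ k * iter_partial bs f x)))}"

text \<open>With \<open>dx\<close> unnormalised, the transform of a convolution is the product of the transforms,
  so no constants occur in the two expressions for the inner product
  \<open>\<integral> (\<phi> * tilde \<psi>) d\<Gamma> = \<integral> fourier \<phi> * cnj (fourier \<psi>) d\<mu>\<close>; the same is true for the kernel with a factor
  \<open>2 * pi\<close> in the exponent.\<close>

definition fourier :: "('a::euclidean_space \<Rightarrow> real) \<Rightarrow> 'a \<Rightarrow> complex" where
  "fourier f \<xi> = (\<integral>x. exp (- \<i> * complex_of_real (\<xi> \<bullet> x)) * complex_of_real (f x) \<partial>lborel)"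

definition convol :: "('a::euclidean_space \<Rightarrow> real) \<Rightarrow> ('a \<Rightarrow> real) \<Rightarrow> 'a \<Rightarrow> real" where
  "convol f g x = (\<integral>y. f (x - y) * g y \<partial>lborel)"

definition refl_fun :: "('a::euclidean_space \<Rightarrow> real) \<Rightarrow> 'a \<Rightarrow> real" where
  "refl_fun g x = g (- x)"

definition tempered_measure :: "'a::euclidean_space measure \<Rightarrow> bool" where
  "tempered_measure \<Gamma> \<longleftrightarrow> sets \<Gamma> = sets borel \<and>
     (\<exists>k::nat. (\<integral>\<^sup>+x. ennreal (1 / (1 + (norm x)\<^sup>2) ^ k) \<partial>\<Gamma>) < \<infinity>)"

definition nonneg_definite :: "'a::euclidean_space measure \<Rightarrow> bool" where
  "nonneg_definite \<Gamma> \<longleftrightarrow> (\<forall>\<phi>\<in>schwartz. 0 \<le> (\<integral>x. convol \<phi> (refl_fun \<phi>) x \<partial>\<Gamma>))"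

text \<open>\<open>\<Gamma>\<close> is the Fourier transform of \<open>\<mu>\<close> as a tempered distribution. Real test functions
  suffice, both sides being complex linear in the test function.\<close>

definition is_fourier_transform :: "'a::euclidean_space measure \<Rightarrow> 'a measure \<Rightarrow> bool" where
  "is_fourier_transform \<mu> \<Gamma> \<longleftrightarrow>
     (\<forall>\<phi>\<in>schwartz. complex_of_real (\<integral>x. \<phi> x \<partial>\<Gamma>) = (\<integral>\<xi>. fourier \<phi> \<xi> \<partial>\<mu>))"


section \<open>Square integrable functions and closures\<close>

text \<open>Elements of \<open>L\<^sup>2\<close> spaces are handled through their representatives. All subsets of
  \<open>L\<^sup>2\<close> spaces below are saturated under almost everywhere equality, hence equality of the sets of
  representatives is equality of the spaces.\<close>

definition L2_sqnorm :: "'b measure \<Rightarrow> ('b \<Rightarrow> complex) \<Rightarrow> ennreal" where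
  "L2_sqnorm N f = (\<integral>\<^sup>+x. ennreal ((cmod (f x))\<^sup>2) \<partial>N)"

definition L2 :: "'b measure \<Rightarrow> ('b \<Rightarrow> complex) set" where
  "L2 N = {f \<in> borel_measurable N. L2_sqnorm N f < \<infinity>}"

definition L2_closure :: "'b measure \<Rightarrow> ('b \<Rightarrow> complex) set \<Rightarrow> ('b \<Rightarrow> complex) set" where
  "L2_closure N S = {f \<in> L2 N. \<exists>g. (\<forall>n::nat. g n \<in> S) \<and>
     (\<lambda>n. L2_sqnorm N (\<lambda>x. g n x - f x)) \<longlonglongrightarrow> 0}"

definition time_measure :: "real \<Rightarrow> real measure" where
  "time_measure T = restrict_space lborel {0..T}"


section \<open>The space of square integrable functions with values in the completion\<close>

text \<open>The completion of the Schwartz space under the norm whose square is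
  \<open>\<phi> \<mapsto> L2_sqnorm \<mu> (fourier \<phi>)\<close>, realised through the Fourier transform inside \<open>L\<^sup>2(\<mu>)\<close>.\<close>

definition H_space :: "'a::euclidean_space measure \<Rightarrow> ('a \<Rightarrow> complex) set" where
  "H_space \<mu> = L2_closure \<mu> (fourier ` schwartz)"

text \<open>Bochner square integrable functions with values in the subspace \<open>H\<close> of \<open>L\<^sup>2(\<mu>)\<close>.\<close>

definition strongly_measurable ::
    "'t measure \<Rightarrow> 'b measure \<Rightarrow> ('b \<Rightarrow> complex) set \<Rightarrow> ('t \<Rightarrow> 'b \<Rightarrow> complex) \<Rightarrow> bool" where
  "strongly_measurable N \<mu> H h \<longleftrightarrow> (\<exists>s :: nat \<Rightarrow> 't \<Rightarrow> 'b \<Rightarrow> complex.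
     (\<forall>n. simple_function N (s n) \<and> s n ` space N \<subseteq> H) \<and>
     (AE t in N. (\<lambda>n. L2_sqnorm \<mu> (\<lambda>\<xi>. s n t \<xi> - h t \<xi>)) \<longlonglongrightarrow> 0))"

definition bochner_L2 ::
    "'t measure \<Rightarrow> 'b measure \<Rightarrow> ('b \<Rightarrow> complex) set \<Rightarrow> ('t \<Rightarrow> 'b \<Rightarrow> complex) set" where
  "bochner_L2 N \<mu> H = {h. h ` space N \<subseteq> H \<and> strongly_measurable N \<mu> H h \<and>
     (\<integral>\<^sup>+t. L2_sqnorm \<mu> (h t) \<partial>N) < \<infinity>}"

text \<open>The functions on \<open>[0,T] \<times> \<real>\<^sup>d\<close> identified with an element of \<open>L\<^sup>2([0,T];H)\<close>: the section
  at time \<open>t\<close> is a representative of the value at \<open>t\<close>, for almost every \<open>t\<close>.\<close>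

definition H_T :: "'a::euclidean_space measure \<Rightarrow> real \<Rightarrow> (real \<times> 'a \<Rightarrow> complex) set" where
  "H_T \<mu> T = {G \<in> L2 (time_measure T \<Otimes>\<^sub>M \<mu>).
     \<exists>h \<in> bochner_L2 (time_measure T) \<mu> (H_space \<mu>).
       AE t in time_measure T. AE \<xi> in \<mu>. G (t, \<xi>) = h t \<xi>}"


section \<open>The Gaussian noise and its filtration\<close>

text \<open>The constant case is the degenerate Gaussian law.\<close>

definition gaussian_rv :: "'w measure \<Rightarrow> ('w \<Rightarrow> real) \<Rightarrow> bool" where
  "gaussian_rv P X \<longleftrightarrow> X \<in> borel_measurable P \<and>
     ((\<exists>m \<sigma>. 0 < \<sigma> \<and> distributed P lborel X (normal_density m \<sigma>)) \<or>
      (\<exists>m. AE \<omega> in P. X \<omega> = m))"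

definition centered_gaussian_process ::
    "'w measure \<Rightarrow> 'i set \<Rightarrow> ('i \<Rightarrow> 'w \<Rightarrow> real) \<Rightarrow> bool" where
  "centered_gaussian_process P I F \<longleftrightarrow>
     (\<forall>J c. finite J \<and> J \<subseteq> I \<longrightarrow> gaussian_rv P (\<lambda>\<omega>. \<Sum>i\<in>J. c i * F i \<omega>)) \<and>
     (\<forall>i\<in>I. (\<integral>\<omega>. F i \<omega> \<partial>P) = 0)"

text \<open>The index set of the noise: bounded Borel functions on \<open>[0,\<infinity>) \<times> \<real>\<^sup>d\<close> with bounded support,
  extended by 0 to negative times. It contains the test functions and the functions
  \<open>1\<^bsub>[0,t]\<^esub> 1\<^sub>A\<close> that define the martingale measure.\<close>

definition noise_index :: "(real \<Rightarrow> 'a::euclidean_space \<Rightarrow> real) set" where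
  "noise_index = {\<phi>. (\<lambda>(t, x). \<phi> t x) \<in> borel_measurable borel \<and>
     bounded (range (\<lambda>(t, x). \<phi> t x)) \<and> bounded {(t, x). \<phi> t x \<noteq> 0} \<and>
     (\<forall>t x. t < 0 \<longrightarrow> \<phi> t x = 0)}"

definition gaussian_noise ::
    "'w measure \<Rightarrow> 'a::euclidean_space measure \<Rightarrow> ((real \<Rightarrow> 'a \<Rightarrow> real) \<Rightarrow> 'w \<Rightarrow> real) \<Rightarrow> bool" where
  "gaussian_noise P \<Gamma> F \<longleftrightarrow> centered_gaussian_process P noise_index F \<and>
     (\<forall>\<phi>\<in>noise_index. \<forall>\<psi>\<in>noise_index.
        (\<integral>\<omega>. F \<phi> \<omega> * F \<psi> \<omega> \<partial>P) =
        (\<integral>t\<in>{0..}. (\<integral>x. convol (\<phi> t) (refl_fun (\<psi> t)) x \<partial>\<Gamma>) \<partial>lborel))"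

definition martingale_measure ::
    "((real \<Rightarrow> 'a::euclidean_space \<Rightarrow> real) \<Rightarrow> 'w \<Rightarrow> real) \<Rightarrow> real \<Rightarrow> 'a set \<Rightarrow> 'w \<Rightarrow> real" where
  "martingale_measure F t A = F (\<lambda>s x. indicator {0..t} s * indicator A x)"

definition noise_filtration ::
    "'w measure \<Rightarrow> ((real \<Rightarrow> 'a::euclidean_space \<Rightarrow> real) \<Rightarrow> 'w \<Rightarrow> real) \<Rightarrow> real \<Rightarrow> 'w measure" where
  "noise_filtration P F t = sigma (space P)
     {martingale_measure F s A -` B \<inter> space P | s A B.
        0 \<le> s \<and> s \<le> t \<and> A \<in> sets borel \<and> bounded A \<and> B \<in> sets borel}"


section \<open>Simple processes and their completion\<close>

definition simple_processes ::
    "'w measure \<Rightarrow> ((real \<Rightarrow> 'a::euclidean_space \<Rightarrow> real) \<Rightarrow> 'w \<Rightarrow> real) \<Rightarrow> real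
       \<Rightarrow> ('w \<Rightarrow> real \<Rightarrow> 'a \<Rightarrow> real) set" where
  "simple_processes P F T = {g. \<exists>(n::nat) a b A X.
     (\<forall>i<n. 0 \<le> a i \<and> a i < b i \<and> b i \<le> T \<and> A i \<in> sets borel \<and> bounded (A i) \<and>
        X i \<in> borel_measurable (noise_filtration P F (a i)) \<and> bounded (X i ` space P)) \<and>
     g = (\<lambda>\<omega> t x. \<Sum>i<n. indicator {a i<..b i} t * indicator (A i) x * X i \<omega>)}"

text \<open>The completion of the simple processes, realised through \<open>g \<mapsto> fourier (g \<omega> s) \<xi>\<close> inside the
  \<open>L\<^sup>2\<close> space whose norm defines the norm of the completion.\<close>

definition P_0 ::
    "'w measure \<Rightarrow> ((real \<Rightarrow> 'a::euclidean_space \<Rightarrow> real) \<Rightarrow> 'w \<Rightarrow> real) \<Rightarrow> 'a measure \<Rightarrow> real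
       \<Rightarrow> ('w \<times> real \<times> 'a \<Rightarrow> complex) set" where
  "P_0 P F \<mu> T = L2_closure (P \<Otimes>\<^sub>M (time_measure T \<Otimes>\<^sub>M \<mu>))
     ((\<lambda>g (\<omega>, s, \<xi>). fourier (g \<omega> s) \<xi>) ` simple_processes P F T)"

text \<open>The deterministic elements, as functions on \<open>[0,T] \<times> \<real>\<^sup>d\<close>.\<close>

definition P_0d ::
    "'w measure \<Rightarrow> ((real \<Rightarrow> 'a::euclidean_space \<Rightarrow> real) \<Rightarrow> 'w \<Rightarrow> real) \<Rightarrow> 'a measure \<Rightarrow> real
       \<Rightarrow> (real \<times> 'a \<Rightarrow> complex) set" where
  "P_0d P F \<mu> T = {G \<in> L2 (time_measure T \<Otimes>\<^sub>M \<mu>). (\<lambda>(\<omega>, s, \<xi>). G (s, \<xi>)) \<in> P_0 P F \<mu> T}"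

end

theory Submission
  imports Defs
begin

text \<open>Both spaces are the closure in \<open>L\<^sup>2(ds \<otimes> \<mu>)\<close> of the real span of the functions
  \<open>1\<^bsub>(a,b]\<^esub>(s) \<F> 1\<^bsub>A\<^esub>(\<xi>)\<close>. For \<open>P_0d\<close> this holds because a mean square bound for a random process is
  attained at some \<open>\<omega>\<close>. For \<open>H_T\<close> two density facts are needed: every \<open>\<F> 1\<^bsub>A\<^esub>\<close> lies in \<open>H\<close>, and every
  \<open>\<F> \<phi>\<close> with \<open>\<phi>\<close> a Schwartz function is a limit of combinations of the \<open>\<F> 1\<^bsub>A\<^esub>\<close>. Both rest on the
  bound \<open>\<integral> |\<F> f|\<^sup>2 d\<mu> \<le> C c\<^sup>2\<close> for rapidly decreasing Borel functions with
  \<open>|f| \<le> c (1 + |x|\<^sup>2)\<^sup>-\<^sup>m\<close>, where \<open>C\<close> and \<open>m\<close> depend only on \<open>\<Gamma>\<close>. Gaussian mollifiers \<open>\<rho>\<^sub>n\<close> give it: the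
  function \<open>f * \<rho>\<^sub>n\<close> is Schwartz, so \<open>\<integral> |\<F> f|\<^sup>2 |\<F> \<rho>\<^sub>n|\<^sup>2 d\<mu>\<close> equals a convolution integral against \<open>\<Gamma>\<close>
  that is bounded uniformly in \<open>n\<close>, and \<open>\<F> \<rho>\<^sub>n \<rightarrow> 1\<close>. That \<open>\<F> \<rho>\<^sub>n\<close> is again Gaussian supplies the
  \<open>\<mu>\<close>-integrability needed to apply \<open>\<F> \<mu> = \<Gamma>\<close>.\<close>

section \<open>Rapidly decreasing functions\<close>

text \<open>The relation between \<mu> and \<Gamma> is known only on Schwartz functions, while
  simple processes are built from indicators, and nothing says beforehand that |F 1_A|^2 is
  \<mu>-integrable; a divergent integral over \<mu> would silently be 0. Hence the bound is proved
  for mollified functions first and passed to the limit afterwards. Since \<Gamma> is merely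
  tempered, smallness of f in L^1 or L^2 does not in general control F f in L^2(\<mu>). Smallness in
  a weighted supremum norm does, and in that norm a rapidly decreasing function can still be
  approximated by simple functions with bounded support. The exponent is m = k + d: k powers of the
  weight are integrable for \<Gamma>, and d more make the Lebesgue integral inside a convolution
  finite. In time, simple processes use intervals (a,b] while Bochner simple functions live on
  arbitrary Borel sets; a Dynkin system argument inside the closure bridges the two. All spans are
  real, because test functions and random coefficients are real valued.\<close>

definition wt :: "nat \<Rightarrow> 'a::euclidean_space \<Rightarrow> real" where
  "wt k x = 1 / (1 + (norm x)\<^sup>2) ^ k"

lemma wt_pos [simp]: "0 < wt k x"
  by (simp add: wt_def add_pos_nonneg)

lemma wt_nonneg [simp]: "0 \<le> wt k x"
  using wt_pos less_imp_le by blast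

text \<open>Temperedness of a measure means that some \<open>wt k\<close> is integrable, rapid
  decrease means domination by every \<open>wt k\<close>. This law lets some powers of a weight be
  spent on an integral while the others are kept as decay.\<close>

lemma wt_add: "wt (k + l) x = wt k x * wt l x"
  by (simp add: wt_def power_add)

lemma wt_0 [simp]: "wt 0 x = 1"
  by (simp add: wt_def)

lemma wt_le_1: "wt k x \<le> 1"
  by (simp add: wt_def add_pos_nonneg)

lemma wt_antimono: "k \<le> l \<Longrightarrow> wt l x \<le> wt k x"
  using mult_left_mono[OF wt_le_1[of "l - k" x] wt_nonneg[of k x]] wt_add[of k "l - k" x] by simp

lemma wt_minus [simp]: "wt k (- x) = wt k x"
  by (simp add: wt_def)

lemma wt_measurable [measurable]: "wt k \<in> borel_measurable borel"
  unfolding wt_def by measurable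

lemma wt_scale: "0 \<le> s \<Longrightarrow> s \<le> 1 \<Longrightarrow> wt k x \<le> wt k (s *\<^sub>R x)"
  unfolding wt_def
  by (intro divide_left_mono power_mono mult_pos_pos zero_less_power add_pos_nonneg)
     (auto simp: power_mult_distrib intro!: mult_left_le_one_le power_le_one)

text \<open>Peetre's inequality, from 1 + |x + y|^2 <= 2 (1 + |x|^2) (1 + |y|^2). In a convolution
  it turns decay in x - y and in y into decay in x.\<close>

lemma wt_add_mult: "wt k x * wt k y \<le> 2 ^ k * wt k (x + y)"
proof -
  have "(norm (x + y))\<^sup>2 \<le> (norm x + norm y)\<^sup>2"
    by (intro power_mono norm_triangle_ineq) auto
  also have "\<dots> \<le> 2 * (norm x)\<^sup>2 + 2 * (norm y)\<^sup>2"
    using sum_squares_bound[of "norm x" "norm y"] by (simp add: power2_eq_square algebra_simps)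
  finally have "1 + (norm (x + y))\<^sup>2 \<le> 2 * ((1 + (norm x)\<^sup>2) * (1 + (norm y)\<^sup>2))"
    using mult_nonneg_nonneg[OF zero_le_power2 zero_le_power2, of "norm x" "norm y"]
    by (simp only: distrib_left distrib_right mult_1 mult_1_right)
  then have "(1 + (norm (x + y))\<^sup>2) ^ k \<le> (2 * ((1 + (norm x)\<^sup>2) * (1 + (norm y)\<^sup>2))) ^ k"
    by (intro power_mono) auto
  then have "(1 + (norm (x + y))\<^sup>2) ^ k \<le> 2 ^ k * ((1 + (norm x)\<^sup>2) ^ k * (1 + (norm y)\<^sup>2) ^ k)"
    by (simp add: power_mult_distrib)
  then show ?thesis
    by (simp add: wt_def add_pos_nonneg divide_simps mult_ac)
qed

text \<open>The d factors 1 / (1 + |x|^2) are spent one per coordinate, each bounded by 1 / (1 + (x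
  . b)^2), so the integral is dominated by a product of one-dimensional Cauchy integrals.\<close>

lemma integrable_wt: "integrable lborel (wt DIM('a) :: 'a::euclidean_space \<Rightarrow> real)"
proof (rule integrableI_bounded)
  have R: "integrable lborel (\<lambda>x::real. inverse (1 + x\<^sup>2))"
    using integrable_inverse_1_plus_square
    by (simp add: set_integrable_def einterval_def)
  have "(\<integral>\<^sup>+x. ennreal (norm (wt DIM('a) (x::'a))) \<partial>lborel) \<le>
        (\<integral>\<^sup>+(x::'a). (\<Prod>b\<in>Basis. ennreal (inverse (1 + (x \<bullet> b)\<^sup>2))) \<partial>lborel)"
  proof (intro nn_integral_mono)
    fix x :: 'a
    have "wt DIM('a) x = (\<Prod>b\<in>(Basis::'a set). inverse (1 + (norm x)\<^sup>2))"
      by (simp add: wt_def divide_inverse power_inverse)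
    also have "\<dots> \<le> (\<Prod>b\<in>(Basis::'a set). inverse (1 + (x \<bullet> b)\<^sup>2))"
    proof (intro prod_mono conjI le_imp_inverse_le add_left_mono)
      fix b :: 'a assume "b \<in> Basis"
      then show "(x \<bullet> b)\<^sup>2 \<le> (norm x)\<^sup>2"
        using power_mono[OF Basis_le_norm abs_ge_zero, of b x 2] by simp
    qed (auto simp: add_pos_nonneg)
    finally show "ennreal (norm (wt DIM('a) x)) \<le> (\<Prod>b\<in>Basis. ennreal (inverse (1 + (x \<bullet> b)\<^sup>2)))"
      by (subst prod_ennreal) (auto intro!: ennreal_leI)
  qed
  also have "\<dots> = (\<Prod>b\<in>(Basis::'a set). (\<integral>\<^sup>+x. ennreal (inverse (1 + x\<^sup>2)) \<partial>lborel))"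
    using nn_integral_lborel_prod[of "\<lambda>_ x. ennreal (inverse (1 + x\<^sup>2))"] by auto
  also have "\<dots> = (\<integral>\<^sup>+x. ennreal (inverse (1 + x\<^sup>2)) \<partial>lborel) ^ DIM('a)"
    by simp
  also have "\<dots> < \<infinity>"
    using R unfolding integrable_iff_bounded by (simp add: power_less_top_ennreal)
  finally show "(\<integral>\<^sup>+x. ennreal (norm (wt DIM('a) (x::'a))) \<partial>lborel) < \<infinity>" .
qed measurable

text \<open>Serves translations (c = 1), reflections (c = -1) and the rescaling of Gaussians. If
  \<open>f\<close> is not integrable, both sides of the first equation are 0.\<close>

lemma integral_affine:
  fixes f :: "'a::euclidean_space \<Rightarrow> 'b::{banach, second_countable_topology}"
  assumes [measurable]: "f \<in> borel_measurable borel" and c: "c \<noteq> 0"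
  shows "(\<integral>x. f (t + c *\<^sub>R x) \<partial>lborel) = (\<integral>x. f x \<partial>lborel) /\<^sub>R \<bar>c\<bar> ^ DIM('a)"
    and "integrable lborel (\<lambda>x. f (t + c *\<^sub>R x)) \<longleftrightarrow> integrable lborel f"
proof -
  have "(\<integral>x. f x \<partial>lborel) = (\<integral>x. f x \<partial>density (distr lborel borel (\<lambda>x. t + c *\<^sub>R x)) (\<lambda>_. \<bar>c\<bar>^DIM('a)))"
    using lborel_affine[OF c, of t] by simp
  also have "\<dots> = \<bar>c\<bar>^DIM('a) *\<^sub>R (\<integral>x. f (t + c *\<^sub>R x) \<partial>lborel)"
    by (simp add: integral_density integral_distr)
  finally show "(\<integral>x. f (t + c *\<^sub>R x) \<partial>lborel) = (\<integral>x. f x \<partial>lborel) /\<^sub>R \<bar>c\<bar> ^ DIM('a)"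
    using c by simp
  have "integrable lborel f \<longleftrightarrow> integrable (density (distr lborel borel (\<lambda>x. t + c *\<^sub>R x)) (\<lambda>_. \<bar>c\<bar>^DIM('a))) f"
    using lborel_affine[OF c, of t] by simp
  also have "\<dots> \<longleftrightarrow> integrable lborel (\<lambda>x. \<bar>c\<bar>^DIM('a) *\<^sub>R f (t + c *\<^sub>R x))"
    by (simp add: integrable_density integrable_distr_eq)
  also have "\<dots> \<longleftrightarrow> integrable lborel (\<lambda>x. f (t + c *\<^sub>R x))"
    using c integrable_scaleR_right[of "\<bar>c\<bar>^DIM('a)" lborel "\<lambda>x. f (t + c *\<^sub>R x)"]
      integrable_scaleR_right[of "inverse (\<bar>c\<bar>^DIM('a))" lborel "\<lambda>x. \<bar>c\<bar>^DIM('a) *\<^sub>R f (t + c *\<^sub>R x)"]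
    by auto
  finally show "integrable lborel (\<lambda>x. f (t + c *\<^sub>R x)) \<longleftrightarrow> integrable lborel f" by simp
qed

text \<open>Schwartz decay without smoothness: the common home of Schwartz functions and of
  indicators of bounded Borel sets, so that one estimate on Fourier transforms serves both.\<close>

definition rapidly_decreasing :: "('a::euclidean_space \<Rightarrow> real) set" where
  "rapidly_decreasing = {f \<in> borel_measurable borel. \<forall>k. \<exists>C. \<forall>x. \<bar>f x\<bar> \<le> C * wt k x}"

lemma rapidly_decreasing_measurable: "f \<in> rapidly_decreasing \<Longrightarrow> f \<in> borel_measurable borel"
  by (simp add: rapidly_decreasing_def)

lemma rapidly_decreasing_bound:
  assumes "f \<in> rapidly_decreasing"
  obtains C where "0 < C" "\<And>x. \<bar>f x\<bar> \<le> C * wt k x"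
proof -
  obtain C where C: "\<And>x. \<bar>f x\<bar> \<le> C * wt k x"
    using assms unfolding rapidly_decreasing_def by blast
  have "\<bar>f x\<bar> \<le> (\<bar>C\<bar> + 1) * wt k x" for x
    using C[of x] mult_right_mono[of C "\<bar>C\<bar> + 1" "wt k x"] by (smt (verit) wt_nonneg)
  then show ?thesis
    by (intro that[of "\<bar>C\<bar> + 1"]) auto
qed

lemma integrable_wt_bound:
  fixes f :: "'a::euclidean_space \<Rightarrow> 'b::{banach, second_countable_topology}"
  assumes "f \<in> borel_measurable borel" "\<And>x. norm (f x) \<le> C * wt DIM('a) x"
  shows "integrable lborel f"
  by (rule Bochner_Integration.integrable_bound[of _ "\<lambda>x. C * wt DIM('a) x"])
     (use assms integrable_wt[where 'a='a] in \<open>auto intro: order_trans[OF _ abs_ge_self]\<close>)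

lemma rapidly_decreasing_integrable:
  fixes f :: "'a::euclidean_space \<Rightarrow> real"
  shows "f \<in> rapidly_decreasing \<Longrightarrow> integrable lborel f"
  using integrable_wt_bound[of f] rapidly_decreasing_measurable[of f] rapidly_decreasing_bound[of f "DIM('a)"]
  by (metis real_norm_def)

lemma rapidly_decreasing_dominated:
  assumes "f \<in> rapidly_decreasing" "g \<in> borel_measurable borel" "\<And>x. \<bar>g x\<bar> \<le> c * \<bar>f x\<bar>"
  shows "g \<in> rapidly_decreasing"
  unfolding rapidly_decreasing_def
proof (safe)
  fix k
  obtain C where C: "\<And>x. \<bar>f x\<bar> \<le> C * wt k x"
    using rapidly_decreasing_bound[OF assms(1)] by blast
  have "\<bar>g x\<bar> \<le> (\<bar>c\<bar> * C) * wt k x" for x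
  proof -
    have "\<bar>g x\<bar> \<le> \<bar>c\<bar> * \<bar>f x\<bar>"
      using assms(3)[of x] mult_right_mono[of c "\<bar>c\<bar>" "\<bar>f x\<bar>"] by (smt (verit) abs_ge_zero)
    also have "\<dots> \<le> \<bar>c\<bar> * (C * wt k x)" by (intro mult_left_mono C) auto
    finally show ?thesis by (simp add: mult_ac)
  qed
  then show "\<exists>C. \<forall>x. \<bar>g x\<bar> \<le> C * wt k x" by blast
qed (rule assms(2))

lemma rapidly_decreasing_add:
  assumes "f \<in> rapidly_decreasing" "g \<in> rapidly_decreasing"
  shows "(\<lambda>x. f x + g x) \<in> rapidly_decreasing"
  unfolding rapidly_decreasing_def
proof safe
  fix k
  obtain C D where "\<And>x. \<bar>f x\<bar> \<le> C * wt k x" "\<And>x. \<bar>g x\<bar> \<le> D * wt k x"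
    using rapidly_decreasing_bound assms by metis
  then have "\<bar>f x + g x\<bar> \<le> (C + D) * wt k x" for x
    by (smt (verit, best) distrib_right)
  then show "\<exists>C. \<forall>x. \<bar>f x + g x\<bar> \<le> C * wt k x" by blast
qed (use assms[THEN rapidly_decreasing_measurable] in measurable)

lemma rapidly_decreasing_scale:
  "f \<in> rapidly_decreasing \<Longrightarrow> (\<lambda>x. c * f x) \<in> rapidly_decreasing"
  by (rule rapidly_decreasing_dominated[where c="\<bar>c\<bar>"])
     (auto simp: abs_mult dest: rapidly_decreasing_measurable)

lemma rapidly_decreasing_0: "(\<lambda>x. 0) \<in> rapidly_decreasing"
  unfolding rapidly_decreasing_def by (auto intro!: exI[of _ 0])

lemma rapidly_decreasing_sum:
  "(\<And>i. i \<in> I \<Longrightarrow> f i \<in> rapidly_decreasing) \<Longrightarrow> (\<lambda>x. \<Sum>i\<in>I. f i x) \<in> rapidly_decreasing"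
  by (induction I rule: infinite_finite_induct)
     (auto intro: rapidly_decreasing_0 rapidly_decreasing_add)

lemma rapidly_decreasing_refl_fun:
  assumes "f \<in> rapidly_decreasing"
  shows "refl_fun f \<in> rapidly_decreasing"
  unfolding rapidly_decreasing_def
proof safe
  show "refl_fun f \<in> borel_measurable borel"
    using rapidly_decreasing_measurable[OF assms] unfolding refl_fun_def[abs_def] by measurable
  show "\<exists>C. \<forall>x. \<bar>refl_fun f x\<bar> \<le> C * wt k x" for k
    by (metis refl_fun_def wt_minus rapidly_decreasing_bound[OF assms])
qed

lemma rapidly_decreasing_indicator:
  fixes A :: "'a::euclidean_space set"
  assumes "bounded A" "A \<in> sets borel"
  shows "indicator A \<in> rapidly_decreasing"
  unfolding rapidly_decreasing_def
proof safe
  fix k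
  obtain R where R: "\<And>x. x \<in> A \<Longrightarrow> norm x \<le> R"
    using assms(1) bounded_iff by blast
  have "\<bar>indicator A x\<bar> \<le> (1 + R\<^sup>2) ^ k * wt k x" for x :: 'a
  proof (cases "x \<in> A")
    case True
    then have "(1 + (norm x)\<^sup>2) ^ k \<le> (1 + R\<^sup>2) ^ k"
      using R[OF True] by (intro power_mono add_left_mono) auto
    then show ?thesis using True by (simp add: wt_def add_pos_nonneg)
  qed simp
  then show "\<exists>C. \<forall>x. \<bar>indicator A x\<bar> \<le> C * wt k x" by blast
qed (use assms in measurable)

lemma schwartz_differentiable:
  "f \<in> schwartz \<Longrightarrow> set bs \<subseteq> Basis \<Longrightarrow> iter_partial bs f differentiable (at x)"
  by (auto simp: schwartz_def)

lemma schwartz_iter_partial_rapidly_decreasing: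
  assumes "f \<in> schwartz" "set bs \<subseteq> Basis"
  shows "iter_partial bs f \<in> rapidly_decreasing"
  unfolding rapidly_decreasing_def
proof safe
  have "continuous_on UNIV (iter_partial bs f)"
    using schwartz_differentiable[OF assms]
    by (auto intro!: continuous_at_imp_continuous_on differentiable_imp_continuous_within)
  then show "iter_partial bs f \<in> borel_measurable borel"
    by (rule borel_measurable_continuous_onI)
  fix k :: nat
  have "\<exists>B. \<forall>x. \<bar>norm x ^ k * iter_partial bs f x\<bar> \<le> B" for k
    using assms unfolding schwartz_def bounded_iff by auto
  \<comment> \<open>The orders 2k and 0 suffice, since (1 + r)^k <= 2^k (1 + r^k) with r =
    |x|^2.\<close>
  then obtain B C where B: "\<And>x. \<bar>norm x ^ (2 * k) * iter_partial bs f x\<bar> \<le> B"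
    and C: "\<And>x. \<bar>norm x ^ 0 * iter_partial bs f x\<bar> \<le> C" by metis
  have "\<bar>iter_partial bs f x\<bar> \<le> 2 ^ k * (B + C) * wt k x" for x
  proof -
    let ?r = "(norm x)\<^sup>2"
    have "(1 + ?r) ^ k \<le> (2 * max 1 ?r) ^ k"
      by (intro power_mono) auto
    also have "\<dots> = 2 ^ k * max 1 ?r ^ k" by (simp add: power_mult_distrib)
    also have "\<dots> \<le> 2 ^ k * (1 + ?r ^ k)"
      by (intro mult_left_mono) (auto simp: max_def)
    finally have "(1 + ?r) ^ k * \<bar>iter_partial bs f x\<bar> \<le> 2 ^ k * (1 + ?r ^ k) * \<bar>iter_partial bs f x\<bar>"
      by (rule mult_right_mono) auto
    also have "\<dots> = 2 ^ k * (\<bar>norm x ^ 0 * iter_partial bs f x\<bar> + \<bar>norm x ^ (2 * k) * iter_partial bs f x\<bar>)"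
      by (simp add: abs_mult power_mult[symmetric] algebra_simps)
    also have "\<dots> \<le> 2 ^ k * (C + B)"
      by (intro mult_left_mono add_mono B C) auto
    finally show ?thesis
      by (simp add: wt_def add_pos_nonneg field_simps)
  qed
  then show "\<exists>C. \<forall>x. \<bar>iter_partial bs f x\<bar> \<le> C * wt k x" by blast
qed

lemmas schwartz_rapidly_decreasing =
  schwartz_iter_partial_rapidly_decreasing[where bs="[]", simplified]

lemma schwartzI:
  assumes "\<And>bs x. set bs \<subseteq> Basis \<Longrightarrow> iter_partial bs f differentiable (at x)"
    and "\<And>bs. set bs \<subseteq> Basis \<Longrightarrow> iter_partial bs f \<in> rapidly_decreasing"
  shows "f \<in> schwartz"
  unfolding schwartz_def
proof (safe)
  fix bs :: "'a list" and k :: nat assume bs: "set bs \<subseteq> Basis"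
  obtain C where C: "\<And>x. \<bar>iter_partial bs f x\<bar> \<le> C * wt k x"
    using rapidly_decreasing_bound[OF assms(2)[OF bs]] by blast
  have "\<bar>norm x ^ k * iter_partial bs f x\<bar> \<le> C" for x
  proof -
    have "norm x \<le> 1 + (norm x)\<^sup>2"
      using sum_squares_bound[of 1 "norm x"] by (simp add: power2_eq_square)
        (smt (verit) norm_ge_zero)
    then have "norm x ^ k \<le> (1 + (norm x)\<^sup>2) ^ k" by (intro power_mono) auto
    then have "norm x ^ k * wt k x \<le> 1"
      by (simp add: wt_def add_pos_nonneg)
    moreover have "0 \<le> C" using C[of 0] by (auto simp: wt_def)
    ultimately have "C * (norm x ^ k * wt k x) \<le> C"
      by (simp add: mult_left_le)
    moreover have "norm x ^ k * \<bar>iter_partial bs f x\<bar> \<le> norm x ^ k * (C * wt k x)"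
      by (intro mult_left_mono C) auto
    ultimately show ?thesis by (simp add: abs_mult mult_ac)
  qed
  then show "bounded (range (\<lambda>x. norm x ^ k * iter_partial bs f x))"
    by (auto simp: bounded_iff)
qed (use assms in auto)

section \<open>Convolution with a Schwartz function\<close>

text \<open>An iterated partial is the value of a total derivative on a basis vector, so linearity
  recovers the whole derivative from the partials of the next order.\<close>

lemma has_derivative_iter_partial:
  assumes "f \<in> schwartz" "set bs \<subseteq> Basis"
  shows "(iter_partial bs f has_derivative (\<lambda>h. \<Sum>b\<in>Basis. (h \<bullet> b) * iter_partial (b # bs) f x)) (at x)"
proof -
  let ?D = "frechet_derivative (iter_partial bs f) (at x)"
  have D: "(iter_partial bs f has_derivative ?D) (at x)"
    using schwartz_differentiable[OF assms] frechet_derivative_works by blast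
  have "?D = (\<lambda>h. \<Sum>b\<in>Basis. (h \<bullet> b) * iter_partial (b # bs) f x)"
  proof
    fix h
    have "?D h = ?D (\<Sum>b\<in>Basis. (h \<bullet> b) *\<^sub>R b)"
      by (simp only: euclidean_representation)
    also have "\<dots> = (\<Sum>b\<in>Basis. (h \<bullet> b) * iter_partial (b # bs) f x)"
      by (simp only: linear_sum[OF has_derivative_linear[OF D]] iter_partial.simps
          linear_scale[OF has_derivative_linear[OF D]] real_scaleR_def)
    finally show "?D h = (\<Sum>b\<in>Basis. (h \<bullet> b) * iter_partial (b # bs) f x)" .
  qed
  from D[unfolded this] show ?thesis .
qed

lemma onorm_sum_inner_le:
  fixes g :: "'a::euclidean_space \<Rightarrow> real"
  assumes "\<And>b. b \<in> Basis \<Longrightarrow> \<bar>g b\<bar> \<le> C"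
  shows "onorm (\<lambda>h. \<Sum>b\<in>Basis. (h \<bullet> b) * g b) \<le> real DIM('a) * C"
proof (rule onorm_le)
  fix h :: 'a
  have "norm (\<Sum>b\<in>Basis. (h \<bullet> b) * g b) \<le> (\<Sum>b\<in>(Basis::'a set). norm h * C)"
    by (rule sum_norm_le) (auto simp: abs_mult Basis_le_norm assms intro!: mult_mono)
  then show "norm (\<Sum>b\<in>Basis. (h \<bullet> b) * g b) \<le> DIM('a) * C * norm h"
    by (simp add: mult_ac)
qed

lemma schwartz_bounded_iter_partial:
  assumes "f \<in> schwartz" "set bs \<subseteq> Basis"
  obtains C where "0 < C" "\<And>x b. b \<in> Basis \<Longrightarrow> \<bar>iter_partial (b # bs) f x\<bar> \<le> C"
proof -
  have "\<forall>b\<in>Basis. \<exists>C>0. \<forall>x. \<bar>iter_partial (b # bs) f x\<bar> \<le> C"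
  proof
    fix b :: 'a assume "b \<in> Basis"
    then have "iter_partial (b # bs) f \<in> rapidly_decreasing"
      using assms by (intro schwartz_iter_partial_rapidly_decreasing) auto
    then obtain C where "0 < C" "\<And>x. \<bar>iter_partial (b # bs) f x\<bar> \<le> C * wt 0 x"
      by (rule rapidly_decreasing_bound[where k=0]) blast
    then show "\<exists>C>0. \<forall>x. \<bar>iter_partial (b # bs) f x\<bar> \<le> C" by auto
  qed
  then obtain C where C: "\<And>b. b \<in> Basis \<Longrightarrow> C b > 0"
    "\<And>b x. b \<in> Basis \<Longrightarrow> \<bar>iter_partial (b # bs) f x\<bar> \<le> C b"
    by metis
  have "C b \<le> (\<Sum>b\<in>Basis. C b)" if "b \<in> Basis" for b
    using that C(1) by (intro member_le_sum) (auto intro: less_imp_le)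
  moreover have "0 < (\<Sum>b\<in>Basis. C b)"
    by (rule sum_pos) (auto intro: C)
  ultimately show ?thesis
    using C(2) by (intro that[of "\<Sum>b\<in>Basis. C b"]) (auto intro: order_trans)
qed

text \<open>The quadratic bound on the Taylor remainder makes differentiation under the integral a
  direct estimate.\<close>

lemma schwartz_taylor:
  assumes "f \<in> schwartz" "set bs \<subseteq> Basis"
  obtains C where "0 < C" "\<And>x h. \<bar>iter_partial bs f (x + h) - iter_partial bs f x -
     (\<Sum>b\<in>Basis. (h \<bullet> b) * iter_partial (b # bs) f x)\<bar> \<le> C * (norm h)\<^sup>2"
proof -
  let ?d = "real DIM('a)"
  \<comment> \<open>The partials of the next order are Lipschitz, because those of the order after
    it are bounded.\<close>
  have "\<forall>b\<in>Basis. \<exists>C>0. \<forall>x y. \<bar>iter_partial (b # bs) f x - iter_partial (b # bs) f y\<bar> \<le> C * norm (x - y)"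
  proof
    fix b :: 'a assume b: "b \<in> Basis"
    then have bs: "set (b # bs) \<subseteq> Basis" using assms by simp
    obtain C where C: "0 < C" "\<And>x b'. b' \<in> Basis \<Longrightarrow> \<bar>iter_partial (b' # b # bs) f x\<bar> \<le> C"
      using schwartz_bounded_iter_partial[OF assms(1) bs] by blast
    have "norm (iter_partial (b # bs) f x - iter_partial (b # bs) f y) \<le> ?d * C * norm (x - y)" for x y
    proof (rule differentiable_bound[where S=UNIV])
      show "(iter_partial (b # bs) f has_derivative
          (\<lambda>h. \<Sum>b'\<in>Basis. (h \<bullet> b') * iter_partial (b' # b # bs) f z)) (at z within UNIV)" for z
        by (rule has_derivative_iter_partial[OF assms(1) bs])
      show "onorm (\<lambda>h. \<Sum>b'\<in>Basis. (h \<bullet> b') * iter_partial (b' # b # bs) f z) \<le> ?d * C" for z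
        by (rule onorm_sum_inner_le[OF C(2)])
    qed auto
    then show "\<exists>C>0. \<forall>x y. \<bar>iter_partial (b # bs) f x - iter_partial (b # bs) f y\<bar> \<le> C * norm (x - y)"
      using C(1) by (intro exI[of _ "?d * C"]) (auto simp del: iter_partial.simps)
  qed
  then obtain C where C: "\<And>b. b \<in> Basis \<Longrightarrow> C b > 0"
    "\<And>b x y. b \<in> Basis \<Longrightarrow> \<bar>iter_partial (b # bs) f x - iter_partial (b # bs) f y\<bar> \<le> C b * norm (x - y)"
    by metis
  define L where "L = (\<Sum>b\<in>Basis. C b)"
  have L: "C b \<le> L" if "b \<in> Basis" for b
    using that C(1) unfolding L_def by (intro member_le_sum) (auto intro: less_imp_le)
  have L0: "0 < L"
    unfolding L_def by (rule sum_pos) (auto intro: C)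
  have "\<bar>iter_partial bs f (x + h) - iter_partial bs f x -
     (\<Sum>b\<in>Basis. (h \<bullet> b) * iter_partial (b # bs) f x)\<bar> \<le> (?d * L) * (norm h)\<^sup>2" for x h
  proof -
    let ?f' = "\<lambda>x h. \<Sum>b\<in>Basis. (h \<bullet> b) * iter_partial (b # bs) f x"
    have "norm (iter_partial bs f (x + h) - iter_partial bs f x - ?f' x (x + h - x))
        \<le> norm (x + h - x) * (?d * (L * norm h))"
    \<comment> \<open>On the ball of radius |h| about x the derivative differs from the one at x by
      O(|h|) in operator norm; multiplying by the increment |h| gives the square.\<close>
    proof (rule differentiable_bound_linearization[where S="cball x (norm h)"])
      fix y assume y: "y \<in> cball x (norm h)"
      show "(iter_partial bs f has_derivative ?f' y) (at y within cball x (norm h))"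
        by (rule has_derivative_at_withinI[OF has_derivative_iter_partial[OF assms]])
      have "?f' y - ?f' x = (\<lambda>h. \<Sum>b\<in>Basis. (h \<bullet> b) * (iter_partial (b # bs) f y - iter_partial (b # bs) f x))"
        by (simp add: fun_eq_iff sum_subtractf right_diff_distrib)
      moreover have "\<bar>iter_partial (b # bs) f y - iter_partial (b # bs) f x\<bar> \<le> L * norm h" if "b \<in> Basis" for b
        using C(2)[OF that, of y x] y L[OF that] L0
        by (smt (verit) mem_cball dist_norm norm_minus_commute mult_mono norm_ge_zero)
      ultimately show "onorm (?f' y - ?f' x) \<le> ?d * (L * norm h)"
        using onorm_sum_inner_le[of "\<lambda>b. iter_partial (b # bs) f y - iter_partial (b # bs) f x" "L * norm h"]
        by simp
    qed (auto simp: dist_norm mult_left_le_one_le)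
    then show ?thesis by (simp add: power2_eq_square mult_ac)
  qed
  then show ?thesis using L0 by (intro that[of "?d * L"]) (auto simp: DIM_positive)
qed

lemma integrable_convol:
  fixes f g :: "'a::euclidean_space \<Rightarrow> real"
  assumes [measurable]: "f \<in> borel_measurable borel" and f: "\<And>x. \<bar>f x\<bar> \<le> C"
    and g: "integrable lborel g"
  shows "integrable lborel (\<lambda>y. f (x - y) * g y)"
proof (rule Bochner_Integration.integrable_bound)
  show "integrable lborel (\<lambda>y. C * g y)" using g by simp
  have [measurable]: "g \<in> borel_measurable borel"
    using borel_measurable_integrable[OF g] by simp
  show "(\<lambda>y. f (x - y) * g y) \<in> borel_measurable lborel" by measurable
  have "\<bar>f (x - y)\<bar> * \<bar>g y\<bar> \<le> \<bar>C\<bar> * \<bar>g y\<bar>" for y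
    using f[of "x - y"] by (intro mult_right_mono) auto
  then show "AE y in lborel. norm (f (x - y) * g y) \<le> norm (C * g y)"
    by (simp add: abs_mult)
qed

lemma has_derivative_convol:
  assumes f: "f \<in> schwartz" and bs: "set bs \<subseteq> Basis" and g: "integrable lborel g"
  shows "(convol (iter_partial bs f) g has_derivative
     (\<lambda>h. \<Sum>b\<in>Basis. (h \<bullet> b) * convol (iter_partial (b # bs) f) g x)) (at x)"
proof -
  obtain C where C: "0 < C" "\<And>x h. \<bar>iter_partial bs f (x + h) - iter_partial bs f x -
     (\<Sum>b\<in>Basis. (h \<bullet> b) * iter_partial (b # bs) f x)\<bar> \<le> C * (norm h)\<^sup>2"
    using schwartz_taylor[OF f bs] by blast
  have int: "integrable lborel (\<lambda>y. iter_partial cs f (x - y) * g y)" if cs: "set cs \<subseteq> Basis" for cs x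
  proof -
    obtain B where "\<And>x. \<bar>iter_partial cs f x\<bar> \<le> B * wt 0 x"
      using rapidly_decreasing_bound[OF schwartz_iter_partial_rapidly_decreasing[OF f cs], of 0] by blast
    then show ?thesis
      by (intro integrable_convol[OF rapidly_decreasing_measurable[OF
            schwartz_iter_partial_rapidly_decreasing[OF f cs]] _ g]) simp
  qed
  let ?F = "convol (iter_partial bs f) g"
  let ?D = "\<lambda>h. \<Sum>b\<in>Basis. (h \<bullet> b) * convol (iter_partial (b # bs) f) g x"
  let ?K = "C * (\<integral>y. \<bar>g y\<bar> \<partial>lborel)"
  have bound: "\<bar>?F (x + h) - ?F x - ?D h\<bar> \<le> ?K * (norm h)\<^sup>2" for h
  proof -
    let ?r = "\<lambda>y. iter_partial bs f (x + h - y) - iter_partial bs f (x - y) -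
       (\<Sum>b\<in>Basis. (h \<bullet> b) * iter_partial (b # bs) f (x - y))"
    have i2: "integrable lborel (\<lambda>y. \<Sum>b\<in>Basis. (h \<bullet> b) * (iter_partial (b # bs) f (x - y) * g y))"
      using bs by (intro Bochner_Integration.integrable_sum integrable_mult_right int) auto
    have "?D h = (\<integral>y. (\<Sum>b\<in>Basis. (h \<bullet> b) * (iter_partial (b # bs) f (x - y) * g y)) \<partial>lborel)"
      unfolding convol_def using bs
      by (subst Bochner_Integration.integral_sum)
         (auto intro!: Bochner_Integration.integrable_sum integrable_mult_right int sum.cong
           simp del: iter_partial.simps)
    then have "?F (x + h) - ?F x - ?D h = (\<integral>y. iter_partial bs f (x + h - y) * g y - iter_partial bs f (x - y) * g y
        - (\<Sum>b\<in>Basis. (h \<bullet> b) * (iter_partial (b # bs) f (x - y) * g y)) \<partial>lborel)"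
      unfolding convol_def using bs i2
      by (simp add: Bochner_Integration.integral_diff int del: iter_partial.simps)
    also have "\<dots> = (\<integral>y. ?r y * g y \<partial>lborel)"
      by (simp add: left_diff_distrib sum_distrib_right mult.assoc)
    finally have eq: "?F (x + h) - ?F x - ?D h = (\<integral>y. ?r y * g y \<partial>lborel)" .
    have "norm (\<integral>y. ?r y * g y \<partial>lborel) \<le> (\<integral>y. (C * (norm h)\<^sup>2) * \<bar>g y\<bar> \<partial>lborel)"
    proof (rule Bochner_Integration.integral_norm_bound_integral)
      have "integrable lborel (\<lambda>y. iter_partial bs f (x + h - y) * g y - iter_partial bs f (x - y) * g y
        - (\<Sum>b\<in>Basis. (h \<bullet> b) * (iter_partial (b # bs) f (x - y) * g y)))"
        using bs i2 by (auto intro!: int)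
      then show "integrable lborel (\<lambda>y. ?r y * g y)"
        by (simp add: left_diff_distrib sum_distrib_right mult.assoc)
      show "norm (?r y * g y) \<le> C * (norm h)\<^sup>2 * \<bar>g y\<bar>" for y
        unfolding real_norm_def abs_mult diff_add_eq[symmetric] using C(2)[of "x - y" h]
        by (intro mult_right_mono) auto
    qed (use g in auto)
    then show ?thesis using eq by (simp add: mult_ac)
  qed
  have K: "0 \<le> ?K" using C(1) by (simp add: integral_nonneg_AE)
  show ?thesis
    unfolding has_derivative_at
  proof safe
    show "bounded_linear ?D"
      by (intro bounded_linear_sum bounded_linear_mult_const bounded_linear_inner_left)
    have "(\<lambda>h. ?K * norm h) \<midarrow>(0::'a)\<rightarrow> ?K * norm (0::'a)"
      by (rule tendsto_mult[OF tendsto_const tendsto_norm[OF tendsto_ident_at]])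
    then have lim: "(\<lambda>h. ?K * norm h) \<midarrow>(0::'a)\<rightarrow> 0" by simp
    have "\<forall>\<^sub>F h in at 0. norm (norm (?F (x + h) - ?F x - ?D h) / norm h) \<le> ?K * norm h"
      unfolding eventually_at_filter
    proof (intro always_eventually allI impI)
      fix h :: 'a assume "h \<noteq> 0"
      then show "norm (norm (?F (x + h) - ?F x - ?D h) / norm h) \<le> ?K * norm h"
        using bound[of h] by (simp add: power2_eq_square field_simps)
    qed
    then show "(\<lambda>h. norm (?F (x + h) - ?F x - ?D h) / norm h) \<midarrow>0\<rightarrow> 0"
      using lim by (rule Lim_null_comparison)
  qed
qed

text \<open>All derivatives fall on the Schwartz factor. This is what makes the mollification of a
  discontinuous integrable function smooth.\<close>

lemma iter_partial_convol:
  assumes f: "f \<in> schwartz" and bs: "set bs \<subseteq> Basis" and g: "integrable lborel g"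
  shows "iter_partial bs (convol f g) = convol (iter_partial bs f) g"
  using bs
proof (induction bs)
  case (Cons b bs)
  then have bs: "set bs \<subseteq> Basis" and b: "b \<in> Basis" by auto
  show ?case
  proof
    fix x
    have "frechet_derivative (convol (iter_partial bs f) g) (at x)
        = (\<lambda>h. \<Sum>b\<in>Basis. (h \<bullet> b) * convol (iter_partial (b # bs) f) g x)"
      using has_derivative_convol[OF f bs g] by (rule frechet_derivative_at[symmetric])
    then show "iter_partial (b # bs) (convol f g) x = convol (iter_partial (b # bs) f) g x"
      using Cons.IH[OF bs] b
      by (simp add: inner_Basis if_distrib[of "\<lambda>x. x * _"] sum.delta cong: if_cong)
  qed
qed simp

text \<open>Of the k + d powers carried by \<open>g\<close>, k combine with those of
  \<open>f\<close> by Peetre's inequality into \<open>wt k x\<close>, and the remaining d make the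
  integral over y finite.\<close>

lemma convol_wt_bound:
  fixes f g :: "'a::euclidean_space \<Rightarrow> real"
  assumes "\<And>x. \<bar>f x\<bar> \<le> A * wt k x" "\<And>x. \<bar>g x\<bar> \<le> B * wt (k + DIM('a)) x" "0 \<le> A" "0 \<le> B"
  shows "\<bar>convol f g x\<bar> \<le> A * B * 2 ^ k * (\<integral>y. wt DIM('a) (y::'a) \<partial>lborel) * wt k x"
proof -
  have bd: "norm (f (x - y) * g y) \<le> (A * B * 2 ^ k * wt k x) * wt DIM('a) y" for y
  proof -
    have "norm (f (x - y) * g y) \<le> (A * wt k (x - y)) * (B * (wt k y * wt DIM('a) y))"
      unfolding real_norm_def abs_mult using assms(1)[of "x - y"] assms(2)[of y] assms(3,4)
      by (intro mult_mono) (auto simp: wt_add)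
    also have "\<dots> = A * B * wt DIM('a) y * (wt k (x - y) * wt k y)" by (simp add: mult_ac)
    also have "\<dots> \<le> A * B * wt DIM('a) y * (2 ^ k * wt k (x - y + y))"
      using assms(3,4) by (intro mult_left_mono wt_add_mult) auto
    finally show ?thesis by (simp add: mult_ac)
  qed
  have "norm (convol f g x) \<le> (\<integral>y. (A * B * 2 ^ k * wt k x) * wt DIM('a) (y::'a) \<partial>lborel)"
    unfolding convol_def
  proof (cases "integrable lborel (\<lambda>y. f (x - y) * g y)")
    case True
    then show "norm (\<integral>y. f (x - y) * g y \<partial>lborel) \<le> (\<integral>y. (A * B * 2 ^ k * wt k x) * wt DIM('a) (y::'a) \<partial>lborel)"
      by (intro Bochner_Integration.integral_norm_bound_integral bd integrable_mult_right integrable_wt)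
  next
    \<comment> \<open>A non-integrable integrand has integral 0, which lies below the nonnegative
      bound.\<close>
    case False
    then show "norm (\<integral>y. f (x - y) * g y \<partial>lborel) \<le> (\<integral>y. (A * B * 2 ^ k * wt k x) * wt DIM('a) (y::'a) \<partial>lborel)"
      using assms(3,4) by (auto simp: not_integrable_integral_eq intro!: integral_nonneg_AE mult_nonneg_nonneg)
  qed
  then show ?thesis by (simp add: mult_ac)
qed

lemma convol_measurable [measurable]:
  assumes [measurable]: "f \<in> borel_measurable borel" "g \<in> borel_measurable borel"
  shows "convol f g \<in> borel_measurable borel"
  unfolding convol_def[abs_def] by measurable

lemma rapidly_decreasing_convol:
  assumes f: "f \<in> rapidly_decreasing" and g: "g \<in> rapidly_decreasing"
  shows "convol f g \<in> rapidly_decreasing"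
  unfolding rapidly_decreasing_def
proof safe
  show "convol f g \<in> borel_measurable borel"
    using f g by (intro convol_measurable rapidly_decreasing_measurable)
  fix k
  obtain A B where "0 < A" "\<And>x. \<bar>f x\<bar> \<le> A * wt k x" "0 < B" "\<And>x. \<bar>g x\<bar> \<le> B * wt (k + DIM('a)) x"
    using rapidly_decreasing_bound f g by metis
  then show "\<exists>C. \<forall>x. \<bar>convol f g x\<bar> \<le> C * wt k x"
    using convol_wt_bound[of f A k g B] by (metis less_imp_le)
qed

text \<open>Smoothness comes from \<open>f\<close> alone, decay from both factors. With
  \<open>f\<close> a Gaussian this mollifies indicators; with g * refl g it supplies the test
  functions for \<open>is_fourier_transform\<close>.\<close>

lemma schwartz_convol:
  assumes f: "f \<in> schwartz" and g: "g \<in> rapidly_decreasing"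
  shows "convol f g \<in> schwartz"
proof (rule schwartzI)
  fix bs :: "'a list" and x assume bs: "set bs \<subseteq> Basis"
  note eq = iter_partial_convol[OF f bs rapidly_decreasing_integrable[OF g]]
  show "iter_partial bs (convol f g) differentiable at x"
    unfolding eq differentiable_def
    using has_derivative_convol[OF f bs rapidly_decreasing_integrable[OF g]] by blast
  show "iter_partial bs (convol f g) \<in> rapidly_decreasing"
    unfolding eq by (intro rapidly_decreasing_convol g schwartz_iter_partial_rapidly_decreasing f bs)
qed

section \<open>Fourier transforms and Gaussians\<close>

lemma integrable_fourier:
  fixes f :: "'a::euclidean_space \<Rightarrow> real"
  assumes "integrable lborel f"
  shows "integrable lborel (\<lambda>x. exp (- \<i> * complex_of_real (\<xi> \<bullet> x)) * complex_of_real (f x))"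
proof (rule Bochner_Integration.integrable_bound[OF assms])
  have [measurable]: "f \<in> borel_measurable borel"
    using borel_measurable_integrable[OF assms] by simp
  show "(\<lambda>x. exp (- \<i> * complex_of_real (\<xi> \<bullet> x)) * complex_of_real (f x)) \<in> borel_measurable lborel"
    by measurable
qed (simp add: norm_mult)

lemma fourier_measurable [measurable]:
  assumes [measurable]: "f \<in> borel_measurable borel"
  shows "fourier f \<in> borel_measurable borel"
  unfolding fourier_def[abs_def] by measurable

lemma fourier_add:
  "integrable lborel f \<Longrightarrow> integrable lborel g \<Longrightarrow> fourier (\<lambda>x. f x + g x) \<xi> = fourier f \<xi> + fourier g \<xi>"
  unfolding fourier_def of_real_add distrib_left
  by (intro Bochner_Integration.integral_add integrable_fourier)

lemma fourier_cmult: "fourier (\<lambda>x. c * f x) \<xi> = complex_of_real c * fourier f \<xi>"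
  unfolding fourier_def by (simp add: mult.left_commute)

lemma fourier_0 [simp]: "fourier (\<lambda>x. 0) \<xi> = 0"
  by (simp add: fourier_def)

lemma fourier_diff:
  "integrable lborel f \<Longrightarrow> integrable lborel g \<Longrightarrow> fourier (\<lambda>x. f x - g x) \<xi> = fourier f \<xi> - fourier g \<xi>"
  using fourier_add[of f "\<lambda>x. (-1) * g x"] fourier_cmult[of "-1" g] by simp

lemma fourier_sum:
  "(\<And>i. i \<in> I \<Longrightarrow> integrable lborel (f i)) \<Longrightarrow> fourier (\<lambda>x. \<Sum>i\<in>I. f i x) \<xi> = (\<Sum>i\<in>I. fourier (f i) \<xi>)"
  by (induction I rule: infinite_finite_induct) (auto simp: fourier_add)

lemma norm_fourier_le:
  "integrable lborel f \<Longrightarrow> cmod (fourier f \<xi>) \<le> (\<integral>x. \<bar>f x\<bar> \<partial>lborel)"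
  unfolding fourier_def
  by (rule order_trans[OF integral_norm_bound]) (simp add: norm_mult)

text \<open>For a real function the reflection x -> -x conjugates the kernel, hence the transform.
  Together with the convolution theorem this gives F (g * refl g) = |F g|^2.\<close>

lemma fourier_refl_fun:
  assumes [measurable]: "f \<in> borel_measurable borel"
  shows "fourier (refl_fun f) \<xi> = cnj (fourier f \<xi>)"
proof -
  have "fourier (refl_fun f) \<xi> = (\<integral>x. exp (\<i> * complex_of_real (\<xi> \<bullet> x)) * complex_of_real (f x) \<partial>lborel)"
    unfolding fourier_def refl_fun_def
    using integral_affine(1)[of "\<lambda>x. exp (\<i> * complex_of_real (\<xi> \<bullet> x)) * complex_of_real (f x)" "-1" 0]
    by simp
  also have "\<dots> = cnj (fourier f \<xi>)"
    unfolding fourier_def by (subst Bochner_Integration.integral_cnj[symmetric]) (simp add: exp_cnj)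
  finally show ?thesis .
qed

lemma fourier_convol:
  fixes f g :: "'a::euclidean_space \<Rightarrow> real"
  assumes f: "integrable lborel f" and g: "integrable lborel g"
  shows "fourier (convol f g) \<xi> = fourier f \<xi> * fourier g \<xi>"
proof -
  have [measurable]: "f \<in> borel_measurable borel" "g \<in> borel_measurable borel"
    using f g borel_measurable_integrable by fastforce+
  let ?e = "\<lambda>x. exp (- \<i> * complex_of_real (\<xi> \<bullet> x))"
  \<comment> \<open>The order (y, x) puts the translate f (x - y) in the inner integral, whose
    absolute value then integrates to |g y| times the L^1 norm of \<open>f\<close>.\<close>
  let ?k = "\<lambda>(y, x). ?e x * complex_of_real (f (x - y) * g y)"
  have shift: "integrable lborel (\<lambda>x. f (x - y))" "(\<integral>x. \<bar>f (x - y)\<bar> \<partial>lborel) = (\<integral>x. \<bar>f x\<bar> \<partial>lborel)" for y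
    using integral_affine(2)[of f 1 "- y"] integral_affine(1)[of "\<lambda>x. \<bar>f x\<bar>" 1 "- y"] f by simp_all
  have int: "integrable (lborel \<Otimes>\<^sub>M lborel) ?k"
  proof (rule lborel_pair.Fubini_integrable)
    show "?k \<in> borel_measurable (lborel \<Otimes>\<^sub>M lborel)" by measurable
    show "integrable lborel (\<lambda>y. \<integral>x. norm (?k (y, x)) \<partial>lborel)"
      using g by (simp add: norm_mult abs_mult shift(2))
    show "AE y in lborel. integrable lborel (\<lambda>x. ?k (y, x))"
      using integrable_fourier[OF integrable_mult_left[OF shift(1)], of \<xi>] by simp
  qed
  have "fourier (convol f g) \<xi> = (\<integral>x. (\<integral>y. ?k (y, x) \<partial>lborel) \<partial>lborel)"
    unfolding fourier_def convol_def
    by (simp only: case_prod_conv integral_mult_right_zero integral_complex_of_real)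
  also have "\<dots> = (\<integral>y. (\<integral>x. ?k (y, x) \<partial>lborel) \<partial>lborel)"
    using lborel_pair.Fubini_integral[of "\<lambda>y x. ?k (y, x)"] int by simp
  also have "\<dots> = (\<integral>y. fourier f \<xi> * (?e y * complex_of_real (g y)) \<partial>lborel)"
  proof (rule Bochner_Integration.integral_cong)
    fix y
    have "(\<integral>x. ?k (y, x) \<partial>lborel) = (\<integral>x. ?e (y + x) * complex_of_real (f x * g y) \<partial>lborel)"
      using integral_affine(1)[of "\<lambda>x. ?k (y, x)" 1 y] by simp
    also have "\<dots> = (\<integral>x. ?e x * complex_of_real (f x) * (?e y * complex_of_real (g y)) \<partial>lborel)"
      by (simp add: inner_add_right distrib_left exp_add exp_diff exp_minus divide_inverse mult_ac)
    also have "\<dots> = fourier f \<xi> * (?e y * complex_of_real (g y))"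
      unfolding fourier_def by simp
    finally show "(\<integral>x. ?k (y, x) \<partial>lborel) = fourier f \<xi> * (?e y * complex_of_real (g y))" .
  qed simp
  also have "\<dots> = fourier f \<xi> * fourier g \<xi>"
    unfolding fourier_def by simp
  finally show ?thesis .
qed

text \<open>Here \<open>s\<close> is the inverse of the standard deviation.\<close>

definition gauss :: "real \<Rightarrow> 'a::euclidean_space \<Rightarrow> real" where
  "gauss s x = s ^ DIM('a) * (\<Prod>b\<in>Basis. std_normal_density (s * (x \<bullet> b)))"

lemma power2_norm_eq_sum_Basis: "(norm x)\<^sup>2 = (\<Sum>b\<in>Basis. (x \<bullet> b)\<^sup>2)"
  using euclidean_inner[of x x] by (simp only: power2_norm_eq_inner) (simp only: power2_eq_square)

lemma gauss_eq:
  "gauss s (x::'a::euclidean_space) = (s / sqrt (2 * pi)) ^ DIM('a) * exp (- (s\<^sup>2 / 2) * (norm x)\<^sup>2)"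
proof -
  have "exp (- (s\<^sup>2 / 2) * (norm x)\<^sup>2) = (\<Prod>b\<in>Basis. exp (- (s * (x \<bullet> b))\<^sup>2 / 2))"
    by (simp add: power2_norm_eq_sum_Basis exp_sum[symmetric] sum_distrib_left power_mult_distrib)
  then show ?thesis
    by (simp add: gauss_def std_normal_density_def prod.distrib prod_dividef power_divide power_mult_distrib)
qed

lemma exp_neg_le_wt:
  fixes a :: real
  assumes "0 < a"
  obtains C where "0 < C" "\<And>x::'a::euclidean_space. exp (- a * (norm x)\<^sup>2) \<le> C * wt k x"
proof -
  \<comment> \<open>The k-th power of y / k <= exp (y / k). For k = 0 the claim reads 1 <= exp y, as
    0 ^ 0 = 1.\<close>
  have *: "y ^ k \<le> real k ^ k * exp y" if "0 \<le> y" for y :: real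
  proof (cases "k = 0")
    case False
    have "y / real k \<le> exp (y / real k)"
      using exp_ge_add_one_self[of "y / real k"] by linarith
    then have "(y / real k) ^ k \<le> exp (y / real k) ^ k"
      using that by (intro power_mono) auto
    then show ?thesis
      using False by (simp add: exp_of_nat_mult[symmetric] power_divide field_simps)
  qed (use that in simp)
  have "exp (- a * (norm x)\<^sup>2) \<le> (real k ^ k * exp a / a ^ k) * wt k x" for x :: 'a
  proof -
    \<comment> \<open>Taking y = a (1 + |x|^2) produces the full weight at once; the surplus factor
      exp a goes into the constant.\<close>
    have "(a * (1 + (norm x)\<^sup>2)) ^ k \<le> real k ^ k * exp (a * (1 + (norm x)\<^sup>2))"
      using assms by (intro *) auto
    then have "a ^ k * (1 + (norm x)\<^sup>2) ^ k \<le> real k ^ k * (exp a * exp (a * (norm x)\<^sup>2))"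
      unfolding power_mult_distrib by (simp add: distrib_left exp_add)
    then show ?thesis
      using assms by (simp add: wt_def exp_minus add_pos_nonneg field_simps)
  qed
  then show ?thesis using assms by (intro that[of "real k ^ k * exp a / a ^ k"]) (cases "k = 0", auto)
qed

section \<open>Products of polynomials and Gaussians are Schwartz functions\<close>

lemma real_polynomial_function_bound:
  fixes p :: "'a::euclidean_space \<Rightarrow> real"
  assumes "real_polynomial_function p"
  shows "\<exists>C n. 0 \<le> C \<and> (\<forall>x. \<bar>p x\<bar> \<le> C * (1 + (norm x)\<^sup>2) ^ n)"
  using assms
proof induction
  case (linear f)
  obtain K where K: "0 < K" "\<And>x. norm (f x) \<le> norm x * K"
    using bounded_linear.pos_bounded[OF linear] by blast
  have "\<bar>f x\<bar> \<le> K * (1 + (norm x)\<^sup>2) ^ 1" for x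
  proof -
    have "norm x \<le> 1 + (norm x)\<^sup>2"
      using sum_squares_bound[of 1 "norm x"] by (simp add: power2_eq_square)
        (smt (verit) norm_ge_zero)
    then have "norm x * K \<le> (1 + (norm x)\<^sup>2) * K"
      using K(1) by (intro mult_right_mono) auto
    then show ?thesis using K(2)[of x] by (simp add: mult_ac)
  qed
  then show ?case using K(1) less_imp_le by blast
next
  case (const c)
  show ?case by (intro exI[of _ "\<bar>c\<bar>"] exI[of _ 0]) auto
next
  case (add f g)
  then obtain C n D m where *: "0 \<le> C" "\<And>x. \<bar>f x\<bar> \<le> C * (1 + (norm x)\<^sup>2) ^ n"
    "0 \<le> D" "\<And>x. \<bar>g x\<bar> \<le> D * (1 + (norm x)\<^sup>2) ^ m" by blast
  have "\<bar>f x + g x\<bar> \<le> (C + D) * (1 + (norm x)\<^sup>2) ^ (n + m)" for x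
  proof -
    have "C * (1 + (norm x)\<^sup>2) ^ n \<le> C * (1 + (norm x)\<^sup>2) ^ (n + m)"
      "D * (1 + (norm x)\<^sup>2) ^ m \<le> D * (1 + (norm x)\<^sup>2) ^ (n + m)"
      using * by (auto intro!: mult_left_mono power_increasing)
    then show ?thesis
      using *(2)[of x] *(4)[of x] unfolding distrib_right by linarith
  qed
  then show ?case using * by (intro exI[of _ "C + D"] exI[of _ "n + m"]) auto
next
  case (mult f g)
  then obtain C n D m where *: "0 \<le> C" "\<And>x. \<bar>f x\<bar> \<le> C * (1 + (norm x)\<^sup>2) ^ n"
    "0 \<le> D" "\<And>x. \<bar>g x\<bar> \<le> D * (1 + (norm x)\<^sup>2) ^ m" by blast
  have "\<bar>f x * g x\<bar> \<le> (C * D) * (1 + (norm x)\<^sup>2) ^ (n + m)" for x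
    using mult_mono[OF *(2)[of x] *(4)[of x]] * by (simp add: abs_mult power_add mult_ac)
  then show ?case using * by (intro exI[of _ "C * D"] exI[of _ "n + m"]) auto
qed

text \<open>The derivative is kept together with the fact that it is polynomial in x for each fixed
  direction, which is the form that can be iterated along a list of basis vectors.\<close>

lemma real_polynomial_function_directional_derivative:
  fixes p :: "'a::real_normed_vector \<Rightarrow> real"
  assumes "real_polynomial_function p"
  shows "\<exists>p'. (\<forall>x. (p has_derivative p' x) (at x)) \<and> (\<forall>b. real_polynomial_function (\<lambda>x. p' x b))"
  using assms
proof induction
  case (linear f)
  then show ?case
    by (intro exI[of _ "\<lambda>_. f"]) (auto intro: bounded_linear_imp_has_derivative real_polynomial_function.intros(2))
next
  case (const c)
  show ?case by (intro exI[of _ "\<lambda>_ _. 0"]) auto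
next
  case (add f g)
  then obtain f' g' where "\<And>x. (f has_derivative f' x) (at x)" "\<And>b. real_polynomial_function (\<lambda>x. f' x b)"
    "\<And>x. (g has_derivative g' x) (at x)" "\<And>b. real_polynomial_function (\<lambda>x. g' x b)" by blast
  then show ?case
    by (intro exI[of _ "\<lambda>x b. f' x b + g' x b"]) (auto intro!: derivative_intros)
next
  case (mult f g)
  then obtain f' g' where *: "\<And>x. (f has_derivative f' x) (at x)" "\<And>b. real_polynomial_function (\<lambda>x. f' x b)"
    "\<And>x. (g has_derivative g' x) (at x)" "\<And>b. real_polynomial_function (\<lambda>x. g' x b)" by blast
  show ?case
    by (intro exI[of _ "\<lambda>x b. f x * g' x b + f' x b * g x"] conjI allI has_derivative_mult
        real_polynomial_function.intros(3,4) * mult.hyps)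
qed

text \<open>Induction needs the polynomial factor: differentiating q exp (-a |x|^2) in direction b
  replaces q by its directional derivative minus 2 a (x . b) q, and so stays in the class.\<close>

lemma iter_partial_polynomial_exp:
  fixes p :: "'a::euclidean_space \<Rightarrow> real"
  assumes p: "real_polynomial_function p"
  shows "\<exists>q. real_polynomial_function q \<and>
    iter_partial bs (\<lambda>x. p x * exp (- a * (norm x)\<^sup>2)) = (\<lambda>x. q x * exp (- a * (norm x)\<^sup>2))"
proof (induction bs)
  case Nil
  show ?case using p by auto
next
  case (Cons b bs)
  then obtain q where q: "real_polynomial_function q"
    and eq: "iter_partial bs (\<lambda>x. p x * exp (- a * (norm x)\<^sup>2)) = (\<lambda>x. q x * exp (- a * (norm x)\<^sup>2))" by blast
  obtain q' where q': "\<And>x. (q has_derivative q' x) (at x)" "\<And>b. real_polynomial_function (\<lambda>x. q' x b)"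
    using real_polynomial_function_directional_derivative[OF q] by blast
  have "((\<lambda>x. q x * exp (- a * (norm x)\<^sup>2)) has_derivative
     (\<lambda>h. q x * (exp (- a * (x \<bullet> x)) * (- a * (x \<bullet> h + h \<bullet> x))) + q' x h * exp (- a * (x \<bullet> x)))) (at x)" for x
    unfolding power2_norm_eq_inner by (auto intro!: derivative_eq_intros q'(1))
  then have D: "iter_partial (b # bs) (\<lambda>x. p x * exp (- a * (norm x)\<^sup>2)) x =
     (q' x b + q x * (- (2 * a) * (x \<bullet> b))) * exp (- a * (norm x)\<^sup>2)" for x
    unfolding iter_partial.simps eq
    by (subst frechet_derivative_at[symmetric])
       (assumption, simp add: power2_norm_eq_inner inner_commute algebra_simps)
  have "real_polynomial_function (\<lambda>x. q' x b + q x * (- (2 * a) * (x \<bullet> b)))"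
    by (rule real_polynomial_function.intros(3)[OF q'(2) real_polynomial_function.intros(4)[OF q
          real_polynomial_function.intros(4)[OF real_polynomial_function.intros(2)
            real_polynomial_function.intros(1)[OF bounded_linear_inner_left]]]])
  then show ?case using D by blast
qed

lemma schwartz_polynomial_exp:
  fixes p :: "'a::euclidean_space \<Rightarrow> real"
  assumes p: "real_polynomial_function p" and a: "0 < a"
  shows "(\<lambda>x. p x * exp (- a * (norm x)\<^sup>2)) \<in> schwartz"
proof (rule schwartzI)
  fix bs :: "'a list" and x :: 'a
  obtain q where q: "real_polynomial_function q"
    and eq: "iter_partial bs (\<lambda>x. p x * exp (- a * (norm x)\<^sup>2)) = (\<lambda>x. q x * exp (- a * (norm x)\<^sup>2))"
    using iter_partial_polynomial_exp[OF p] by blast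
  have [simp]: "q differentiable at x" for x
    using differentiable_at_real_polynomial_function[OF q] .
  have e: "(\<lambda>x. exp (- a * (norm x)\<^sup>2)) differentiable at x" for x :: 'a
    unfolding power2_norm_eq_inner differentiable_def by (rule exI, (rule derivative_eq_intros refl)+)
  show d: "iter_partial bs (\<lambda>x. p x * exp (- a * (norm x)\<^sup>2)) differentiable at x" for x
    unfolding eq by (intro differentiable_mult e) auto
  show "iter_partial bs (\<lambda>x. p x * exp (- a * (norm x)\<^sup>2)) \<in> rapidly_decreasing"
    unfolding rapidly_decreasing_def
  proof safe
    show "iter_partial bs (\<lambda>x. p x * exp (- a * (norm x)\<^sup>2)) \<in> borel_measurable borel"
      using d by (auto intro!: borel_measurable_continuous_onI continuous_at_imp_continuous_on
          differentiable_imp_continuous_within)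
    fix k
    obtain C n where C: "0 \<le> C" "\<And>x. \<bar>q x\<bar> \<le> C * (1 + (norm x)\<^sup>2) ^ n"
      using real_polynomial_function_bound[OF q] by blast
    \<comment> \<open>Of the n + k powers, n absorb the growth of the polynomial and k
      remain.\<close>
    obtain D where D: "0 < D" "\<And>x::'a. exp (- a * (norm x)\<^sup>2) \<le> D * wt (n + k) x"
      using exp_neg_le_wt[OF a] by blast
    have "\<bar>q x * exp (- a * (norm x)\<^sup>2)\<bar> \<le> (C * D) * wt k x" for x
    proof -
      have "\<bar>q x * exp (- a * (norm x)\<^sup>2)\<bar> \<le> (C * (1 + (norm x)\<^sup>2) ^ n) * (D * wt (n + k) x)"
        unfolding abs_mult using C(1) by (intro mult_mono C) (use D(2)[of x] in auto)
      also have "\<dots> = (C * D) * ((1 + (norm x)\<^sup>2) ^ n * wt n x * wt k x)"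
        by (simp add: wt_add mult_ac)
      also have "(1 + (norm x)\<^sup>2) ^ n * wt n x = 1"
        by (simp add: wt_def add_pos_nonneg less_imp_neq[symmetric])
      finally show ?thesis by simp
    qed
    then show "\<exists>C. \<forall>x. \<bar>iter_partial bs (\<lambda>x. p x * exp (- a * (norm x)\<^sup>2)) x\<bar> \<le> C * wt k x"
      unfolding eq by blast
  qed
qed

lemma schwartz_gauss:
  assumes "0 < s"
  shows "gauss s \<in> schwartz"
proof -
  have "(\<lambda>x::'a. (s / sqrt (2 * pi)) ^ DIM('a) * exp (- (s\<^sup>2 / 2) * (norm x)\<^sup>2)) \<in> schwartz"
    using assms by (intro schwartz_polynomial_exp real_polynomial_function.intros(2)) auto
  moreover have "(gauss s :: 'a \<Rightarrow> real) = (\<lambda>x. (s / sqrt (2 * pi)) ^ DIM('a) * exp (- (s\<^sup>2 / 2) * (norm x)\<^sup>2))"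
    by (rule ext) (rule gauss_eq)
  ultimately show ?thesis by simp
qed

lemma gauss_nonneg: "0 < s \<Longrightarrow> 0 \<le> gauss s x"
  by (simp add: gauss_def prod_nonneg)

lemma gauss_scale: "gauss s (x::'a::euclidean_space) = s ^ DIM('a) * gauss 1 (s *\<^sub>R x)"
  by (simp add: gauss_def)

lemma integral_gauss_scale:
  fixes f :: "'a::euclidean_space \<Rightarrow> 'b::{banach, second_countable_topology}"
  assumes [measurable]: "f \<in> borel_measurable borel" and s: "0 < s"
  shows "(\<integral>x. gauss s x *\<^sub>R f x \<partial>lborel) = (\<integral>x. gauss 1 x *\<^sub>R f (x /\<^sub>R s) \<partial>lborel)"
proof -
  have [measurable]: "gauss 1 \<in> borel_measurable (borel :: 'a measure)"
    by (intro rapidly_decreasing_measurable schwartz_rapidly_decreasing schwartz_gauss) simp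
  have "(\<integral>x. gauss 1 x *\<^sub>R f (x /\<^sub>R s) \<partial>lborel) = s ^ DIM('a) *\<^sub>R (\<integral>x. gauss 1 (s *\<^sub>R x) *\<^sub>R f x \<partial>lborel)"
    using integral_affine(1)[of "\<lambda>x. gauss 1 x *\<^sub>R f (x /\<^sub>R s)" s 0] s by simp
  also have "\<dots> = (\<integral>x. gauss s x *\<^sub>R f x \<partial>lborel)"
    unfolding gauss_scale[of s] by (simp flip: scaleR_scaleR)
  finally show ?thesis by simp
qed

text \<open>Kernel and density both factor over the coordinates, so the integral is a product of
  values of the characteristic function of the standard normal law, taken at -(\<xi> . b) because of
  the sign in \<open>fourier\<close>.\<close>

lemma fourier_gauss_1: "fourier (gauss 1) (\<xi>::'a::euclidean_space) = exp (- (norm \<xi>)\<^sup>2 / 2)"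
proof -
  interpret product_sigma_finite "\<lambda>_::'a. lborel :: real measure" ..
  let ?g = "\<lambda>b t. exp (- \<i> * complex_of_real ((\<xi> \<bullet> b) * t)) * complex_of_real (std_normal_density t)"
  have int: "integrable lborel (?g b)" for b
    using integrable_fourier[of std_normal_density "\<xi> \<bullet> b"] by simp
  have one: "(\<integral>t. ?g b t \<partial>lborel) = exp (- (\<xi> \<bullet> b)\<^sup>2 / 2)" for b
  proof -
    have "char std_normal_distribution (- (\<xi> \<bullet> b)) = (\<integral>t. ?g b t \<partial>lborel)"
      unfolding char_def by (subst integral_density) (auto simp: scaleR_conv_of_real mult_ac)
    then show ?thesis by (simp add: char_std_normal_distribution)
  qed
  have exp_prod: "exp (- \<i> * complex_of_real (\<xi> \<bullet> x)) = (\<Prod>b\<in>Basis. exp (- \<i> * complex_of_real ((\<xi> \<bullet> b) * (x \<bullet> b))))" for x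
    by (subst euclidean_inner[of \<xi> x]) (simp add: exp_sum sum_distrib_left sum_negf[symmetric])
  have "fourier (gauss 1) \<xi> = (\<integral>x. (\<Prod>b\<in>Basis. ?g b (x \<bullet> b)) \<partial>lborel)"
    unfolding fourier_def exp_prod gauss_def by (simp add: prod.distrib)
  also have "\<dots> = (\<integral>f. (\<Prod>b\<in>Basis. ?g b ((\<Sum>b\<in>Basis. f b *\<^sub>R b) \<bullet> b)) \<partial>(\<Pi>\<^sub>M b\<in>Basis. lborel))"
    by (subst lborel_eq) (subst integral_distr, auto)
  also have "\<dots> = (\<integral>f. (\<Prod>b\<in>Basis. ?g b (f b)) \<partial>(\<Pi>\<^sub>M b\<in>Basis. lborel))"
    by (intro Bochner_Integration.integral_cong refl prod.cong)
       (simp add: inner_sum_left inner_Basis if_distrib[of "\<lambda>x. _ * x"] sum.delta cong: if_cong)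
  also have "\<dots> = (\<Prod>b\<in>Basis. (\<integral>t. ?g b t \<partial>lborel))"
    by (rule product_integral_prod) (simp, rule int)
  also have "\<dots> = exp (- (norm \<xi>)\<^sup>2 / 2)"
    unfolding one
    by (simp add: exp_sum[symmetric] power2_norm_eq_sum_Basis sum_divide_distrib sum_negf flip: of_real_prod)
  finally show ?thesis .
qed

lemma fourier_gauss:
  assumes "0 < s"
  shows "fourier (gauss s) \<xi> = exp (- (norm \<xi>)\<^sup>2 / (2 * s\<^sup>2))"
proof -
  have "fourier (gauss s) \<xi> = (\<integral>x. gauss s x *\<^sub>R exp (- \<i> * complex_of_real (\<xi> \<bullet> x)) \<partial>lborel)"
    unfolding fourier_def by (simp add: scaleR_conv_of_real mult_ac)
  also have "\<dots> = (\<integral>x. gauss 1 x *\<^sub>R exp (- \<i> * complex_of_real (\<xi> \<bullet> (x /\<^sub>R s))) \<partial>lborel)"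
    by (rule integral_gauss_scale) (use assms in auto)
  also have "\<dots> = fourier (gauss 1) (\<xi> /\<^sub>R s)"
    unfolding fourier_def by (simp add: scaleR_conv_of_real mult_ac)
  also have "\<dots> = exp (- (norm \<xi>)\<^sup>2 / (2 * s\<^sup>2))"
    using assms by (simp add: fourier_gauss_1 power_mult_distrib field_simps)
  finally show ?thesis .
qed

section \<open>Spectral measures\<close>

lemma tempered_measure_wt:
  assumes "tempered_measure M"
  obtains k where "(\<integral>\<^sup>+x. ennreal (wt k x) \<partial>M) < \<infinity>"
  using assms unfolding tempered_measure_def wt_def by blast

lemma tempered_measure_sets: "tempered_measure M \<Longrightarrow> sets M = sets borel"
  by (simp add: tempered_measure_def)

lemma tempered_measure_space: "tempered_measure M \<Longrightarrow> space M = UNIV"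
  by (drule tempered_measure_sets, drule sets_eq_imp_space_eq) simp

text \<open>On a ball \<open>wt k\<close> is bounded below, so balls have finite measure.
  Sigma-finiteness is what Tonelli's theorem on the time-frequency product asks for.\<close>

lemma tempered_measure_sigma_finite:
  fixes M :: "'a::euclidean_space measure"
  assumes M: "tempered_measure M"
  shows "sigma_finite_measure M"
proof
  note [measurable_cong] = tempered_measure_sets[OF M]
  obtain k where k: "(\<integral>\<^sup>+x. ennreal (wt k x) \<partial>M) < \<infinity>"
    using tempered_measure_wt[OF M] .
  have fin: "emeasure M (cball 0 (real n)) \<noteq> \<infinity>" for n
  proof -
    have "emeasure M (cball 0 (real n)) = (\<integral>\<^sup>+x. indicator (cball 0 (real n)) x \<partial>M)"
      by simp
    also have "\<dots> \<le> (\<integral>\<^sup>+x. ennreal ((1 + (real n)\<^sup>2) ^ k) * ennreal (wt k x) \<partial>M)"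
    proof (rule nn_integral_mono)
      fix x
      show "indicator (cball 0 (real n)) x \<le> ennreal ((1 + (real n)\<^sup>2) ^ k) * ennreal (wt k x)"
      proof (cases "x \<in> cball 0 (real n)")
        case True
        then have "(1 + (norm x)\<^sup>2) ^ k \<le> (1 + (real n)\<^sup>2) ^ k"
          by (intro power_mono add_left_mono) auto
        then have "1 \<le> (1 + (real n)\<^sup>2) ^ k * wt k x"
          by (simp add: wt_def add_pos_nonneg)
        then show ?thesis
          using True by (simp add: ennreal_mult'[symmetric] flip: ennreal_1)
      qed simp
    qed
    also have "\<dots> = ennreal ((1 + (real n)\<^sup>2) ^ k) * (\<integral>\<^sup>+x. ennreal (wt k x) \<partial>M)"
      by (rule nn_integral_cmult) simp
    also have "\<dots> < \<infinity>"
      using k by (simp add: ennreal_mult_less_top)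
    finally show ?thesis by simp
  qed
  have "\<exists>n. x \<in> cball 0 (real n)" for x :: 'a
    using real_arch_simple[of "norm x"] by auto
  then show "\<exists>A. countable A \<and> A \<subseteq> sets M \<and> \<Union>A = space M \<and> (\<forall>a\<in>A. emeasure M a \<noteq> \<infinity>)"
    using fin tempered_measure_space[OF M]
    by (intro exI[of _ "range (\<lambda>n. cball 0 (real n))"]) (auto simp: tempered_measure_sets[OF M])
qed

text \<open>The constant must be the same for all s >= 1, since s tends to infinity later. Peetre's
  inequality moves the weight of \<open>f\<close> to x at the price of 1 / \<open>wt m\<close> under
  the Gaussian, and concentrating the Gaussian only decreases that moment.\<close>

lemma convol_gauss_bound:
  fixes m :: nat
  obtains M where "0 < M" and "\<And>f :: 'a::euclidean_space \<Rightarrow> real. \<And>c s x. f \<in> borel_measurable borel \<Longrightarrow> 1 \<le> s \<Longrightarrow> 0 \<le> c \<Longrightarrow>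
    (\<And>x. \<bar>f x\<bar> \<le> c * wt m x) \<Longrightarrow> \<bar>convol (gauss s) f x\<bar> \<le> c * M * wt m x"
proof
  \<comment> \<open>The factor from Peetre's inequality times the weighted moment of the standard
    Gaussian. The exported constant is |M| + 1, which is visibly positive.\<close>
  define M where "M = 2 ^ m * (\<integral>x. gauss 1 x / wt m (x::'a) \<partial>lborel)"
  have rd: "(gauss s :: 'a \<Rightarrow> real) \<in> rapidly_decreasing" if "0 < s" for s
    using that by (intro schwartz_rapidly_decreasing schwartz_gauss)
  have [measurable]: "(gauss s :: 'a \<Rightarrow> real) \<in> borel_measurable borel" if "0 < s" for s
    using that by (intro rapidly_decreasing_measurable rd)
  have int: "integrable lborel (\<lambda>x::'a. gauss s x / wt m x)" if s: "0 < s" for s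
  proof -
    obtain C where C: "\<And>x::'a. \<bar>gauss s x\<bar> \<le> C * wt (m + DIM('a)) x"
      using rapidly_decreasing_bound[OF rd[OF s]] by metis
    show ?thesis
    proof (rule integrable_wt_bound)
      show "(\<lambda>x::'a. gauss s x / wt m x) \<in> borel_measurable borel" using s by measurable
      show "norm (gauss s x / wt m x) \<le> C * wt DIM('a) x" for x :: 'a
        using C[of x] by (simp add: wt_add field_simps)
    qed
  qed
  show "0 < \<bar>M\<bar> + 1" by simp
  fix f :: "'a \<Rightarrow> real" and c s :: real and x :: 'a
  assume [measurable]: "f \<in> borel_measurable borel" and s: "1 \<le> s" and c: "0 \<le> c"
    and f: "\<And>x. \<bar>f x\<bar> \<le> c * wt m x"
  have s0: "0 < s" using s by simp
  have le: "norm (gauss s (x - y) * f y) \<le> c * 2 ^ m * wt m x * (gauss s (x - y) / wt m (x - y))" for y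
  proof -
    \<comment> \<open>Peetre's inequality for the decomposition x = y + (x - y).\<close>
    have "wt m y * wt m (x - y) \<le> 2 ^ m * wt m (y + (x - y))"
      by (rule wt_add_mult)
    then have "wt m y \<le> 2 ^ m * wt m x / wt m (x - y)"
      by (simp add: pos_le_divide_eq)
    then have "c * wt m y \<le> c * (2 ^ m * wt m x / wt m (x - y))"
      by (rule mult_left_mono[OF _ c])
    then have "gauss s (x - y) * \<bar>f y\<bar> \<le> gauss s (x - y) * (c * (2 ^ m * wt m x / wt m (x - y)))"
      using f[of y] by (intro mult_left_mono gauss_nonneg s0) auto
    then show ?thesis
      by (simp add: abs_mult gauss_nonneg[OF s0] mult_ac)
  qed
  have int2: "integrable lborel (\<lambda>y. gauss s (x - y) / wt m (x - y))"
    using integral_affine(2)[of "\<lambda>x. gauss s x / wt m x" "-1" x] int[OF s0] s0 by simp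
  have eq2: "(\<integral>y. gauss s (x - y) / wt m (x - y) \<partial>lborel) = (\<integral>y. gauss s y / wt m (y::'a) \<partial>lborel)"
    using integral_affine(1)[of "\<lambda>x. gauss s x / wt m x" "-1" x] s0 by simp
  \<comment> \<open>Rescaling to s = 1 shrinks the argument of 1 / \<open>wt m\<close>, which
    increases with the norm; so the moment for s is at most the one for 1.\<close>
  have "(\<integral>y. gauss s y / wt m (y::'a) \<partial>lborel) = (\<integral>y. gauss 1 y / wt m ((y::'a) /\<^sub>R s) \<partial>lborel)"
    using integral_gauss_scale[of "\<lambda>x::'a. 1 / wt m x" s] s0 by simp
  also have "\<dots> \<le> (\<integral>y. gauss 1 y / wt m (y::'a) \<partial>lborel)"
  proof (rule integral_mono)
    have le: "gauss 1 y / wt m (y /\<^sub>R s) \<le> gauss 1 y / wt m y" for y :: 'a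
      using s s0 wt_scale[of "inverse s" m y]
      by (intro divide_left_mono gauss_nonneg mult_pos_pos) (auto simp: inverse_le_1_iff)
    then show "gauss 1 y / wt m (y /\<^sub>R s) \<le> gauss 1 y / wt m y" for y :: 'a .
    show "integrable lborel (\<lambda>y::'a. gauss 1 y / wt m (y /\<^sub>R s))"
      by (rule Bochner_Integration.integrable_bound[OF int[of 1]]) (use le gauss_nonneg[of 1, where 'a='a] in auto)
  qed (use int[of 1] in auto)
  finally have mono: "(\<integral>y. gauss s y / wt m (y::'a) \<partial>lborel) \<le> (\<integral>y. gauss 1 y / wt m (y::'a) \<partial>lborel)" .
  have "norm (convol (gauss s) f x) \<le> (\<integral>y. c * 2 ^ m * wt m x * (gauss s (x - y) / wt m (x - y)) \<partial>lborel)"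
    unfolding convol_def
  proof (rule Bochner_Integration.integral_norm_bound_integral)
    show "integrable lborel (\<lambda>y. c * 2 ^ m * wt m x * (gauss s (x - y) / wt m (x - y)))"
      by (rule integrable_mult_right[OF int2])
    then show "integrable lborel (\<lambda>y. gauss s (x - y) * f y)"
      by (rule Bochner_Integration.integrable_bound)
         (use s0 in measurable, intro AE_I2 order_trans[OF le], simp only: real_norm_def abs_ge_self)
  qed (rule le)
  also have "\<dots> = c * 2 ^ m * wt m x * (\<integral>y. gauss s y / wt m (y::'a) \<partial>lborel)"
    by (simp only: integral_mult_right_zero eq2)
  also have "\<dots> \<le> c * 2 ^ m * wt m x * (\<integral>y. gauss 1 y / wt m (y::'a) \<partial>lborel)"
    using c by (intro mult_left_mono mono) auto
  also have "\<dots> = c * wt m x * M" by (simp add: M_def)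
  also have "\<dots> \<le> c * wt m x * (\<bar>M\<bar> + 1)"
    using c by (intro mult_left_mono) auto
  finally show "\<bar>convol (gauss s) f x\<bar> \<le> c * (\<bar>M\<bar> + 1) * wt m x" by (simp add: mult_ac)
qed

lemma fourier_gauss_tendsto: "(\<lambda>n. fourier (gauss (real (Suc n))) \<xi>) \<longlonglongrightarrow> 1"
proof -
  have "(\<lambda>n. exp (- ((norm \<xi>)\<^sup>2 / 2) * (inverse (real (Suc n)))\<^sup>2)) \<longlonglongrightarrow> exp (- ((norm \<xi>)\<^sup>2 / 2) * 0\<^sup>2)"
    by (intro tendsto_intros LIMSEQ_inverse_real_of_nat)
  then have "(\<lambda>n. complex_of_real (exp (- ((norm \<xi>)\<^sup>2 / 2) * (inverse (real (Suc n)))\<^sup>2))) \<longlonglongrightarrow> of_real 1"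
    by (intro tendsto_of_real) simp
  moreover have "complex_of_real (exp (- ((norm \<xi>)\<^sup>2 / 2) * (inverse s)\<^sup>2)) = fourier (gauss s) \<xi>" if "0 < s" for s
    unfolding fourier_gauss[OF that] using that by (simp add: power_inverse field_simps)
  ultimately show ?thesis by (simp del: of_nat_Suc)
qed

lemma fourier_convol_gauss:
  "f \<in> rapidly_decreasing \<Longrightarrow> 0 < s \<Longrightarrow> fourier (convol (gauss s) f) \<xi> = fourier (gauss s) \<xi> * fourier f \<xi>"
  by (rule fourier_convol[OF rapidly_decreasing_integrable[OF schwartz_rapidly_decreasing[OF schwartz_gauss]]
        rapidly_decreasing_integrable])

section \<open>Comparison of transforms in L^2(\<mu>) with convolution integrals against
  \<Gamma>\<close>

locale spectral_measure =
  fixes \<Gamma> \<mu> :: "'a::euclidean_space measure"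
  assumes tempered_\<Gamma>: "tempered_measure \<Gamma>" and tempered_\<mu>: "tempered_measure \<mu>"
    and fourier_\<mu>: "is_fourier_transform \<mu> \<Gamma>"
begin

lemma sets_\<Gamma> [measurable_cong]: "sets \<Gamma> = sets borel"
  by (rule tempered_measure_sets[OF tempered_\<Gamma>])

lemma sets_\<mu> [measurable_cong]: "sets \<mu> = sets borel"
  by (rule tempered_measure_sets[OF tempered_\<mu>])

lemma space_\<mu> [simp]: "space \<mu> = UNIV"
  by (rule tempered_measure_space[OF tempered_\<mu>])

lemma measurable_\<mu> [simp]: "borel_measurable \<mu> = borel_measurable borel"
  by (rule measurable_cong_sets[OF sets_\<mu> refl])

text \<open>The relation between \<mu> and \<Gamma> is applied to the Schwartz function g * refl g,
  whose transform is |F g|^2.\<close>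

lemma L2_sqnorm_fourier_convol_gauss:
  assumes f: "f \<in> rapidly_decreasing" and s: "0 < s"
  defines "g \<equiv> convol (gauss s) f"
  shows "L2_sqnorm \<mu> (fourier g) = ennreal (\<integral>x. convol g (refl_fun g) x \<partial>\<Gamma>)"
proof -
  have g: "g \<in> schwartz"
    unfolding g_def by (intro schwartz_convol schwartz_gauss s f)
  note grd = schwartz_rapidly_decreasing[OF g]
  have \<phi>: "convol g (refl_fun g) \<in> schwartz"
    by (intro schwartz_convol g rapidly_decreasing_refl_fun grd)
  have F\<phi>: "fourier (convol g (refl_fun g)) \<xi> = complex_of_real ((cmod (fourier g \<xi>))\<^sup>2)" for \<xi>
    using grd rapidly_decreasing_refl_fun[OF grd]
    by (simp add: fourier_convol rapidly_decreasing_integrable fourier_refl_fun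
        rapidly_decreasing_measurable complex_norm_square flip: of_real_power)
  obtain k where k: "(\<integral>\<^sup>+x. ennreal (wt k x) \<partial>\<mu>) < \<infinity>"
    using tempered_measure_wt[OF tempered_\<mu>] .
  have intk: "integrable \<mu> (wt k)"
    using k by (intro integrableI_bounded) auto
  define N where "N = (\<integral>x. \<bar>f x\<bar> \<partial>lborel)"
  obtain D where D: "0 < D" "\<And>x::'a. exp (- (1 / s\<^sup>2) * (norm x)\<^sup>2) \<le> D * wt k x"
    using exp_neg_le_wt[of "1 / s\<^sup>2" k] s by auto
  \<comment> \<open>|F g|^2 is exp (-|\<xi>|^2 / s^2) |F f|^2, where |F f| is at most the L^1 norm N
    and the Gaussian lies below any weight, in particular one that is \<mu>-integrable.\<close>
  have bd: "(cmod (fourier g \<xi>))\<^sup>2 \<le> N\<^sup>2 * D * wt k \<xi>" for \<xi>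
  proof -
    have "cmod (fourier g \<xi>) = exp (- (norm \<xi>)\<^sup>2 / (2 * s\<^sup>2)) * cmod (fourier f \<xi>)"
      unfolding g_def fourier_convol_gauss[OF f s] norm_mult fourier_gauss[OF s] by simp
    also have "\<dots> \<le> exp (- (norm \<xi>)\<^sup>2 / (2 * s\<^sup>2)) * N"
      unfolding N_def by (intro mult_left_mono norm_fourier_le rapidly_decreasing_integrable f) auto
    finally have "(cmod (fourier g \<xi>))\<^sup>2 \<le> (exp (- (norm \<xi>)\<^sup>2 / (2 * s\<^sup>2)) * N)\<^sup>2"
      by (intro power_mono) auto
    also have "\<dots> = N\<^sup>2 * exp (- (1 / s\<^sup>2) * (norm \<xi>)\<^sup>2)"
      by (simp add: power_mult_distrib power2_eq_square[of "exp _"] exp_add[symmetric])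
    also have "\<dots> \<le> N\<^sup>2 * (D * wt k \<xi>)"
      by (intro mult_left_mono D) auto
    finally show ?thesis by (simp add: mult_ac)
  qed
  have [measurable]: "fourier g \<in> borel_measurable borel"
    by (intro fourier_measurable rapidly_decreasing_measurable grd)
  \<comment> \<open>Integrability is what allows the passage from the Bochner integral to the
    extended integral in \<open>L2_sqnorm\<close>; a divergent Bochner integral would be 0.\<close>
  have int: "integrable \<mu> (\<lambda>\<xi>. (cmod (fourier g \<xi>))\<^sup>2)"
  proof (rule Bochner_Integration.integrable_bound)
    show "integrable \<mu> (\<lambda>\<xi>. N\<^sup>2 * D * wt k \<xi>)" using intk by simp
    show "AE \<xi> in \<mu>. norm ((cmod (fourier g \<xi>))\<^sup>2) \<le> norm (N\<^sup>2 * D * wt k \<xi>)"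
      using bd by (intro AE_I2) (auto intro: order_trans[OF _ abs_ge_self])
  qed measurable
  have "complex_of_real (\<integral>x. convol g (refl_fun g) x \<partial>\<Gamma>) = (\<integral>\<xi>. fourier (convol g (refl_fun g)) \<xi> \<partial>\<mu>)"
    using fourier_\<mu> \<phi> unfolding is_fourier_transform_def by blast
  also have "\<dots> = complex_of_real (\<integral>\<xi>. (cmod (fourier g \<xi>))\<^sup>2 \<partial>\<mu>)"
    unfolding F\<phi> by (rule integral_complex_of_real)
  finally have "(\<integral>x. convol g (refl_fun g) x \<partial>\<Gamma>) = (\<integral>\<xi>. (cmod (fourier g \<xi>))\<^sup>2 \<partial>\<mu>)"
    by (simp only: of_real_eq_iff)
  then show ?thesis
    unfolding L2_sqnorm_def using nn_integral_eq_integral[OF int] by simp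
qed

text \<open>Mollifying by Gaussians and Fatou's lemma transfer the identity of the two inner products
  from Schwartz functions to rapidly decreasing Borel functions, as an inequality.\<close>

lemma L2_sqnorm_fourier_le:
  obtains C m where "0 < C"
    "\<And>f c. f \<in> rapidly_decreasing \<Longrightarrow> 0 \<le> c \<Longrightarrow> (\<And>x. \<bar>f x\<bar> \<le> c * wt m x) \<Longrightarrow>
       L2_sqnorm \<mu> (fourier f) \<le> ennreal (C * c\<^sup>2)"
proof -
  obtain k where k: "(\<integral>\<^sup>+x. ennreal (wt k x) \<partial>\<Gamma>) < \<infinity>"
    using tempered_measure_wt[OF tempered_\<Gamma>] .
  have intk: "integrable \<Gamma> (wt k)"
    using k by (intro integrableI_bounded) auto
  \<comment> \<open>k powers for the integral over \<Gamma>, and DIM('a) powers for the Lebesgue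
    integral in \<open>convol_wt_bound\<close>.\<close>
  define m where "m = k + DIM('a)"
  obtain M where M: "0 < M" "\<And>f c s x. f \<in> borel_measurable borel \<Longrightarrow> 1 \<le> s \<Longrightarrow> 0 \<le> c \<Longrightarrow>
      (\<And>x::'a. \<bar>f x\<bar> \<le> c * wt m x) \<Longrightarrow> \<bar>convol (gauss s) f x\<bar> \<le> c * M * wt m x"
    using convol_gauss_bound[of m] by blast
  define I where "I = (\<integral>y. wt DIM('a) (y::'a) \<partial>lborel)"
  have I: "0 \<le> I" unfolding I_def by (intro integral_nonneg_AE) auto
  define C where "C = M\<^sup>2 * 2 ^ k * I * (\<integral>x. wt k x \<partial>\<Gamma>)"
  have C: "0 \<le> C"
    unfolding C_def using I by (intro mult_nonneg_nonneg integral_nonneg_AE) auto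
  have "L2_sqnorm \<mu> (fourier f) \<le> ennreal ((C + 1) * c\<^sup>2)"
    if f: "f \<in> rapidly_decreasing" and c: "0 \<le> c" and bd: "\<And>x. \<bar>f x\<bar> \<le> c * wt m x" for f c
  proof -
    define g where "g n = convol (gauss (real (Suc n))) f" for n
    have gS: "g n \<in> schwartz" for n
      unfolding g_def by (intro schwartz_convol schwartz_gauss f) simp
    have g_le: "L2_sqnorm \<mu> (fourier (g n)) \<le> ennreal (C * c\<^sup>2)" for n
    proof -
      have gb: "\<bar>g n x\<bar> \<le> c * M * wt m x" for x
        unfolding g_def using rapidly_decreasing_measurable[OF f] c bd by (intro M) auto
      \<comment> \<open>The first factor of the convolution needs only k powers; the reflected one
        keeps all k + DIM('a). Each contributes c M, whence the square of c.\<close>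
      have gb': "\<bar>g n x\<bar> \<le> c * M * wt k x" for x
        using gb[of x] mult_left_mono[OF wt_antimono[of k m x], of "c * M"] c M(1) by (simp add: m_def)
      have \<phi>b: "\<bar>convol (g n) (refl_fun (g n)) x\<bar> \<le> (c * M) * (c * M) * 2 ^ k * I * wt k x" for x
        unfolding I_def using gb gb' c M(1)
        by (intro convol_wt_bound) (auto simp: refl_fun_def m_def[symmetric] intro: order_trans[OF gb])
      have "(\<integral>x. convol (g n) (refl_fun (g n)) x \<partial>\<Gamma>) \<le> (\<integral>x. (c * M) * (c * M) * 2 ^ k * I * wt k x \<partial>\<Gamma>)"
      proof (rule integral_mono)
        show "integrable \<Gamma> (\<lambda>x. (c * M) * (c * M) * 2 ^ k * I * wt k x)"
          using intk by simp
        then show "integrable \<Gamma> (convol (g n) (refl_fun (g n)))"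
        proof (rule Bochner_Integration.integrable_bound)
          show "convol (g n) (refl_fun (g n)) \<in> borel_measurable \<Gamma>"
            unfolding measurable_cong_sets[OF sets_\<Gamma> refl]
            by (intro convol_measurable rapidly_decreasing_measurable rapidly_decreasing_refl_fun
                schwartz_rapidly_decreasing gS)
        qed (use \<phi>b in \<open>auto intro: order_trans[OF _ abs_ge_self]\<close>)
      qed (use \<phi>b in \<open>auto intro: order_trans[OF abs_ge_self]\<close>)
      also have "\<dots> = C * c\<^sup>2"
        by (simp add: C_def power2_eq_square mult_ac)
      finally show ?thesis
        using L2_sqnorm_fourier_convol_gauss[OF f, of "real (Suc n)"]
        by (simp add: g_def ennreal_leI)
    qed
    have meas [measurable]: "fourier (g n) \<in> borel_measurable borel" for n
      by (intro fourier_measurable rapidly_decreasing_measurable schwartz_rapidly_decreasing gS)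
    have "(\<lambda>n. fourier (g n) \<xi>) \<longlonglongrightarrow> 1 * fourier f \<xi>" for \<xi>
      unfolding g_def by (simp only: fourier_convol_gauss[OF f of_nat_0_less_iff[THEN iffD2, OF zero_less_Suc]])
        (intro tendsto_mult tendsto_const fourier_gauss_tendsto)
    then have lim: "(\<lambda>n. ennreal ((cmod (fourier (g n) \<xi>))\<^sup>2)) \<longlonglongrightarrow> ennreal ((cmod (fourier f \<xi>))\<^sup>2)" for \<xi>
      by (intro tendsto_ennrealI tendsto_power tendsto_norm) simp
    have "L2_sqnorm \<mu> (fourier f) = (\<integral>\<^sup>+\<xi>. liminf (\<lambda>n. ennreal ((cmod (fourier (g n) \<xi>))\<^sup>2)) \<partial>\<mu>)"
      unfolding L2_sqnorm_def by (intro nn_integral_cong lim_imp_Liminf[OF _ lim, symmetric]) simp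
    also have "\<dots> \<le> liminf (\<lambda>n. \<integral>\<^sup>+\<xi>. ennreal ((cmod (fourier (g n) \<xi>))\<^sup>2) \<partial>\<mu>)"
      by (rule nn_integral_liminf) measurable
    also have "\<dots> \<le> liminf (\<lambda>n. ennreal (C * c\<^sup>2))"
      using g_le by (intro Liminf_mono always_eventually) (auto simp: L2_sqnorm_def)
    also have "\<dots> = ennreal (C * c\<^sup>2)" by (simp add: Liminf_const)
    also have "\<dots> \<le> ennreal ((C + 1) * c\<^sup>2)" by (intro ennreal_leI mult_right_mono) auto
    finally show ?thesis .
  qed
  then show ?thesis using C by (intro that[of "C + 1" m]) auto
qed

lemma fourier_L2:
  assumes f: "f \<in> rapidly_decreasing"
  shows "fourier f \<in> L2 \<mu>"
proof -
  obtain C m where C: "0 < C" "\<And>f c. f \<in> rapidly_decreasing \<Longrightarrow> 0 \<le> c \<Longrightarrow> (\<And>x. \<bar>f x\<bar> \<le> c * wt m x) \<Longrightarrow>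
       L2_sqnorm \<mu> (fourier f) \<le> ennreal (C * c\<^sup>2)"
    using L2_sqnorm_fourier_le by blast
  obtain c where "0 < c" "\<And>x. \<bar>f x\<bar> \<le> c * wt m x"
    using rapidly_decreasing_bound[OF f] by blast
  then have "L2_sqnorm \<mu> (fourier f) \<le> ennreal (C * c\<^sup>2)"
    using C(2)[OF f, of c] by auto
  then show ?thesis
    using rapidly_decreasing_measurable[OF f]
    by (auto simp: L2_def le_less_trans intro: fourier_measurable)
qed

text \<open>The mollified functions are Schwartz, and their transforms differ from F f by the factor
  F \<rho>_n - 1, which has modulus at most 1 and tends to 0. Dominated convergence applies because
  |F f|^2 is \<mu>-integrable by \<open>fourier_L2\<close>.\<close>

lemma fourier_mem_H_space:
  assumes f: "f \<in> rapidly_decreasing"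
  shows "fourier f \<in> H_space \<mu>"
  unfolding H_space_def L2_closure_def
proof safe
  show L2: "fourier f \<in> L2 \<mu>" by (rule fourier_L2[OF f])
  define g where "g n = convol (gauss (real (Suc n))) f" for n
  have gS: "g n \<in> schwartz" for n
    unfolding g_def by (intro schwartz_convol schwartz_gauss f) simp
  have [measurable]: "fourier f \<in> borel_measurable borel"
    by (intro fourier_measurable rapidly_decreasing_measurable f)
  have [measurable]: "fourier (gauss (real (Suc n)) :: 'a \<Rightarrow> real) \<in> borel_measurable borel" for n
    by (intro fourier_measurable rapidly_decreasing_measurable schwartz_rapidly_decreasing schwartz_gauss) simp
  let ?e = "\<lambda>n \<xi>. (cmod ((fourier (gauss (real (Suc n))) \<xi> - 1) * fourier f \<xi>))\<^sup>2"
  have "(\<lambda>n. \<integral>\<^sup>+\<xi>. ennreal (?e n \<xi>) \<partial>\<mu>) \<longlonglongrightarrow> (\<integral>\<^sup>+\<xi>. 0 \<partial>\<mu>)"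
  proof (rule nn_integral_dominated_convergence[where w="\<lambda>\<xi>. ennreal ((cmod (fourier f \<xi>))\<^sup>2)"])
    show "(\<integral>\<^sup>+\<xi>. ennreal ((cmod (fourier f \<xi>))\<^sup>2) \<partial>\<mu>) < \<infinity>"
      using L2 by (simp add: L2_def L2_sqnorm_def)
    show "AE \<xi> in \<mu>. ennreal (?e n \<xi>) \<le> ennreal ((cmod (fourier f \<xi>))\<^sup>2)" for n
    proof (intro AE_I2 ennreal_leI power_mono)
      fix \<xi> :: 'a
      have "fourier (gauss (real (Suc n))) \<xi> - 1 = complex_of_real (exp (- (norm \<xi>)\<^sup>2 / (2 * (real (Suc n))\<^sup>2)) - 1)"
        by (subst fourier_gauss) simp_all
      also have "cmod \<dots> = \<bar>exp (- (norm \<xi>)\<^sup>2 / (2 * (real (Suc n))\<^sup>2)) - 1\<bar>"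
        by (rule norm_of_real)
      also have "\<dots> \<le> 1"
      proof -
        have "exp (- (norm \<xi>)\<^sup>2 / (2 * (real (Suc n))\<^sup>2)) \<le> exp 0"
          unfolding exp_le_cancel_iff by simp
        moreover have "0 < exp (- (norm \<xi>)\<^sup>2 / (2 * (real (Suc n))\<^sup>2))" by simp
        ultimately show ?thesis unfolding exp_zero by linarith
      qed
      finally show "cmod ((fourier (gauss (real (Suc n))) \<xi> - 1) * fourier f \<xi>) \<le> cmod (fourier f \<xi>)"
        by (simp add: norm_mult mult_left_le_one_le)
    qed simp
    have "(\<lambda>n. ?e n \<xi>) \<longlonglongrightarrow> (cmod ((1 - 1) * fourier f \<xi>))\<^sup>2" for \<xi>
      by (intro tendsto_power tendsto_norm tendsto_mult tendsto_diff fourier_gauss_tendsto tendsto_const)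
    then have "(\<lambda>n. ennreal (?e n \<xi>)) \<longlonglongrightarrow> 0" for \<xi>
      using tendsto_ennrealI[of "\<lambda>n. ?e n \<xi>" 0] by simp
    then show "AE \<xi> in \<mu>. (\<lambda>n. ennreal (?e n \<xi>)) \<longlonglongrightarrow> 0" by simp
  qed measurable
  moreover have "fourier (g n) \<xi> - fourier f \<xi> = (fourier (gauss (real (Suc n))) \<xi> - 1) * fourier f \<xi>" for n \<xi>
    unfolding g_def fourier_convol_gauss[OF f of_nat_0_less_iff[THEN iffD2, OF zero_less_Suc]]
    by (simp add: left_diff_distrib)
  ultimately have "(\<lambda>n. L2_sqnorm \<mu> (\<lambda>\<xi>. fourier (g n) \<xi> - fourier f \<xi>)) \<longlonglongrightarrow> 0"
    by (simp add: L2_sqnorm_def)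
  then show "\<exists>g. (\<forall>n. g n \<in> fourier ` schwartz) \<and> (\<lambda>n. L2_sqnorm \<mu> (\<lambda>\<xi>. g n \<xi> - fourier f \<xi>)) \<longlonglongrightarrow> 0"
    using gS by (intro exI[of _ "\<lambda>n. fourier (g n)"]) auto
qed

end

text \<open>The error is measured in the weighted supremum norm that
  \<open>L2_sqnorm_fourier_le\<close> controls. Far out \<open>f\<close> itself is small against the
  weight; on the remaining ball its values are rounded down to a fine grid.\<close>

lemma rapidly_decreasing_simple_approx:
  fixes f :: "'a::euclidean_space \<Rightarrow> real"
  assumes f: "f \<in> rapidly_decreasing" and e: "0 < e"
  obtains J :: "int set" and c A where "finite J" "\<And>j. A j \<in> sets borel" "\<And>j. bounded (A j)"
    "\<And>x. \<bar>f x - (\<Sum>j\<in>J. c j * indicator (A j) x)\<bar> \<le> e * wt m x"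
proof -
  obtain C where C: "0 < C" "\<And>x. \<bar>f x\<bar> \<le> C * wt (m + 1) x"
    using rapidly_decreasing_bound[OF f] by blast
  have [measurable]: "f \<in> borel_measurable borel" by (rule rapidly_decreasing_measurable[OF f])
  \<comment> \<open>Outside the ball of radius R the spare power in m + 1 gives C
    \<open>wt 1 x\<close> <= e.\<close>
  define R where "R = sqrt (C / e)"
  have R: "R\<^sup>2 = C / e" unfolding R_def using C e by simp
  \<comment> \<open>The grid size is e times the smallest value of \<open>wt m\<close> on the
    ball.\<close>
  define \<delta> where "\<delta> = e / (1 + R\<^sup>2) ^ m"
  have \<delta>: "0 < \<delta>" unfolding \<delta>_def using e by (simp add: add_pos_nonneg)
  define A where "A j = {x \<in> cball 0 R. \<lfloor>f x / \<delta>\<rfloor> = j}" for j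
  \<comment> \<open>Finitely many grid values occur because |f| <= C.\<close>
  define J where "J = {\<lfloor>- C / \<delta>\<rfloor>..\<lfloor>C / \<delta>\<rfloor>}"
  have "\<bar>f x - (\<Sum>j\<in>J. (\<delta> * real_of_int j) * indicator (A j) x)\<bar> \<le> e * wt m x" for x
  proof (cases "x \<in> cball 0 R")
    case True
    have "\<bar>f x\<bar> \<le> C"
      using C(2)[of x] wt_le_1[of "m + 1" x] C(1) by (smt (verit) mult_left_le)
    then have "- C / \<delta> \<le> f x / \<delta>" "f x / \<delta> \<le> C / \<delta>"
      using \<delta> by (intro divide_right_mono; simp)+
    then have "\<lfloor>f x / \<delta>\<rfloor> \<in> J"
      unfolding J_def by (auto dest: floor_mono)
    moreover have "(\<delta> * real_of_int j) * indicator (A j) x = (if \<lfloor>f x / \<delta>\<rfloor> = j then \<delta> * real_of_int j else 0)" for j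
      using True by (simp add: A_def)
    ultimately have "(\<Sum>j\<in>J. (\<delta> * real_of_int j) * indicator (A j) x) = \<delta> * real_of_int \<lfloor>f x / \<delta>\<rfloor>"
      by (simp add: J_def)
    moreover have "\<bar>f x - \<delta> * real_of_int \<lfloor>f x / \<delta>\<rfloor>\<bar> \<le> \<delta>"
    proof -
      have "\<bar>f x / \<delta> - real_of_int \<lfloor>f x / \<delta>\<rfloor>\<bar> \<le> 1" by linarith
      then have "\<delta> * \<bar>f x / \<delta> - real_of_int \<lfloor>f x / \<delta>\<rfloor>\<bar> \<le> \<delta> * 1"
        using \<delta> by (intro mult_left_mono) auto
      also have "\<delta> * \<bar>f x / \<delta> - real_of_int \<lfloor>f x / \<delta>\<rfloor>\<bar> = \<bar>\<delta> * (f x / \<delta> - real_of_int \<lfloor>f x / \<delta>\<rfloor>)\<bar>"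
        using \<delta> by (simp add: abs_mult)
      also have "\<delta> * (f x / \<delta> - real_of_int \<lfloor>f x / \<delta>\<rfloor>) = f x - \<delta> * real_of_int \<lfloor>f x / \<delta>\<rfloor>"
        using \<delta> by (simp add: right_diff_distrib)
      finally show ?thesis by simp
    qed
    moreover have "\<delta> \<le> e * wt m x"
    proof -
      have "(1 + (norm x)\<^sup>2) ^ m \<le> (1 + R\<^sup>2) ^ m"
        using True by (intro power_mono add_left_mono) auto
      then show ?thesis
        unfolding \<delta>_def wt_def using e
        by (simp add: divide_left_mono add_pos_nonneg)
    qed
    ultimately show ?thesis by simp
  next
    case False
    then have "R < norm x" by simp
    moreover have "0 \<le> R" unfolding R_def using C(1) e by simp
    ultimately have "R\<^sup>2 \<le> (norm x)\<^sup>2" by (intro power_mono) auto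
    then have "C \<le> e * (1 + (norm x)\<^sup>2)"
      using R e by (simp add: field_simps)
    then have "C * wt 1 x \<le> e"
      by (simp add: wt_def add_pos_nonneg field_simps)
    then have "C * wt 1 x * wt m x \<le> e * wt m x" by (rule mult_right_mono) simp
    moreover have "\<bar>f x\<bar> \<le> C * wt 1 x * wt m x"
      using C(2)[of x] by (simp only: wt_add mult_ac)
    ultimately have "\<bar>f x\<bar> \<le> e * wt m x" by linarith
    moreover have "(\<Sum>j\<in>J. (\<delta> * real_of_int j) * indicator (A j) x) = 0"
      using False by (intro sum.neutral) (auto simp: A_def)
    ultimately show ?thesis by simp
  qed
  moreover have "A j \<in> sets borel" for j unfolding A_def by measurable
  moreover have "bounded (A j)" for j
    unfolding A_def by (rule bounded_subset[OF bounded_cball[of 0 R]]) auto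
  ultimately show ?thesis
    by (intro that[of J A "\<lambda>j. \<delta> * real_of_int j"]) (auto simp: J_def)
qed

section \<open>Closures in square integrable functions\<close>

lemma cmod_add_square_le: "(cmod (a + b))\<^sup>2 \<le> 2 * (cmod a)\<^sup>2 + 2 * (cmod b)\<^sup>2"
proof -
  have "(cmod (a + b))\<^sup>2 \<le> (cmod a + cmod b)\<^sup>2"
    by (intro power_mono norm_triangle_ineq) auto
  also have "\<dots> \<le> 2 * (cmod a)\<^sup>2 + 2 * (cmod b)\<^sup>2"
    using sum_squares_bound[of "cmod a" "cmod b"] by (simp add: power2_eq_square algebra_simps)
  finally show ?thesis .
qed

text \<open>A substitute for Minkowski's inequality that stays with squared norms in
  \<open>ennreal\<close> and avoids square roots. The factor 2 is the reason for the tolerances e /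
  4 below.\<close>

lemma L2_sqnorm_add_le:
  assumes [measurable]: "f \<in> borel_measurable N" "g \<in> borel_measurable N"
  shows "L2_sqnorm N (\<lambda>x. f x + g x) \<le> 2 * L2_sqnorm N f + 2 * L2_sqnorm N g"
proof -
  have "L2_sqnorm N (\<lambda>x. f x + g x) \<le>
      (\<integral>\<^sup>+x. 2 * ennreal ((cmod (f x))\<^sup>2) + 2 * ennreal ((cmod (g x))\<^sup>2) \<partial>N)"
    unfolding L2_sqnorm_def
  proof (rule nn_integral_mono)
    fix x
    have "ennreal ((cmod (f x + g x))\<^sup>2) \<le> ennreal (2 * (cmod (f x))\<^sup>2 + 2 * (cmod (g x))\<^sup>2)"
      by (intro ennreal_leI cmod_add_square_le)
    also have "\<dots> = 2 * ennreal ((cmod (f x))\<^sup>2) + 2 * ennreal ((cmod (g x))\<^sup>2)"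
      by (simp add: ennreal_mult)
    finally show "ennreal ((cmod (f x + g x))\<^sup>2) \<le> 2 * ennreal ((cmod (f x))\<^sup>2) + 2 * ennreal ((cmod (g x))\<^sup>2)" .
  qed
  also have "\<dots> = 2 * L2_sqnorm N f + 2 * L2_sqnorm N g"
    unfolding L2_sqnorm_def by (subst nn_integral_add) (auto simp: nn_integral_cmult)
  finally show ?thesis .
qed

lemma L2_sqnorm_triangle:
  assumes "f \<in> borel_measurable N" "g \<in> borel_measurable N" "h \<in> borel_measurable N"
  shows "L2_sqnorm N (\<lambda>x. f x - h x) \<le> 2 * L2_sqnorm N (\<lambda>x. f x - g x) + 2 * L2_sqnorm N (\<lambda>x. g x - h x)"
  using L2_sqnorm_add_le[of "\<lambda>x. f x - g x" N "\<lambda>x. g x - h x"] assms by simp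

lemma L2_sqnorm_cmult:
  assumes [measurable]: "f \<in> borel_measurable N"
  shows "L2_sqnorm N (\<lambda>x. c * f x) = ennreal ((cmod c)\<^sup>2) * L2_sqnorm N f"
  unfolding L2_sqnorm_def
  by (subst nn_integral_cmult[symmetric]) (auto simp: norm_mult power_mult_distrib ennreal_mult)

lemma L2_sqnorm_cong_AE: "AE x in N. f x = g x \<Longrightarrow> L2_sqnorm N f = L2_sqnorm N g"
  unfolding L2_sqnorm_def by (intro nn_integral_cong_AE) auto

lemma L2_measurable: "f \<in> L2 N \<Longrightarrow> f \<in> borel_measurable N"
  by (simp add: L2_def)

lemma L2_add:
  assumes "f \<in> L2 N" "g \<in> L2 N"
  shows "(\<lambda>x. f x + g x) \<in> L2 N"
proof -
  have "2 * L2_sqnorm N f + 2 * L2_sqnorm N g < \<infinity>"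
    using assms by (simp add: L2_def ennreal_mult_less_top)
  then show ?thesis
    using L2_sqnorm_add_le[of f N g] assms by (auto simp: L2_def intro: le_less_trans)
qed

lemma L2_cmult: "f \<in> L2 N \<Longrightarrow> (\<lambda>x. c * f x) \<in> L2 N"
  by (auto simp: L2_def L2_sqnorm_cmult ennreal_mult_less_top)

text \<open>One direction picks an approximation within 1 / (n + 1) for each n. The form with e
  spares the later closure arguments any choice of sequences.\<close>

lemma L2_closure_iff:
  "f \<in> L2_closure N S \<longleftrightarrow> f \<in> L2 N \<and> (\<forall>e>0. \<exists>g\<in>S. L2_sqnorm N (\<lambda>x. g x - f x) < ennreal e)"
proof safe
  assume "f \<in> L2_closure N S"
  then obtain g where g: "f \<in> L2 N" "\<And>n. g n \<in> S" "(\<lambda>n. L2_sqnorm N (\<lambda>x. g n x - f x)) \<longlonglongrightarrow> 0"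
    unfolding L2_closure_def by blast
  show "f \<in> L2 N" by fact
  fix e :: real assume "0 < e"
  then have "eventually (\<lambda>n. L2_sqnorm N (\<lambda>x. g n x - f x) < ennreal e) sequentially"
    using g(3) by (intro order_tendstoD(2)) auto
  from eventually_happens'[OF sequentially_bot this]
  show "\<exists>g\<in>S. L2_sqnorm N (\<lambda>x. g x - f x) < ennreal e"
    using g(2) by blast
next
  assume f: "f \<in> L2 N" and *: "\<forall>e>0. \<exists>g\<in>S. L2_sqnorm N (\<lambda>x. g x - f x) < ennreal e"
  have "\<exists>g\<in>S. L2_sqnorm N (\<lambda>x. g x - f x) < ennreal (inverse (real (Suc n)))" for n
    using * by (meson inverse_positive_iff_positive of_nat_0_less_iff zero_less_Suc)
  then obtain g where g: "\<And>n. g n \<in> S" "\<And>n. L2_sqnorm N (\<lambda>x. g n x - f x) < ennreal (inverse (real (Suc n)))"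
    by metis
  have "(\<lambda>n. L2_sqnorm N (\<lambda>x. g n x - f x)) \<longlonglongrightarrow> 0"
  proof (rule tendsto_sandwich[of "\<lambda>_. 0" _ _ "\<lambda>n. ennreal (inverse (real (Suc n)))"])
    show "(\<lambda>n. ennreal (inverse (real (Suc n)))) \<longlonglongrightarrow> 0"
      using tendsto_ennrealI[OF LIMSEQ_inverse_real_of_nat] by simp
  qed (use g(2) in \<open>auto intro!: always_eventually less_imp_le simp del: of_nat_Suc\<close>)
  then show "f \<in> L2_closure N S" unfolding L2_closure_def using f g(1) by blast
qed

lemma L2_closure_L2: "f \<in> L2_closure N S \<Longrightarrow> f \<in> L2 N"
  by (simp add: L2_closure_def)

lemma L2_closure_measurable: "f \<in> L2_closure N S \<Longrightarrow> f \<in> borel_measurable N"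
  by (rule L2_measurable[OF L2_closure_L2])

lemma L2_closure_approx:
  "f \<in> L2_closure N S \<Longrightarrow> 0 < e \<Longrightarrow> \<exists>g\<in>S. L2_sqnorm N (\<lambda>x. g x - f x) < ennreal e"
  by (simp add: L2_closure_iff)

lemma ennreal_two_quarters: "0 < e \<Longrightarrow> x < ennreal (e / 4) \<Longrightarrow> y < ennreal (e / 4) \<Longrightarrow> 2 * x + 2 * y < ennreal e"
proof -
  assume e: "0 < e" and x: "x < ennreal (e / 4)" and y: "y < ennreal (e / 4)"
  obtain r where r: "x = ennreal r" "0 \<le> r" using x by (cases x) auto
  obtain s where s: "y = ennreal s" "0 \<le> s" using y by (cases y) auto
  have "2 * x + 2 * y = ennreal (2 * r + 2 * s)"
    using r s by (simp add: ennreal_mult)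
  also have "\<dots> < ennreal e"
    using x y r s e by (intro ennreal_lessI) (auto simp: ennreal_less_iff)
  finally show ?thesis .
qed

text \<open>Idempotence of the closure; it allows the approximation from intervals to Borel sets,
  from indicators to Schwartz functions and from those to H to be done in stages.\<close>

lemma L2_closure_closed:
  assumes S: "S \<subseteq> borel_measurable N" and f: "f \<in> L2 N"
    and approx: "\<And>e. 0 < e \<Longrightarrow> \<exists>g\<in>L2_closure N S. L2_sqnorm N (\<lambda>x. g x - f x) < ennreal e"
  shows "f \<in> L2_closure N S"
  unfolding L2_closure_iff
proof safe
  fix e :: real assume e: "0 < e"
  then obtain g where g: "g \<in> L2_closure N S" "L2_sqnorm N (\<lambda>x. g x - f x) < ennreal (e / 4)"
    using approx[of "e / 4"] by auto
  obtain h where h: "h \<in> S" "L2_sqnorm N (\<lambda>x. h x - g x) < ennreal (e / 4)"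
    using L2_closure_approx[OF g(1), of "e / 4"] e by auto
  have "L2_sqnorm N (\<lambda>x. h x - f x) \<le> 2 * L2_sqnorm N (\<lambda>x. h x - g x) + 2 * L2_sqnorm N (\<lambda>x. g x - f x)"
    using S h(1) L2_closure_measurable[OF g(1)] L2_measurable[OF f]
    by (intro L2_sqnorm_triangle) auto
  also have "\<dots> < ennreal e"
    by (rule ennreal_two_quarters[OF e h(2) g(2)])
  finally show "\<exists>g\<in>S. L2_sqnorm N (\<lambda>x. g x - f x) < ennreal e"
    using h(1) by blast
qed (rule f)

lemma L2_closure_add:
  assumes S: "S \<subseteq> borel_measurable N" "\<And>f g. f \<in> S \<Longrightarrow> g \<in> S \<Longrightarrow> (\<lambda>x. f x + g x) \<in> S"
    and f: "f \<in> L2_closure N S" and g: "g \<in> L2_closure N S"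
  shows "(\<lambda>x. f x + g x) \<in> L2_closure N S"
  unfolding L2_closure_iff
proof safe
  show "(\<lambda>x. f x + g x) \<in> L2 N" using f g by (intro L2_add L2_closure_L2)
  fix e :: real assume e: "0 < e"
  then obtain f' g' where *: "f' \<in> S" "L2_sqnorm N (\<lambda>x. f' x - f x) < ennreal (e / 4)"
    "g' \<in> S" "L2_sqnorm N (\<lambda>x. g' x - g x) < ennreal (e / 4)"
    using L2_closure_approx[OF f, of "e / 4"] L2_closure_approx[OF g, of "e / 4"] by auto
  have "L2_sqnorm N (\<lambda>x. (f' x + g' x) - (f x + g x)) = L2_sqnorm N (\<lambda>x. (f' x - f x) + (g' x - g x))"
    by (simp add: algebra_simps)
  also have "\<dots> \<le> 2 * L2_sqnorm N (\<lambda>x. f' x - f x) + 2 * L2_sqnorm N (\<lambda>x. g' x - g x)"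
    using *(1,3) S(1) L2_closure_measurable[OF f] L2_closure_measurable[OF g]
    by (intro L2_sqnorm_add_le borel_measurable_diff) auto
  also have "\<dots> < ennreal e"
    by (rule ennreal_two_quarters[OF e *(2,4)])
  finally show "\<exists>h\<in>S. L2_sqnorm N (\<lambda>x. h x - (f x + g x)) < ennreal e"
    using S(2)[OF *(1,3)] by (intro bexI[of _ "\<lambda>x. f' x + g' x"]) auto
qed

lemma L2_closure_cmult:
  assumes S: "S \<subseteq> borel_measurable N" "\<And>f. f \<in> S \<Longrightarrow> (\<lambda>x. complex_of_real c * f x) \<in> S"
    and f: "f \<in> L2_closure N S"
  shows "(\<lambda>x. complex_of_real c * f x) \<in> L2_closure N S"
  unfolding L2_closure_iff
proof safe
  show "(\<lambda>x. complex_of_real c * f x) \<in> L2 N" using f by (intro L2_cmult L2_closure_L2)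
  fix e :: real assume e: "0 < e"
  \<comment> \<open>The summand 1 covers c = 0 without a case distinction.\<close>
  define d where "d = e / (c\<^sup>2 + 1)"
  have d: "0 < d" unfolding d_def using e by (intro divide_pos_pos) (auto simp: add_nonneg_pos)
  obtain g where g: "g \<in> S" "L2_sqnorm N (\<lambda>x. g x - f x) < ennreal d"
    using L2_closure_approx[OF f d] by auto
  have "L2_sqnorm N (\<lambda>x. complex_of_real c * g x - complex_of_real c * f x)
      = L2_sqnorm N (\<lambda>x. complex_of_real c * (g x - f x))"
    by (simp add: right_diff_distrib)
  also have "\<dots> = ennreal (c\<^sup>2) * L2_sqnorm N (\<lambda>x. g x - f x)"
    using g(1) S(1) L2_closure_measurable[OF f]
    by (subst L2_sqnorm_cmult) (auto intro!: borel_measurable_diff)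
  also have "\<dots> \<le> ennreal (c\<^sup>2) * ennreal d"
    using g(2) by (intro mult_left_mono) auto
  also have "\<dots> = ennreal (c\<^sup>2 * d)" by (simp add: ennreal_mult' d less_imp_le)
  also have "\<dots> < ennreal e"
  proof (rule ennreal_lessI[OF e])
    have "c\<^sup>2 * d < (c\<^sup>2 + 1) * d" using d by (simp add: distrib_right)
    also have "\<dots> = e" unfolding d_def by (simp add: add_nonneg_pos less_imp_neq[symmetric])
    finally show "c\<^sup>2 * d < e" .
  qed
  finally show "\<exists>h\<in>S. L2_sqnorm N (\<lambda>x. h x - complex_of_real c * f x) < ennreal e"
    using S(2)[OF g(1)] by (intro bexI[of _ "\<lambda>x. complex_of_real c * g x"]) auto
qed

lemma L2_closure_base: "f \<in> S \<Longrightarrow> f \<in> L2 N \<Longrightarrow> f \<in> L2_closure N S"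
  unfolding L2_closure_iff by (auto simp: L2_sqnorm_def intro!: bexI[of _ f])

lemma L2_closure_zero: "(\<lambda>_. 0) \<in> S \<Longrightarrow> (\<lambda>_. 0) \<in> L2_closure N S"
  by (auto simp: L2_closure_iff L2_def L2_sqnorm_def intro!: bexI[of _ "\<lambda>_. 0"])

lemma L2_closure_sum:
  assumes S: "S \<subseteq> borel_measurable N" "\<And>f g. f \<in> S \<Longrightarrow> g \<in> S \<Longrightarrow> (\<lambda>x. f x + g x) \<in> S" "(\<lambda>_. 0) \<in> S"
    and "\<And>i. i \<in> I \<Longrightarrow> f i \<in> L2_closure N S"
  shows "(\<lambda>x. \<Sum>i\<in>I. f i x) \<in> L2_closure N S"
  using assms(4)
proof (induction I rule: infinite_finite_induct)
  case (insert i I)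
  have "(\<lambda>x. f i x + (\<Sum>i\<in>I. f i x)) \<in> L2_closure N S"
    by (rule L2_closure_add[OF S(1,2)]) (use insert in auto)
  then show ?case using insert(1,2) by simp
qed (use L2_closure_zero[OF S(3)] in auto)

lemma L2_closure_cong_AE:
  assumes f: "f \<in> L2_closure N S" and g: "g \<in> borel_measurable N" and eq: "AE x in N. f x = g x"
  shows "g \<in> L2_closure N S"
proof -
  have "L2_sqnorm N g = L2_sqnorm N f" using eq by (intro L2_sqnorm_cong_AE) auto
  moreover have "L2_sqnorm N (\<lambda>x. h x - g x) = L2_sqnorm N (\<lambda>x. h x - f x)" for h
    using eq by (intro L2_sqnorm_cong_AE) auto
  ultimately show ?thesis using f g by (simp add: L2_closure_iff L2_def)
qed

section \<open>Square norms on products with a time interval\<close>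

lemma L2_sqnorm_pair:
  assumes "sigma_finite_measure M" and [measurable]: "G \<in> borel_measurable (N \<Otimes>\<^sub>M M)"
  shows "L2_sqnorm (N \<Otimes>\<^sub>M M) G = (\<integral>\<^sup>+t. L2_sqnorm M (\<lambda>\<xi>. G (t, \<xi>)) \<partial>N)"
    and "(\<lambda>t. L2_sqnorm M (\<lambda>\<xi>. G (t, \<xi>))) \<in> borel_measurable N"
proof -
  interpret sigma_finite_measure M by fact
  show "L2_sqnorm (N \<Otimes>\<^sub>M M) G = (\<integral>\<^sup>+t. L2_sqnorm M (\<lambda>\<xi>. G (t, \<xi>)) \<partial>N)"
    unfolding L2_sqnorm_def by (subst nn_integral_fst) auto
  show "(\<lambda>t. L2_sqnorm M (\<lambda>\<xi>. G (t, \<xi>))) \<in> borel_measurable N"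
    unfolding L2_sqnorm_def by measurable
qed

lemma L2_sqnorm_tensor:
  assumes "sigma_finite_measure M" and [measurable]: "B \<in> sets N" "v \<in> borel_measurable M"
  shows "L2_sqnorm (N \<Otimes>\<^sub>M M) (\<lambda>(t, \<xi>). indicator B t * v \<xi>) = emeasure N B * L2_sqnorm M v"
proof -
  have "L2_sqnorm (N \<Otimes>\<^sub>M M) (\<lambda>(t, \<xi>). indicator B t * v \<xi>) = (\<integral>\<^sup>+t. L2_sqnorm M (\<lambda>\<xi>. indicator B t * v \<xi>) \<partial>N)"
    by (subst L2_sqnorm_pair(1)[OF assms(1)]) auto
  also have "\<dots> = (\<integral>\<^sup>+t. L2_sqnorm M v * indicator B t \<partial>N)"
    by (intro nn_integral_cong) (auto simp: L2_sqnorm_def indicator_def)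
  also have "\<dots> = L2_sqnorm M v * emeasure N B"
    by (rule nn_integral_cmult_indicator) simp
  finally show ?thesis by (simp add: mult.commute)
qed

lemma sets_time_measure: "sets (time_measure T) = {B \<inter> {0..T} | B. B \<in> sets borel}"
  unfolding time_measure_def by (auto simp: sets_restrict_space)

lemma space_time_measure [simp]: "space (time_measure T) = {0..T}"
  by (simp add: time_measure_def space_restrict_space)

lemma measurable_time_measure: "f \<in> borel_measurable borel \<Longrightarrow> f \<in> borel_measurable (time_measure T)"
  unfolding time_measure_def by (rule measurable_restrict_space1) simp

lemma emeasure_time_measure_space: "0 \<le> T \<Longrightarrow> emeasure (time_measure T) {0..T} = ennreal T"
  unfolding time_measure_def by (subst emeasure_restrict_space) auto

lemma finite_time_measure: "0 \<le> T \<Longrightarrow> finite_measure (time_measure T)"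
  by (rule finite_measureI) (simp add: emeasure_time_measure_space)

text \<open>The half-open intervals of simple processes never contain the time 0, so sets can only
  be compared up to this null set.\<close>

lemma AE_time_measure_pos: "AE t in time_measure T. 0 < t \<and> t \<le> T"
  unfolding time_measure_def
  by (subst AE_restrict_space_iff) (use AE_lborel_singleton[of 0] in auto)

lemma AE_pair_fst:
  assumes "sigma_finite_measure N" "sigma_finite_measure M" "AE t in N. Q t"
  shows "AE x in N \<Otimes>\<^sub>M M. Q (fst x)"
proof -
  interpret pair_sigma_finite N M using assms by (simp add: pair_sigma_finite_def)
  obtain Z where Z: "{t\<in>space N. \<not> Q t} \<subseteq> Z" "Z \<in> null_sets N"
    using assms(3) unfolding eventually_ae_filter by blast
  have "emeasure (N \<Otimes>\<^sub>M M) (Z \<times> space M) = emeasure N Z * emeasure M (space M)"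
    using Z(2) by (intro M2.emeasure_pair_measure_Times) auto
  then have "Z \<times> space M \<in> null_sets (N \<Otimes>\<^sub>M M)"
    using Z(2) by (auto simp: null_sets_def)
  then show ?thesis
    by (rule AE_I') (use Z(1) in \<open>auto simp: space_pair_measure\<close>)
qed

lemma measurable_tensor:
  fixes v :: "'b \<Rightarrow> complex"
  assumes B: "B \<in> sets borel" and v: "v \<in> borel_measurable M"
  shows "(\<lambda>(t, \<xi>). indicator B t * v \<xi>) \<in> borel_measurable (time_measure T \<Otimes>\<^sub>M M)"
proof -
  have *: "(\<lambda>(t, \<xi>). w t * v \<xi>) \<in> borel_measurable (time_measure T \<Otimes>\<^sub>M M)"
    if [measurable]: "w \<in> borel_measurable (time_measure T)" for w :: "real \<Rightarrow> complex"
    using v by measurable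
  show ?thesis
    by (intro * measurable_time_measure borel_measurable_indicator B)
qed

lemma L2_sqnorm_tensor_le:
  assumes M: "sigma_finite_measure M" and T: "0 \<le> T"
    and B: "B \<in> sets borel" and v: "v \<in> borel_measurable M"
  shows "L2_sqnorm (time_measure T \<Otimes>\<^sub>M M) (\<lambda>(t, \<xi>). indicator B t * v \<xi>) \<le> ennreal T * L2_sqnorm M v"
proof -
  have "L2_sqnorm (time_measure T \<Otimes>\<^sub>M M) (\<lambda>(t, \<xi>). indicator B t * v \<xi>) =
      (\<integral>\<^sup>+t. L2_sqnorm M (\<lambda>\<xi>. indicator B t * v \<xi>) \<partial>time_measure T)"
    using L2_sqnorm_pair(1)[OF M measurable_tensor[OF B v]] by simp
  also have "\<dots> \<le> (\<integral>\<^sup>+t. L2_sqnorm M v \<partial>time_measure T)"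
    by (intro nn_integral_mono) (auto simp: L2_sqnorm_def indicator_def)
  also have "\<dots> = ennreal T * L2_sqnorm M v"
    using T by (simp add: emeasure_time_measure_space mult.commute)
  finally show ?thesis .
qed

lemma L2_tensor:
  assumes "sigma_finite_measure M" "0 \<le> T" "B \<in> sets borel" "v \<in> L2 M"
  shows "(\<lambda>(t, \<xi>). indicator B t * v \<xi>) \<in> L2 (time_measure T \<Otimes>\<^sub>M M)"
proof -
  have "L2_sqnorm (time_measure T \<Otimes>\<^sub>M M) (\<lambda>(t, \<xi>). indicator B t * v \<xi>) \<le> ennreal T * L2_sqnorm M v"
    by (rule L2_sqnorm_tensor_le[OF assms(1,2,3) L2_measurable[OF assms(4)]])
  also have "\<dots> < \<infinity>"
    using assms(4) by (simp add: L2_def ennreal_mult_less_top)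
  finally show ?thesis
    using measurable_tensor[OF assms(3) L2_measurable[OF assms(4)], of T]
    unfolding L2_def by (intro CollectI conjI)
qed

text \<open>The sets B with the asserted property form a Dynkin system. The generators {..a} meet
  (0,T] in a half-open interval or not at all; complements use subtraction in the closure; disjoint
  unions use that the time measure is finite, so that tails become small.\<close>

lemma L2_closure_tensor:
  fixes M :: "'b measure" and v :: "'b \<Rightarrow> complex"
  assumes M: "sigma_finite_measure M" and T: "0 < T"
    and S: "S \<subseteq> borel_measurable (time_measure T \<Otimes>\<^sub>M M)"
      "\<And>f g. f \<in> S \<Longrightarrow> g \<in> S \<Longrightarrow> (\<lambda>x. f x + g x) \<in> S" "(\<lambda>_. 0) \<in> S"
      "\<And>f c. f \<in> S \<Longrightarrow> (\<lambda>x. complex_of_real c * f x) \<in> S"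
    and v: "v \<in> L2 M"
    and Ioc: "\<And>a b. 0 \<le> a \<Longrightarrow> a < b \<Longrightarrow> b \<le> T \<Longrightarrow> (\<lambda>(t, \<xi>). indicator {a<..b} t * v \<xi>) \<in> S"
    and B: "B \<in> sets borel"
  shows "(\<lambda>(t, \<xi>). indicator B t * v \<xi>) \<in> L2_closure (time_measure T \<Otimes>\<^sub>M M) S"
proof -
  let ?N = "time_measure T"
  let ?cl = "L2_closure (?N \<Otimes>\<^sub>M M) S"
  interpret N: finite_measure ?N using T by (intro finite_time_measure) simp
  have N: "sigma_finite_measure ?N" by (rule N.sigma_finite_measure_axioms)
  note vm = L2_measurable[OF v]
  have L2B: "(\<lambda>(t, \<xi>). indicator B t * v \<xi>) \<in> L2 (?N \<Otimes>\<^sub>M M)" if "B \<in> sets borel" for B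
    using L2_tensor[OF M _ that v] T by simp
  have Ioc_cl: "(\<lambda>(t, \<xi>). indicator {a<..b} t * v \<xi>) \<in> ?cl" if "0 \<le> a" "a < b" "b \<le> T" for a b
    by (rule L2_closure_base[OF Ioc[OF that] L2B]) simp
  \<comment> \<open>Only the trace of a set on (0,T] matters, up to almost everywhere
    equality.\<close>
  have cong: "(\<lambda>(t, \<xi>). indicator B t * v \<xi>) \<in> ?cl"
    if "(\<lambda>(t, \<xi>). indicator A t * v \<xi>) \<in> ?cl" "B \<in> sets borel"
      "\<And>t. 0 < t \<Longrightarrow> t \<le> T \<Longrightarrow> t \<in> A \<longleftrightarrow> t \<in> B" for A B
  proof (rule L2_closure_cong_AE[OF that(1)])
    show "(\<lambda>(t, \<xi>). indicator B t * v \<xi>) \<in> borel_measurable (?N \<Otimes>\<^sub>M M)"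
      by (rule measurable_tensor[OF that(2) vm])
    have "AE t in ?N. (indicator A t :: complex) = indicator B t"
      using AE_time_measure_pos[of T] by eventually_elim (auto simp: indicator_def that(3))
    from AE_pair_fst[OF N M this]
    show "AE x in ?N \<Otimes>\<^sub>M M. (case x of (t, \<xi>) \<Rightarrow> indicator A t * v \<xi>) = (case x of (t, \<xi>) \<Rightarrow> indicator B t * v \<xi>)"
      by eventually_elim auto
  qed
  have add: "(\<lambda>(t, \<xi>). indicator A t * v \<xi> + complex_of_real c * (indicator B t * v \<xi>)) \<in> ?cl"
    if "(\<lambda>(t, \<xi>). indicator A t * v \<xi>) \<in> ?cl" "(\<lambda>(t, \<xi>). indicator B t * v \<xi>) \<in> ?cl" for A B c
  proof -
    have "(\<lambda>x. (case x of (t, \<xi>) \<Rightarrow> indicator A t * v \<xi>)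
        + complex_of_real c * (case x of (t, \<xi>) \<Rightarrow> indicator B t * v \<xi>)) \<in> ?cl"
      by (rule L2_closure_add[OF S(1,2) that(1) L2_closure_cmult[OF S(1) S(4) that(2)]])
    then show ?thesis by (simp only: case_prod_unfold)
  qed
  have zero: "(\<lambda>(t, \<xi>). indicator {} t * v \<xi>) \<in> ?cl"
    using L2_closure_zero[OF S(3)] by (simp add: case_prod_unfold)
  have borel: "A \<in> sets borel" if "A \<in> sigma_sets UNIV (range (\<lambda>a::real. {..a}))" for A
    using that by (simp add: borel_eq_atMost)
  have "Int_stable (range (\<lambda>a::real. {..a}))"
    by (auto simp: Int_stable_def)
  moreover have "range (\<lambda>a::real. {..a}) \<subseteq> Pow UNIV" by simp
  moreover have "B \<in> sigma_sets UNIV (range (\<lambda>a::real. {..a}))"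
    using B by (simp add: borel_eq_atMost)
  ultimately show ?thesis
  proof (induction rule: sigma_sets_induct_disjoint)
    case (basic A)
    then obtain a where a: "A = {..a}" by auto
    show ?case
    proof (cases "0 < a")
      case True
      then have "(\<lambda>(t, \<xi>). indicator {0<..min a T} t * v \<xi>) \<in> ?cl"
        using T by (intro Ioc_cl) auto
      then show ?thesis by (rule cong) (auto simp: a)
    next
      case False
      show ?thesis by (rule cong[OF zero]) (use False in \<open>auto simp: a\<close>)
    qed
  next
    case empty
    show ?case by (rule zero)
  next
    case (compl A)
    have "(\<lambda>(t, \<xi>). indicator {0<..T} t * v \<xi>) \<in> ?cl"
      using T by (intro Ioc_cl) auto
    then have "(\<lambda>(t, \<xi>). indicator UNIV t * v \<xi>) \<in> ?cl" by (rule cong) auto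
    from add[OF this compl(2), of "-1"]
    show ?case
      by (rule back_subst[of "\<lambda>f. f \<in> ?cl"]) (auto simp: fun_eq_iff indicator_def)
  next
    case (union A)
    have Ab: "A i \<in> sets borel" for i using union(2) by (intro borel) auto
    have U: "(\<Union>i. A i) \<in> sets borel" using Ab by auto
    \<comment> \<open>The tail of the union, cut down to [0,T]. The tails decrease, and by
      disjointness no point lies in all of them.\<close>
    define C where "C n = (\<Union>i\<in>{n..}. A i) \<inter> {0..T}" for n
    have C [measurable]: "C n \<in> sets ?N" for n
      unfolding C_def sets_time_measure using Ab by auto
    have "(\<lambda>n. emeasure ?N (C n)) \<longlonglongrightarrow> emeasure ?N (\<Inter>n. C n)"
    proof (rule Lim_emeasure_decseq)
      show "decseq C" unfolding C_def by (force simp: decseq_def)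
    qed (use C in auto)
    also have "(\<Inter>n. C n) = {}"
    proof safe
      fix x assume x: "x \<in> (\<Inter>n. C n)"
      then obtain i where i: "x \<in> A i" by (auto simp: C_def)
      from x obtain j where "Suc i \<le> j" "x \<in> A j" unfolding C_def by fastforce
      then show "x \<in> {}" using i disjoint_family_onD[OF union(1) UNIV_I UNIV_I, of i j] by auto
    qed
    finally have lim0: "(\<lambda>n. emeasure ?N (C n)) \<longlonglongrightarrow> 0" by simp
    have lim: "(\<lambda>n. emeasure ?N (C n) * L2_sqnorm M v) \<longlonglongrightarrow> 0"
      using ennreal_tendsto_cmult[OF _ lim0, of "L2_sqnorm M v"] v by (simp add: L2_def mult.commute)
    let ?U = "\<lambda>(t, \<xi>). indicator (\<Union>i. A i) t * v \<xi>"
    show ?case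
    proof (rule L2_closure_closed[OF S(1) L2B[OF U]])
      fix e :: real assume "0 < e"
      then have "eventually (\<lambda>n. emeasure ?N (C n) * L2_sqnorm M v < ennreal e) sequentially"
        using lim by (intro order_tendstoD(2)) auto
      then obtain n where n: "emeasure ?N (C n) * L2_sqnorm M v < ennreal e"
        using eventually_happens'[OF sequentially_bot] by blast
      let ?P = "\<lambda>x. \<Sum>i<n. (case x of (t, \<xi>) \<Rightarrow> indicator (A i) t * v \<xi>)"
      have P: "?P \<in> ?cl"
        by (rule L2_closure_sum[OF S(1-3)]) (use union(3) in auto)
      \<comment> \<open>For t in [0,T], a point of the unique \<open>A j\<close> containing it is
        counted by the partial sum if j < n and by the tail otherwise.\<close>
      have ind: "indicator (\<Union>i. A i) t = (\<Sum>i<n. indicator (A i) t) + (indicator (C n) t :: complex)"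
        if t: "t \<in> {0..T}" for t
      proof (cases "t \<in> (\<Union>i. A i)")
        case True
        then obtain j where j: "t \<in> A j" by blast
        have ij: "t \<in> A i \<longleftrightarrow> i = j" for i
          using j union(1) by (auto simp: disjoint_family_on_def)
        then have "(\<Sum>i<n. indicator (A i) t :: complex) = (\<Sum>i<n. if i = j then 1 else 0)"
          by (intro sum.cong) (auto simp: indicator_def)
        moreover have "t \<in> C n \<longleftrightarrow> n \<le> j" using t ij by (auto simp: C_def)
        ultimately show ?thesis using True by (auto simp: indicator_def)
      next
        case False
        then show ?thesis by (auto simp: C_def indicator_def)
      qed
      have "L2_sqnorm (?N \<Otimes>\<^sub>M M) (\<lambda>x. ?P x - ?U x) = L2_sqnorm (?N \<Otimes>\<^sub>M M) (\<lambda>(t, \<xi>). indicator (C n) t * v \<xi>)"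
        unfolding L2_sqnorm_def
        by (intro nn_integral_cong)
           (auto simp: space_pair_measure ind sum_distrib_right distrib_right norm_minus_commute)
      also have "\<dots> = emeasure ?N (C n) * L2_sqnorm M v"
        by (rule L2_sqnorm_tensor[OF M C vm])
      finally show "\<exists>g\<in>?cl. L2_sqnorm (?N \<Otimes>\<^sub>M M) (\<lambda>x. g x - ?U x) < ennreal e"
        using n P by (intro bexI[of _ ?P]) auto
    qed
  qed
qed

section \<open>Step functions in time\<close>

lemma suminf_ennreal_tendsto_0:
  fixes f :: "nat \<Rightarrow> ennreal"
  assumes "(\<Sum>n. f n) \<noteq> \<infinity>"
  shows "f \<longlonglongrightarrow> 0"
proof -
  have "f n \<noteq> \<infinity>" for n
    using assms sum_le_suminf[of f "{n}"] by (auto simp: top_unique)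
  then have f: "f n = ennreal (enn2real (f n))" for n
    by (simp add: less_top)
  then have "summable (\<lambda>n. enn2real (f n))"
    using assms by (intro summable_suminf_not_top) auto
  then have "(\<lambda>n. ennreal (enn2real (f n))) \<longlonglongrightarrow> ennreal 0"
    by (intro tendsto_ennrealI summable_LIMSEQ_zero)
  then show ?thesis using f by simp
qed

text \<open>The real span from the overview, before closure. Generating it one term at a time turns
  statements about finite sums with many parameters into inductions with a single interval and a
  single set.\<close>

inductive_set step_transforms :: "real \<Rightarrow> (real \<times> 'a::euclidean_space \<Rightarrow> complex) set" for T where
  zero: "(\<lambda>_. 0) \<in> step_transforms T"
| add: "0 \<le> a \<Longrightarrow> a < b \<Longrightarrow> b \<le> T \<Longrightarrow> A \<in> sets borel \<Longrightarrow> bounded A \<Longrightarrow> g \<in> step_transforms T \<Longrightarrow>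
    (\<lambda>x. complex_of_real c * (indicator {a<..b} (fst x) * fourier (indicator A) (snd x)) + g x) \<in> step_transforms T"

lemma step_transforms_add:
  assumes "f \<in> step_transforms T" "g \<in> step_transforms T"
  shows "(\<lambda>x. f x + g x) \<in> step_transforms T"
  using assms(1)
proof induction
  case zero
  then show ?case using assms(2) by simp
next
  case (add a b A f c)
  from step_transforms.add[OF add(1-5,7), of c] show ?case by (simp add: add.assoc)
qed

lemma step_transforms_cmult:
  assumes "f \<in> step_transforms T"
  shows "(\<lambda>x. complex_of_real r * f x) \<in> step_transforms T"
  using assms
proof induction
  case zero
  then show ?case using step_transforms.zero by simp
next
  case (add a b A f c)
  from step_transforms.add[OF add(1-5,7), of "r * c"] show ?case by (simp add: distrib_left mult.assoc)
qed

text \<open>The simple function is produced before the Fourier transform is applied. Its values are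
  rapidly decreasing, so \<open>fourier\<close> sends them into \<open>H_space\<close>, and
  composition keeps it simple.\<close>

lemma step_transforms_section:
  assumes "g \<in> step_transforms T"
  obtains f where "simple_function (time_measure T) f" "\<And>t. f t \<in> rapidly_decreasing"
    "\<And>t \<xi>. g (t, \<xi>) = fourier (f t) \<xi>"
proof -
  have "\<exists>f. simple_function (time_measure T) f \<and> (\<forall>t. f t \<in> rapidly_decreasing) \<and>
      (\<forall>t \<xi>. g (t, \<xi>) = fourier (f t) \<xi>)"
    using assms
  proof induction
    case zero
    show ?case
      by (intro exI[of _ "\<lambda>_ _. 0"]) (auto intro: rapidly_decreasing_0)
  next
    case (add a b A g c)
    then obtain f where f: "simple_function (time_measure T) f" "\<And>t. f t \<in> rapidly_decreasing"
      "\<And>t \<xi>. g (t, \<xi>) = fourier (f t) \<xi>" by blast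
    have A: "(\<lambda>x. c * (indicator {a<..b} t * indicator A x)) \<in> rapidly_decreasing" for t
      using add(4,5) by (intro rapidly_decreasing_scale rapidly_decreasing_indicator)
    have "{a<..b} = {a<..b} \<inter> {0..T}" using add(1-3) by auto
    then have "{a<..b} \<in> sets (time_measure T)"
      unfolding sets_time_measure by (intro CollectI exI[of _ "{a<..b}"] conjI) auto
    then have "simple_function (time_measure T) (indicator {a<..b} :: real \<Rightarrow> real)"
      by (rule simple_function_indicator)
    from simple_function_compose2[OF this f(1), of "\<lambda>i u x. c * (i * indicator A x) + u x"]
    have "simple_function (time_measure T) (\<lambda>t x. c * (indicator {a<..b} t * indicator A x) + f t x)" .
    moreover have "(\<lambda>x. c * (indicator {a<..b} t * indicator A x) + f t x) \<in> rapidly_decreasing" for t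
      by (rule rapidly_decreasing_add[OF A f(2)])
    moreover have "complex_of_real c * (indicator {a<..b} (fst (t, \<xi>)) * fourier (indicator A) (snd (t, \<xi>))) + g (t, \<xi>)
        = fourier (\<lambda>x. c * (indicator {a<..b} t * indicator A x) + f t x) \<xi>" for t \<xi>
      unfolding fourier_add[OF A[THEN rapidly_decreasing_integrable] f(2)[THEN rapidly_decreasing_integrable]]
        fourier_cmult f(3) fst_conv snd_conv by (cases "t \<in> {a<..b}") auto
    ultimately show ?case by blast
  qed
  then show ?thesis using that by blast
qed

section \<open>Products of a time indicator with an element of H lie in the closure\<close>

context spectral_measure
begin

lemma sigma_finite_\<mu>: "sigma_finite_measure \<mu>"
  by (rule tempered_measure_sigma_finite[OF tempered_\<mu>])

lemma step_transforms_measurable: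
  "step_transforms T \<subseteq> borel_measurable (time_measure T \<Otimes>\<^sub>M \<mu>)"
proof
  fix g :: "real \<times> 'a \<Rightarrow> complex" assume "g \<in> step_transforms T"
  then show "g \<in> borel_measurable (time_measure T \<Otimes>\<^sub>M \<mu>)"
  proof induction
    case (add a b A g c)
    have "fourier (indicator A) \<in> borel_measurable \<mu>"
      using add(4) by (simp add: fourier_measurable)
    from measurable_tensor[OF _ this, of "{a<..b}" T] add(7) show ?case
      by (simp add: case_prod_unfold)
  qed simp
qed

abbreviation step_closure :: "real \<Rightarrow> (real \<times> 'a \<Rightarrow> complex) set" where
  "step_closure T \<equiv> L2_closure (time_measure T \<Otimes>\<^sub>M \<mu>) (step_transforms T)"

lemmas step_closure_sum =
  L2_closure_sum[OF step_transforms_measurable step_transforms_add step_transforms.zero]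

lemmas step_closure_cmult = L2_closure_cmult[OF step_transforms_measurable step_transforms_cmult]

lemmas step_closure_closed = L2_closure_closed[OF step_transforms_measurable]

lemma tensor_fourier_indicator_mem_step_closure:
  assumes T: "0 < T" and B: "B \<in> sets borel" and A: "A \<in> sets borel" "bounded A"
  shows "(\<lambda>(t, \<xi>). indicator B t * fourier (indicator A) \<xi>) \<in> step_closure T"
proof (rule L2_closure_tensor[OF sigma_finite_\<mu> T step_transforms_measurable
      step_transforms_add step_transforms.zero step_transforms_cmult _ _ B])
  show "fourier (indicator A) \<in> L2 \<mu>"
    by (intro fourier_L2 rapidly_decreasing_indicator A)
  show "(\<lambda>(t, \<xi>). indicator {a<..b} t * fourier (indicator A) \<xi>) \<in> step_transforms T"
    if "0 \<le> a" "a < b" "b \<le> T" for a b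
    using step_transforms.add[OF that A step_transforms.zero, of 1] by (simp add: case_prod_unfold)
qed auto

text \<open>The map from v to 1_B v multiplies squared norms by at most T, so membership in the
  closed space passes to limits of v in L^2(\<mu>).\<close>

lemma tensor_mem_step_closure_approx:
  assumes T: "0 < T" and B: "B \<in> sets borel" and v: "v \<in> L2 \<mu>"
    and approx: "\<And>e. 0 < e \<Longrightarrow> \<exists>w. (\<lambda>(t, \<xi>). indicator B t * w \<xi>) \<in> step_closure T \<and>
      w \<in> borel_measurable borel \<and> L2_sqnorm \<mu> (\<lambda>\<xi>. w \<xi> - v \<xi>) < ennreal e"
  shows "(\<lambda>(t, \<xi>). indicator B t * v \<xi>) \<in> step_closure T"
proof (rule step_closure_closed)
  show "(\<lambda>(t, \<xi>). indicator B t * v \<xi>) \<in> L2 (time_measure T \<Otimes>\<^sub>M \<mu>)"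
    using T by (intro L2_tensor[OF sigma_finite_\<mu> _ B v]) simp
  fix e :: real assume e: "0 < e"
  \<comment> \<open>The factor T turns e / (2 T) into e / 2, which is strictly below e.\<close>
  then obtain w where w: "(\<lambda>(t, \<xi>). indicator B t * w \<xi>) \<in> step_closure T"
      "w \<in> borel_measurable borel" "L2_sqnorm \<mu> (\<lambda>\<xi>. w \<xi> - v \<xi>) < ennreal (e / (2 * T))"
    using approx[of "e / (2 * T)"] T by auto
  have "L2_sqnorm (time_measure T \<Otimes>\<^sub>M \<mu>) (\<lambda>x. (case x of (t, \<xi>) \<Rightarrow> indicator B t * w \<xi>) -
      (case x of (t, \<xi>) \<Rightarrow> indicator B t * v \<xi>)) =
      L2_sqnorm (time_measure T \<Otimes>\<^sub>M \<mu>) (\<lambda>(t, \<xi>). indicator B t * (w \<xi> - v \<xi>))"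
    by (simp add: case_prod_unfold right_diff_distrib)
  also have "\<dots> \<le> ennreal T * L2_sqnorm \<mu> (\<lambda>\<xi>. w \<xi> - v \<xi>)"
    using T w(2) L2_measurable[OF v] by (intro L2_sqnorm_tensor_le[OF sigma_finite_\<mu> _ B]) auto
  also have "\<dots> \<le> ennreal T * ennreal (e / (2 * T))"
    using w(3) by (intro mult_left_mono) auto
  also have "\<dots> = ennreal (e / 2)"
    using T e by (simp add: ennreal_mult[symmetric])
  also have "\<dots> < ennreal e"
    using e by (intro ennreal_lessI) auto
  finally show "\<exists>g\<in>step_closure T. L2_sqnorm (time_measure T \<Otimes>\<^sub>M \<mu>)
      (\<lambda>x. g x - (case x of (t, \<xi>) \<Rightarrow> indicator B t * v \<xi>)) < ennreal e"
    using w(1) by blast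
qed

text \<open>A simple function p close to \<open>f\<close> in the weighted supremum norm has F p
  close to F f in L^2(\<mu>), and F p is a real combination of transforms of indicators.\<close>

lemma tensor_fourier_mem_step_closure:
  assumes T: "0 < T" and B: "B \<in> sets borel" and f: "f \<in> rapidly_decreasing"
  shows "(\<lambda>(t, \<xi>). indicator B t * fourier f \<xi>) \<in> step_closure T"
proof (rule tensor_mem_step_closure_approx[OF T B fourier_L2[OF f]])
  fix e :: real assume e: "0 < e"
  obtain C m where C: "0 < C" "\<And>f c. f \<in> rapidly_decreasing \<Longrightarrow> 0 \<le> c \<Longrightarrow> (\<And>x. \<bar>f x\<bar> \<le> c * wt m x) \<Longrightarrow>
       L2_sqnorm \<mu> (fourier f) \<le> ennreal (C * c\<^sup>2)"
    using L2_sqnorm_fourier_le by blast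
  \<comment> \<open>Chosen so that C d^2 = e / 2.\<close>
  define d where "d = sqrt (e / (2 * C))"
  have d: "0 < d" "d\<^sup>2 = e / (2 * C)" unfolding d_def using e C(1) by auto
  obtain J :: "int set" and c A where A: "finite J" "\<And>j. A j \<in> sets borel" "\<And>j. bounded (A j)"
    and le: "\<And>x. \<bar>f x - (\<Sum>j\<in>J. c j * indicator (A j) x)\<bar> \<le> d * wt m x"
    using rapidly_decreasing_simple_approx[OF f d(1), of m] by metis
  define p where "p x = (\<Sum>j\<in>J. c j * indicator (A j) x)" for x
  have rd: "(\<lambda>x. c j * indicator (A j) x) \<in> rapidly_decreasing" for j
    by (intro rapidly_decreasing_scale rapidly_decreasing_indicator A)
  have p: "p \<in> rapidly_decreasing"
    unfolding p_def[abs_def] by (intro rapidly_decreasing_sum rd)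
  have Fp: "fourier p \<xi> = (\<Sum>j\<in>J. complex_of_real (c j) * fourier (indicator (A j)) \<xi>)" for \<xi>
    unfolding p_def[abs_def]
    by (subst fourier_sum[OF rapidly_decreasing_integrable[OF rd]]) (simp add: fourier_cmult)
  have "(\<lambda>x. \<Sum>j\<in>J. complex_of_real (c j) * (case x of (t, \<xi>) \<Rightarrow> indicator B t * fourier (indicator (A j)) \<xi>)) \<in> step_closure T"
    by (intro step_closure_sum step_closure_cmult tensor_fourier_indicator_mem_step_closure T B A)
  then have "(\<lambda>(t, \<xi>). indicator B t * fourier p \<xi>) \<in> step_closure T"
    by (simp add: Fp case_prod_unfold sum_distrib_left mult.left_commute)
  moreover have "fourier p \<in> borel_measurable borel"
    by (intro fourier_measurable rapidly_decreasing_measurable p)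
  moreover have "L2_sqnorm \<mu> (\<lambda>\<xi>. fourier p \<xi> - fourier f \<xi>) < ennreal e"
  proof -
    have "L2_sqnorm \<mu> (\<lambda>\<xi>. fourier p \<xi> - fourier f \<xi>) = L2_sqnorm \<mu> (fourier (\<lambda>x. p x - f x))"
      using fourier_diff[OF rapidly_decreasing_integrable[OF p] rapidly_decreasing_integrable[OF f]]
      by (simp add: L2_sqnorm_def)
    also have "\<dots> \<le> ennreal (C * d\<^sup>2)"
    proof (rule C(2))
      show "(\<lambda>x. p x - f x) \<in> rapidly_decreasing"
        using rapidly_decreasing_add[OF p rapidly_decreasing_scale[OF f, of "-1"]] by simp
      show "\<bar>p x - f x\<bar> \<le> d * wt m x" for x
        using le[of x] by (simp add: p_def abs_minus_commute)
    qed (use d in simp)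
    also have "\<dots> < ennreal e"
      using C(1) e by (intro ennreal_lessI) (auto simp: d(2))
    finally show ?thesis .
  qed
  ultimately show "\<exists>w. (\<lambda>(t, \<xi>). indicator B t * w \<xi>) \<in> step_closure T \<and>
      w \<in> borel_measurable borel \<and> L2_sqnorm \<mu> (\<lambda>\<xi>. w \<xi> - fourier f \<xi>) < ennreal e"
    by blast
qed

lemma zero_mem_H_space: "(\<lambda>_. 0) \<in> H_space \<mu>"
proof -
  have "fourier (\<lambda>_::'a. 0) = (\<lambda>_. 0)" by (rule ext) simp
  then show ?thesis using fourier_mem_H_space[OF rapidly_decreasing_0] by simp
qed

lemma H_space_L2: "v \<in> H_space \<mu> \<Longrightarrow> v \<in> L2 \<mu>"
  unfolding H_space_def by (rule L2_closure_L2)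

lemma fourier_schwartz_measurable: "fourier ` schwartz \<subseteq> borel_measurable \<mu>"
  by (auto intro!: fourier_measurable rapidly_decreasing_measurable schwartz_rapidly_decreasing)

lemma tensor_mem_step_closure:
  assumes T: "0 < T" and B: "B \<in> sets borel" and v: "v \<in> H_space \<mu>"
  shows "(\<lambda>(t, \<xi>). indicator B t * v \<xi>) \<in> step_closure T"
proof (rule tensor_mem_step_closure_approx[OF T B H_space_L2[OF v]])
  fix e :: real assume "0 < e"
  then obtain w where w: "w \<in> fourier ` schwartz" "L2_sqnorm \<mu> (\<lambda>\<xi>. w \<xi> - v \<xi>) < ennreal e"
    using L2_closure_approx v unfolding H_space_def by blast
  then show "\<exists>w. (\<lambda>(t, \<xi>). indicator B t * w \<xi>) \<in> step_closure T \<and>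
      w \<in> borel_measurable borel \<and> L2_sqnorm \<mu> (\<lambda>\<xi>. w \<xi> - v \<xi>) < ennreal e"
    using fourier_schwartz_measurable tensor_fourier_mem_step_closure[OF T B schwartz_rapidly_decreasing]
    by auto
qed

text \<open>A simple function is the finite sum over its values v of the products 1_{u = v} v. The
  values are representatives, and the level sets are taken inside [0,T], where they are
  Borel.\<close>

lemma simple_function_mem_step_closure:
  assumes T: "0 < T" and u: "simple_function (time_measure T) u" "u ` {0..T} \<subseteq> H_space \<mu>"
  obtains U where "U \<in> step_closure T" "\<And>t \<xi>. t \<in> {0..T} \<Longrightarrow> U (t, \<xi>) = u t \<xi>"
proof -
  define B where "B v = u -` {v} \<inter> {0..T}" for v
  define U where "U x = (\<Sum>v\<in>u ` {0..T}. (case x of (t, \<xi>) \<Rightarrow> indicator (B v) t * v \<xi>))" for x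
  have fin: "finite (u ` {0..T})" using simple_functionD(1)[OF u(1)] by simp
  have B: "B v \<in> sets borel" for v
    using simple_functionD(2)[OF u(1), of "{v}"] unfolding B_def sets_time_measure by auto
  have "U \<in> step_closure T"
    unfolding U_def[abs_def] using u(2) by (intro step_closure_sum tensor_mem_step_closure T B) auto
  moreover have "U (t, \<xi>) = u t \<xi>" if t: "t \<in> {0..T}" for t \<xi>
  proof -
    have "U (t, \<xi>) = (\<Sum>v\<in>u ` {0..T}. if v = u t then u t \<xi> else 0)"
      unfolding U_def using t by (auto simp: B_def indicator_def intro!: sum.cong)
    then show ?thesis using fin t by simp
  qed
  ultimately show ?thesis using that by blast
qed

section \<open>The closure of the step functions and Bochner square integrability\<close>

lemma section_measurable:
  assumes "G \<in> borel_measurable (time_measure T \<Otimes>\<^sub>M \<mu>)" "t \<in> {0..T}"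
  shows "(\<lambda>\<xi>. G (t, \<xi>)) \<in> borel_measurable \<mu>"
  using measurable_Pair2[OF assms(1)] assms(2) by simp

text \<open>The approximating simple functions are truncated where their norm exceeds twice that of
  the limit, so that dominated convergence applies to their squared distances.\<close>

lemma H_T_subset_step_closure:
  assumes T: "0 < T" and G: "G \<in> H_T \<mu> T"
  shows "G \<in> step_closure T"
proof -
  let ?N = "time_measure T"
  obtain h where G2: "G \<in> L2 (?N \<Otimes>\<^sub>M \<mu>)" and h: "h \<in> bochner_L2 ?N \<mu> (H_space \<mu>)"
    and eq: "AE t in ?N. AE \<xi> in \<mu>. G (t, \<xi>) = h t \<xi>"
    using G unfolding H_T_def by blast
  obtain s :: "nat \<Rightarrow> real \<Rightarrow> 'a \<Rightarrow> complex" where s: "\<And>n. simple_function ?N (s n)"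
    "\<And>n. s n ` space ?N \<subseteq> H_space \<mu>"
    "AE t in ?N. (\<lambda>n. L2_sqnorm \<mu> (\<lambda>\<xi>. s n t \<xi> - h t \<xi>)) \<longlonglongrightarrow> 0"
    using h unfolding bochner_L2_def strongly_measurable_def by blast
  note Gm = L2_measurable[OF G2]
  \<comment> \<open>The norm of the section of \<open>G\<close> is used instead of that of
    \<open>h\<close>: joint measurability is known for \<open>G\<close>, and it makes
    \<open>a\<close> measurable.\<close>
  define a where "a t = L2_sqnorm \<mu> (\<lambda>\<xi>. G (t, \<xi>))" for t
  have a_meas [measurable]: "a \<in> borel_measurable ?N"
    unfolding a_def[abs_def] by (rule L2_sqnorm_pair(2)[OF sigma_finite_\<mu> Gm])
  have a_int: "(\<integral>\<^sup>+t. a t \<partial>?N) < \<infinity>"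
    using G2 unfolding a_def[abs_def] L2_def by (simp add: L2_sqnorm_pair(1)[OF sigma_finite_\<mu> Gm, symmetric])
  have a_fin: "AE t in ?N. a t \<noteq> \<infinity>"
    by (rule nn_integral_noteq_infinite) (use a_int in auto)
  \<comment> \<open>The factor 4 is the square of 2: once the squared distance of
    \<open>s n t\<close> to \<open>G\<close> is below \<open>a t\<close>, the squared norm of
    \<open>s n t\<close> is at most 2 \<open>a t\<close> + 2 \<open>a t\<close>.\<close>
  define E where "E n = {t \<in> space ?N. L2_sqnorm \<mu> (s n t) \<le> 4 * a t}" for n
  have E: "E n \<in> sets ?N" for n
  proof -
    have "simple_function ?N (\<lambda>t. L2_sqnorm \<mu> (s n t))"
      using simple_function_compose[OF s(1)[of n], of "L2_sqnorm \<mu>"] by (simp add: comp_def)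
    then have [measurable]: "(\<lambda>t. L2_sqnorm \<mu> (s n t)) \<in> borel_measurable ?N"
      by (rule borel_measurable_simple_function)
    show ?thesis unfolding E_def by measurable
  qed
  define u where "u n t = (if t \<in> E n then s n t else (\<lambda>_. 0))" for n t
  have u_simple: "simple_function ?N (u n)" for n
    unfolding u_def[abs_def] using E[of n] s(1)[of n] sets.sets_into_space[OF E[of n]]
    by (intro simple_function_If_set) (auto simp: Int_absorb2)
  have u_H: "u n ` {0..T} \<subseteq> H_space \<mu>" for n
    using s(2)[of n] zero_mem_H_space unfolding u_def by auto
  have "\<exists>U. U \<in> step_closure T \<and> (\<forall>t\<in>{0..T}. \<forall>\<xi>. U (t, \<xi>) = u n t \<xi>)" for n
    by (metis simple_function_mem_step_closure[OF T u_simple u_H])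
  then obtain U where U: "\<And>n. U n \<in> step_closure T" "\<And>n t \<xi>. t \<in> {0..T} \<Longrightarrow> U n (t, \<xi>) = u n t \<xi>"
    by metis
  note Um = L2_closure_measurable[OF U(1)]
  have diff_meas: "(\<lambda>x. U n x - G x) \<in> borel_measurable (?N \<Otimes>\<^sub>M \<mu>)" for n
    using Um[of n] Gm by simp
  let ?d = "\<lambda>n t. L2_sqnorm \<mu> (\<lambda>\<xi>. U n (t, \<xi>) - G (t, \<xi>))"
  have s_meas: "s n t \<in> borel_measurable \<mu>" if "t \<in> {0..T}" for n t
    using s(2)[of n] that by (intro L2_measurable H_space_L2) auto
  have "(\<lambda>n. \<integral>\<^sup>+t. ?d n t \<partial>?N) \<longlonglongrightarrow> (\<integral>\<^sup>+t. 0 \<partial>?N)"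
  \<comment> \<open>The constant is 2 * 4 + 2: the truncated function contributes 4
    \<open>a t\<close> and \<open>G\<close> contributes \<open>a t\<close>, each doubled.\<close>
  proof (rule nn_integral_dominated_convergence[where w="\<lambda>t. 10 * a t"])
    show "?d n \<in> borel_measurable ?N" for n
      using L2_sqnorm_pair(2)[OF sigma_finite_\<mu> diff_meas[of n]] by simp
    show "(\<integral>\<^sup>+t. 10 * a t \<partial>?N) < \<infinity>"
      using a_int by (simp add: nn_integral_cmult ennreal_mult_less_top)
    show "AE t in ?N. ?d n t \<le> 10 * a t" for n
    proof (rule AE_I2)
      fix t assume "t \<in> space ?N"
      then have t: "t \<in> {0..T}" by simp
      have um: "u n t \<in> borel_measurable \<mu>"
        using s_meas[OF t] by (simp add: u_def)
      have "?d n t = L2_sqnorm \<mu> (\<lambda>\<xi>. u n t \<xi> + (- 1) * G (t, \<xi>))"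
        using U(2)[OF t] by simp
      also have "\<dots> \<le> 2 * L2_sqnorm \<mu> (u n t) + 2 * L2_sqnorm \<mu> (\<lambda>\<xi>. (- 1) * G (t, \<xi>))"
        using um section_measurable[OF Gm t] by (intro L2_sqnorm_add_le) auto
      also have "L2_sqnorm \<mu> (\<lambda>\<xi>. (- 1) * G (t, \<xi>)) = a t"
        unfolding a_def L2_sqnorm_def by simp
      also have "L2_sqnorm \<mu> (u n t) \<le> 4 * a t"
        by (simp add: u_def E_def L2_sqnorm_def)
      also have "2 * (4 * a t) + 2 * a t = 10 * a t"
        by (simp add: mult.assoc[symmetric] distrib_right[symmetric])
      finally show "?d n t \<le> 10 * a t" by (simp add: mult_left_mono add_right_mono)
    qed
    show "AE t in ?N. (\<lambda>n. ?d n t) \<longlonglongrightarrow> 0"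
      using s(3) eq a_fin AE_space
    proof eventually_elim
      case (elim t)
      then have t: "t \<in> {0..T}" by simp
      have "L2_sqnorm \<mu> (\<lambda>\<xi>. s n t \<xi> - h t \<xi>) = L2_sqnorm \<mu> (\<lambda>\<xi>. s n t \<xi> - G (t, \<xi>))" for n
        using elim(2) by (intro L2_sqnorm_cong_AE) auto
      then have lim: "(\<lambda>n. L2_sqnorm \<mu> (\<lambda>\<xi>. s n t \<xi> - G (t, \<xi>))) \<longlonglongrightarrow> 0"
        using elim(1) by simp
      have "\<forall>\<^sub>F n in sequentially. ?d n t \<le> L2_sqnorm \<mu> (\<lambda>\<xi>. s n t \<xi> - G (t, \<xi>))"
      \<comment> \<open>If \<open>a t\<close> = 0, a strict inequality against it is out of reach,
        but then the value 0 used by the truncation is at distance 0 from the section of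
        \<open>G\<close>.\<close>
      proof (cases "a t = 0")
        case True
        have "?d n t \<le> L2_sqnorm \<mu> (\<lambda>\<xi>. s n t \<xi> - G (t, \<xi>))" for n
          using U(2)[OF t] True by (cases "t \<in> E n") (simp_all add: u_def a_def L2_sqnorm_def)
        then show ?thesis by simp
      next
        case False
        then have "\<forall>\<^sub>F n in sequentially. L2_sqnorm \<mu> (\<lambda>\<xi>. s n t \<xi> - G (t, \<xi>)) < a t"
          using lim by (intro order_tendstoD(2)) (auto simp: zero_less_iff_neq_zero)
        then show ?thesis
        proof eventually_elim
          case (elim n)
          have "L2_sqnorm \<mu> (s n t) = L2_sqnorm \<mu> (\<lambda>\<xi>. (s n t \<xi> - G (t, \<xi>)) + G (t, \<xi>))"
            by simp
          also have "\<dots> \<le> 2 * L2_sqnorm \<mu> (\<lambda>\<xi>. s n t \<xi> - G (t, \<xi>)) + 2 * a t"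
            unfolding a_def using s_meas[OF t] section_measurable[OF Gm t]
            by (intro L2_sqnorm_add_le) auto
          also have "\<dots> \<le> 2 * a t + 2 * a t"
            using elim by (intro add_right_mono mult_left_mono) auto
          also have "\<dots> = 4 * a t"
            by (simp add: distrib_right[symmetric])
          finally have "t \<in> E n" using t by (simp add: E_def)
          then show ?case using U(2)[OF t] by (simp add: u_def)
        qed
      qed
      then show ?case
        by (rule tendsto_sandwich[OF always_eventually _ tendsto_const lim, rotated]) simp
    qed
  qed auto
  then have lim: "(\<lambda>n. L2_sqnorm (?N \<Otimes>\<^sub>M \<mu>) (\<lambda>x. U n x - G x)) \<longlonglongrightarrow> 0"
    by (simp add: L2_sqnorm_pair(1)[OF sigma_finite_\<mu> diff_meas])
  show ?thesis
  proof (rule step_closure_closed[OF G2])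
    fix e :: real assume "0 < e"
    then have "\<forall>\<^sub>F n in sequentially. L2_sqnorm (?N \<Otimes>\<^sub>M \<mu>) (\<lambda>x. U n x - G x) < ennreal e"
      using lim by (intro order_tendstoD(2)) auto
    from eventually_happens'[OF sequentially_bot this]
    show "\<exists>g\<in>step_closure T. L2_sqnorm (?N \<Otimes>\<^sub>M \<mu>) (\<lambda>x. g x - G x) < ennreal e"
      using U(1) by blast
  qed
qed

text \<open>Step functions within 2^-n of \<open>G\<close> have summable squared distances, so for
  almost every t their sections converge to that of \<open>G\<close> along the whole sequence. H is
  closed, hence contains the limit, and the same step functions witness strong
  measurability.\<close>

lemma step_closure_subset_H_T:
  assumes T: "0 < T" and G: "G \<in> step_closure T"
  shows "G \<in> H_T \<mu> T"
proof -
  let ?N = "time_measure T"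
  have G2: "G \<in> L2 (?N \<Otimes>\<^sub>M \<mu>)" by (rule L2_closure_L2[OF G])
  note Gm = L2_measurable[OF G2]
  have "\<exists>g\<in>step_transforms T. L2_sqnorm (?N \<Otimes>\<^sub>M \<mu>) (\<lambda>x. g x - G x) < ennreal ((1/2) ^ n)" for n :: nat
    by (rule L2_closure_approx[OF G]) simp
  then obtain g where g: "\<And>n. g n \<in> step_transforms T"
    "\<And>n. L2_sqnorm (?N \<Otimes>\<^sub>M \<mu>) (\<lambda>x. g n x - G x) < ennreal ((1/2) ^ n)"
    by metis
  have diff_meas: "(\<lambda>x. g n x - G x) \<in> borel_measurable (?N \<Otimes>\<^sub>M \<mu>)" for n
    using g(1)[of n] step_transforms_measurable Gm by (intro borel_measurable_diff) auto
  let ?d = "\<lambda>n t. L2_sqnorm \<mu> (\<lambda>\<xi>. g n (t, \<xi>) - G (t, \<xi>))"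
  have d_meas [measurable]: "?d n \<in> borel_measurable ?N" for n
    using L2_sqnorm_pair(2)[OF sigma_finite_\<mu> diff_meas[of n]] by simp
  have "(\<integral>\<^sup>+t. (\<Sum>n. ?d n t) \<partial>?N) = (\<Sum>n. \<integral>\<^sup>+t. ?d n t \<partial>?N)"
    by (rule nn_integral_suminf) (rule d_meas)
  also have "\<dots> = (\<Sum>n. L2_sqnorm (?N \<Otimes>\<^sub>M \<mu>) (\<lambda>x. g n x - G x))"
    by (simp add: L2_sqnorm_pair(1)[OF sigma_finite_\<mu> diff_meas])
  also have "\<dots> \<le> (\<Sum>n. ennreal ((1/2) ^ n))"
    by (intro suminf_le) (use g(2) in \<open>auto intro: less_imp_le\<close>)
  also have "\<dots> < \<infinity>"
    by (subst suminf_ennreal2) (auto intro: summable_geometric)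
  finally have "AE t in ?N. (\<Sum>n. ?d n t) \<noteq> \<infinity>"
    by (intro nn_integral_noteq_infinite) auto
  then have lim: "AE t in ?N. (\<lambda>n. ?d n t) \<longlonglongrightarrow> 0"
    by eventually_elim (rule suminf_ennreal_tendsto_0)
  have "(\<integral>\<^sup>+t. L2_sqnorm \<mu> (\<lambda>\<xi>. G (t, \<xi>)) \<partial>?N) < \<infinity>"
    using G2 L2_sqnorm_pair(1)[OF sigma_finite_\<mu> Gm] by (simp add: L2_def)
  then have fin: "AE t in ?N. L2_sqnorm \<mu> (\<lambda>\<xi>. G (t, \<xi>)) \<noteq> \<infinity>"
    by (intro nn_integral_noteq_infinite L2_sqnorm_pair(2)[OF sigma_finite_\<mu> Gm]) auto
  have g_H: "(\<lambda>\<xi>. g n (t, \<xi>)) \<in> H_space \<mu>" for n t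
  proof -
    obtain f where "f \<in> rapidly_decreasing" "\<And>\<xi>. g n (t, \<xi>) = fourier f \<xi>"
      using step_transforms_section[OF g(1)[of n]] by metis
    then show ?thesis using fourier_mem_H_space[of f] by (simp add: fun_eq_iff[symmetric])
  qed
  have GH: "AE t in ?N. (\<lambda>\<xi>. G (t, \<xi>)) \<in> H_space \<mu>"
    using lim fin AE_space
  proof eventually_elim
    case (elim t)
    show ?case unfolding H_space_def
    proof (rule L2_closure_closed[OF fourier_schwartz_measurable])
      show "(\<lambda>\<xi>. G (t, \<xi>)) \<in> L2 \<mu>"
        using section_measurable[OF Gm] elim(2,3) by (simp add: L2_def less_top)
      fix e :: real assume "0 < e"
      then have "\<forall>\<^sub>F n in sequentially. ?d n t < ennreal e"
        using elim(1) by (intro order_tendstoD(2)) auto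
      then obtain n where "?d n t < ennreal e"
        using eventually_happens'[OF sequentially_bot] by blast
      then show "\<exists>w\<in>L2_closure \<mu> (fourier ` schwartz). L2_sqnorm \<mu> (\<lambda>\<xi>. w \<xi> - G (t, \<xi>)) < ennreal e"
        using g_H[of n t] unfolding H_space_def by (rule bexI[where x="\<lambda>\<xi>. g n (t, \<xi>)"])
    qed
  qed
  \<comment> \<open>\<open>bochner_L2\<close> asks for values in H at every time, so the exceptional
    null set is filled with 0.\<close>
  define h where "h t = (if (\<lambda>\<xi>. G (t, \<xi>)) \<in> H_space \<mu> then (\<lambda>\<xi>. G (t, \<xi>)) else (\<lambda>_. 0))" for t
  have eq: "AE t in ?N. h t = (\<lambda>\<xi>. G (t, \<xi>))"
    using GH by eventually_elim (simp add: h_def)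
  have "h \<in> bochner_L2 ?N \<mu> (H_space \<mu>)"
    unfolding bochner_L2_def
  proof (intro CollectI conjI)
    show "h ` space ?N \<subseteq> H_space \<mu>"
      using zero_mem_H_space by (auto simp: h_def)
    have "simple_function ?N (\<lambda>t \<xi>. g n (t, \<xi>))" for n
    proof -
      obtain f where f: "simple_function ?N f" "\<And>t \<xi>. g n (t, \<xi>) = fourier (f t) \<xi>"
        using step_transforms_section[OF g(1)[of n]] by metis
      have "simple_function ?N (fourier \<circ> f)" by (rule simple_function_compose[OF f(1)])
      also have "fourier \<circ> f = (\<lambda>t \<xi>. g n (t, \<xi>))" using f(2) by (simp add: fun_eq_iff)
      finally show ?thesis .
    qed
    moreover have "AE t in ?N. (\<lambda>n. L2_sqnorm \<mu> (\<lambda>\<xi>. g n (t, \<xi>) - h t \<xi>)) \<longlonglongrightarrow> 0"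
      using lim eq by eventually_elim simp
    ultimately show "strongly_measurable ?N \<mu> (H_space \<mu>) h"
      unfolding strongly_measurable_def using g_H
      by (intro exI[of _ "\<lambda>n t \<xi>. g n (t, \<xi>)"]) auto
    have "(\<integral>\<^sup>+t. L2_sqnorm \<mu> (h t) \<partial>?N) = (\<integral>\<^sup>+t. L2_sqnorm \<mu> (\<lambda>\<xi>. G (t, \<xi>)) \<partial>?N)"
      using eq by (intro nn_integral_cong_AE) (auto elim!: AE_mp)
    then show "(\<integral>\<^sup>+t. L2_sqnorm \<mu> (h t) \<partial>?N) < \<infinity>"
      using G2 L2_sqnorm_pair(1)[OF sigma_finite_\<mu> Gm] by (simp add: L2_def)
  qed
  moreover have "AE t in ?N. AE \<xi> in \<mu>. G (t, \<xi>) = h t \<xi>"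
    using eq by eventually_elim simp
  ultimately show ?thesis
    unfolding H_T_def using G2 by blast
qed

end

section \<open>Simple processes\<close>

lemma time_noise_index:
  fixes A :: "'a::euclidean_space set"
  assumes "0 \<le> s" "A \<in> sets borel" "bounded A"
  shows "(\<lambda>t x. indicator {0..s} t * indicator A x) \<in> noise_index"
proof -
  have [measurable]: "A \<in> sets borel" by fact
  have "(\<lambda>(t, x). indicator {0..s} t * indicator A x :: real) \<in> borel_measurable (borel \<Otimes>\<^sub>M (borel :: 'a measure))"
    by measurable
  then have "(\<lambda>(t, x). indicator {0..s} t * indicator A x :: real) \<in> borel_measurable (borel :: (real \<times> 'a) measure)"
    by (simp only: borel_prod)
  moreover have "bounded (range (\<lambda>(t, x). indicator {0..s} t * indicator A x :: real))"
    by (rule boundedI[of _ 1]) (auto simp: indicator_def)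
  moreover have "bounded {(t, x). indicator {0..s} t * indicator A x \<noteq> (0::real)}"
    by (rule bounded_subset[OF bounded_Times[OF bounded_closed_interval[of 0 s] assms(3)]])
       (auto simp: indicator_def split: if_splits)
  ultimately show ?thesis unfolding noise_index_def by auto
qed

lemma gaussian_noise_measurable:
  assumes "gaussian_noise P \<Gamma> F" "\<phi> \<in> noise_index"
  shows "F \<phi> \<in> borel_measurable P"
proof -
  have "\<forall>J c. finite J \<and> J \<subseteq> noise_index \<longrightarrow> gaussian_rv P (\<lambda>\<omega>. \<Sum>i\<in>J. c i * F i \<omega>)"
    using assms(1) unfolding gaussian_noise_def centered_gaussian_process_def by blast
  from this[rule_format, of "{\<phi>}" "\<lambda>_. 1"] assms(2)
  show ?thesis by (simp add: gaussian_rv_def)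
qed

text \<open>The generating events are preimages under values of the noise, which are random
  variables on \<open>P\<close>. So each member of the filtration is a sub-sigma-algebra of the
  events of \<open>P\<close>.\<close>

lemma noise_filtration_measurable:
  fixes \<Gamma> :: "'a::euclidean_space measure"
  assumes F: "gaussian_noise P \<Gamma> F" and X: "X \<in> borel_measurable (noise_filtration P F a)"
  shows "X \<in> borel_measurable P"
proof -
  let ?E = "{martingale_measure F s A -` B \<inter> space P | s A B.
        0 \<le> s \<and> s \<le> a \<and> A \<in> sets borel \<and> bounded A \<and> B \<in> sets borel}"
  have E: "?E \<subseteq> sets P"
  proof safe
    fix s :: real and B :: "real set" and A :: "'a set"
    assume "0 \<le> s" "A \<in> sets borel" "bounded A" "B \<in> sets borel"
    then show "martingale_measure F s A -` B \<inter> space P \<in> sets P"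
      unfolding martingale_measure_def
      by (intro measurable_sets[OF gaussian_noise_measurable[OF F time_noise_index]])
  qed
  have "?E \<subseteq> Pow (space P)" by auto
  then have "subalgebra P (noise_filtration P F a)"
    unfolding subalgebra_def noise_filtration_def using sets.sigma_sets_subset[OF E] by simp
  then show ?thesis using X by (rule measurable_from_subalg)
qed

lemma rapidly_decreasing_simple_process:
  assumes g: "g \<in> simple_processes P F T"
  shows "g \<omega> t \<in> rapidly_decreasing"
proof -
  obtain n :: nat and a b A X where c: "\<forall>i<n. 0 \<le> a i \<and> a i < b i \<and> b i \<le> T \<and> A i \<in> sets borel \<and> bounded (A i) \<and>
        X i \<in> borel_measurable (noise_filtration P F (a i)) \<and> bounded (X i ` space P)"
    and g: "g = (\<lambda>\<omega> t x. \<Sum>i<n. indicator {a i<..b i} t * indicator (A i) x * X i \<omega>)"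
    using g unfolding simple_processes_def by auto
  have "(\<lambda>x. \<Sum>i<n. (indicator {a i<..b i} t * X i \<omega>) * indicator (A i) x) \<in> rapidly_decreasing"
    using c by (intro rapidly_decreasing_sum rapidly_decreasing_scale rapidly_decreasing_indicator) auto
  then show ?thesis unfolding g by (simp add: mult_ac)
qed

lemma simple_process_transform:
  fixes F :: "(real \<Rightarrow> 'a::euclidean_space \<Rightarrow> real) \<Rightarrow> 'w \<Rightarrow> real"
  assumes g: "g \<in> simple_processes P F T"
  obtains n :: nat and a b A X where
    "\<And>i. i < n \<Longrightarrow> 0 \<le> a i \<and> a i < b i \<and> b i \<le> T \<and> A i \<in> sets borel \<and> bounded (A i) \<and>
      X i \<in> borel_measurable (noise_filtration P F (a i))"
    "\<And>\<omega> t \<xi>. fourier (g \<omega> t) \<xi> =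
      (\<Sum>i<n. complex_of_real (X i \<omega>) * (indicator {a i<..b i} t * fourier (indicator (A i)) \<xi>))"
proof -
  obtain n :: nat and a b A X where c: "\<forall>i<n. 0 \<le> a i \<and> a i < b i \<and> b i \<le> T \<and> A i \<in> sets borel \<and> bounded (A i) \<and>
        X i \<in> borel_measurable (noise_filtration P F (a i)) \<and> bounded (X i ` space P)"
    and g: "g = (\<lambda>\<omega> t x. \<Sum>i<n. indicator {a i<..b i} t * indicator (A i) x * X i \<omega>)"
    using g unfolding simple_processes_def by auto
  have "fourier (g \<omega> t) \<xi> =
      (\<Sum>i<n. complex_of_real (X i \<omega>) * (indicator {a i<..b i} t * fourier (indicator (A i)) \<xi>))" for \<omega> t \<xi>
  proof -
    have "g \<omega> t = (\<lambda>x. \<Sum>i<n. (indicator {a i<..b i} t * X i \<omega>) * indicator (A i) x)"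
      unfolding g by (simp add: mult_ac)
    then have "fourier (g \<omega> t) \<xi> = fourier (\<lambda>x. \<Sum>i<n. (indicator {a i<..b i} t * X i \<omega>) * indicator (A i) x) \<xi>"
      by simp
    also have "\<dots> = (\<Sum>i<n. fourier (\<lambda>x. (indicator {a i<..b i} t * X i \<omega>) * indicator (A i) x) \<xi>)"
      using c by (intro fourier_sum rapidly_decreasing_integrable rapidly_decreasing_scale
          rapidly_decreasing_indicator) auto
    also have "\<dots> = (\<Sum>i<n. complex_of_real (X i \<omega>) * (indicator {a i<..b i} t * fourier (indicator (A i)) \<xi>))"
      unfolding fourier_cmult
    proof (intro sum.cong refl)
      fix i
      show "complex_of_real (indicator {a i<..b i} t * X i \<omega>) * fourier (indicator (A i)) \<xi> =
          complex_of_real (X i \<omega>) * (indicator {a i<..b i} t * fourier (indicator (A i)) \<xi>)"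
        by (cases "t \<in> {a i<..b i}") auto
    qed
    finally show ?thesis .
  qed
  then show ?thesis using c by (intro that[of n a b A X]) auto
qed

text \<open>With \<omega> fixed, the random coefficients \<open>X i \<omega>\<close> are just real
  numbers.\<close>

lemma simple_process_section:
  assumes g: "g \<in> simple_processes P F T"
  shows "(\<lambda>(t, \<xi>). fourier (g \<omega> t) \<xi>) \<in> step_transforms T"
proof -
  obtain n :: nat and a b A X where c: "\<And>i. i < n \<Longrightarrow> 0 \<le> a i \<and> a i < b i \<and> b i \<le> T \<and> A i \<in> sets borel \<and> bounded (A i) \<and>
      X i \<in> borel_measurable (noise_filtration P F (a i))"
    and eq: "\<And>\<omega> t \<xi>. fourier (g \<omega> t) \<xi> =
      (\<Sum>i<n. complex_of_real (X i \<omega>) * (indicator {a i<..b i} t * fourier (indicator (A i)) \<xi>))"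
    by (rule simple_process_transform[OF g]) blast
  have "(\<lambda>x. \<Sum>i<m. complex_of_real (X i \<omega>) * (indicator {a i<..b i} (fst x) * fourier (indicator (A i)) (snd x)))
      \<in> step_transforms T" if "m \<le> n" for m
    using that
  proof (induction m)
    case 0
    show ?case using step_transforms.zero by simp
  next
    case (Suc m)
    have c: "0 \<le> a m" "a m < b m" "b m \<le> T" "A m \<in> sets borel" "bounded (A m)"
      using c[of m] Suc(2) by auto
    have "(\<lambda>x. \<Sum>i<m. complex_of_real (X i \<omega>) * (indicator {a i<..b i} (fst x) * fourier (indicator (A i)) (snd x)))
      \<in> step_transforms T" using Suc by simp
    from step_transforms.add[OF c this, of "X m \<omega>"] show ?case
      by (simp add: add.commute)
  qed
  from this[of n] show ?thesis by (simp add: eq case_prod_unfold)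
qed

text \<open>A constant is bounded and measurable for every sigma-algebra of the filtration, so it is
  an admissible coefficient.\<close>

lemma step_transform_simple_process:
  fixes F :: "(real \<Rightarrow> 'a::euclidean_space \<Rightarrow> real) \<Rightarrow> 'w \<Rightarrow> real"
  assumes "h \<in> step_transforms T"
  shows "\<exists>g\<in>simple_processes P F T. \<forall>\<omega> t \<xi>. fourier (g \<omega> t) \<xi> = h (t, \<xi>)"
  using assms
proof induction
  case zero
  have "(\<lambda>\<omega> t x. 0) \<in> simple_processes P F T"
    unfolding simple_processes_def by (auto intro!: exI[of _ "0::nat"])
  then show ?case by (rule bexI[rotated]) simp
next
  case (add a b A h c)
  then obtain g where g: "g \<in> simple_processes P F T" "\<And>\<omega> t \<xi>. fourier (g \<omega> t) \<xi> = h (t, \<xi>)"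
    by blast
  obtain n :: nat and a' b' A' X' where c: "\<forall>i<n. 0 \<le> a' i \<and> a' i < b' i \<and> b' i \<le> T \<and> A' i \<in> sets borel \<and> bounded (A' i) \<and>
        X' i \<in> borel_measurable (noise_filtration P F (a' i)) \<and> bounded (X' i ` space P)"
    and g_eq: "g = (\<lambda>\<omega> t x. \<Sum>i<n. indicator {a' i<..b' i} t * indicator (A' i) x * X' i \<omega>)"
    using g(1) unfolding simple_processes_def by auto
  let ?g = "\<lambda>\<omega> t x. g \<omega> t x + c * (indicator {a<..b} t * indicator A x)"
  have simple: "?g \<in> simple_processes P F T"
    unfolding simple_processes_def
  \<comment> \<open>The new term is appended at index n by updating each family of parameters
    there.\<close>
  proof (intro CollectI exI conjI allI impI)
    fix i assume "i < Suc n"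
    then have i: "i < n \<or> i = n" by auto
    show "0 \<le> (a'(n := a)) i" "(a'(n := a)) i < (b'(n := b)) i" "(b'(n := b)) i \<le> T"
      "(A'(n := A)) i \<in> sets borel" "bounded ((A'(n := A)) i)"
      "(X'(n := \<lambda>_. c)) i \<in> borel_measurable (noise_filtration P F ((a'(n := a)) i))"
      "bounded ((X'(n := \<lambda>_. c)) i ` space P)"
      using i c add(1-5) by (auto simp: image_constant_conv)
  next
    show "?g = (\<lambda>\<omega> t x. \<Sum>i<Suc n. indicator {(a'(n := a)) i<..(b'(n := b)) i} t *
        indicator ((A'(n := A)) i) x * (X'(n := \<lambda>_. c)) i \<omega>)"
      unfolding g_eq by (simp add: fun_eq_iff mult_ac)
  qed
  have transform: "fourier (?g \<omega> t) \<xi> = complex_of_real c * (indicator {a<..b} (fst (t, \<xi>)) * fourier (indicator A) (snd (t, \<xi>))) + h (t, \<xi>)"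
    for \<omega> t \<xi>
  proof -
    have A: "(\<lambda>x. c * (indicator {a<..b} t * indicator A x)) \<in> rapidly_decreasing"
      by (intro rapidly_decreasing_scale rapidly_decreasing_indicator add(4,5))
    show ?thesis
      unfolding fourier_add[OF rapidly_decreasing_simple_process[OF g(1), THEN rapidly_decreasing_integrable]
          rapidly_decreasing_integrable[OF A]] fourier_cmult g(2)
      by (cases "t \<in> {a<..b}") auto
  qed
  show ?case by (rule bexI[OF _ simple]) (intro allI transform)
qed

context spectral_measure
begin

lemma simple_process_measurable:
  assumes F: "gaussian_noise P \<Gamma> F" and g: "g \<in> simple_processes P F T"
  shows "(\<lambda>(\<omega>, s, \<xi>). fourier (g \<omega> s) \<xi>) \<in> borel_measurable (P \<Otimes>\<^sub>M (time_measure T \<Otimes>\<^sub>M \<mu>))"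
proof -
  obtain n :: nat and a b A X where c: "\<And>i. i < n \<Longrightarrow> 0 \<le> a i \<and> a i < b i \<and> b i \<le> T \<and> A i \<in> sets borel \<and> bounded (A i) \<and>
      X i \<in> borel_measurable (noise_filtration P F (a i))"
    and eq: "\<And>\<omega> t \<xi>. fourier (g \<omega> t) \<xi> =
      (\<Sum>i<n. complex_of_real (X i \<omega>) * (indicator {a i<..b i} t * fourier (indicator (A i)) \<xi>))"
    by (rule simple_process_transform[OF g]) blast
  have "(\<lambda>x. complex_of_real (X i (fst x)) * (case snd x of (t, \<xi>) \<Rightarrow> indicator {a i<..b i} t * fourier (indicator (A i)) \<xi>))
      \<in> borel_measurable (P \<Otimes>\<^sub>M (time_measure T \<Otimes>\<^sub>M \<mu>))" if i: "i < n" for i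
  proof -
    have [measurable]: "X i \<in> borel_measurable P"
      using c[OF i] by (intro noise_filtration_measurable[OF F]) auto
    have "A i \<in> sets borel" using c[OF i] by simp
    then have "fourier (indicator (A i)) \<in> borel_measurable \<mu>"
      by (simp add: fourier_measurable)
    then have [measurable]: "(\<lambda>(t, \<xi>). indicator {a i<..b i} t * fourier (indicator (A i)) \<xi>)
        \<in> borel_measurable (time_measure T \<Otimes>\<^sub>M \<mu>)"
      by (intro measurable_tensor) auto
    show ?thesis by measurable
  qed
  then have "(\<lambda>x. \<Sum>i<n. complex_of_real (X i (fst x)) * (case snd x of (t, \<xi>) \<Rightarrow> indicator {a i<..b i} t * fourier (indicator (A i)) \<xi>))
      \<in> borel_measurable (P \<Otimes>\<^sub>M (time_measure T \<Otimes>\<^sub>M \<mu>))"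
    by (intro borel_measurable_sum) auto
  then show ?thesis by (simp add: eq case_prod_unfold)
qed

lemma sigma_finite_time_space:
  assumes "0 < T"
  shows "sigma_finite_measure (time_measure T \<Otimes>\<^sub>M \<mu>)"
proof -
  interpret N: finite_measure "time_measure T" using assms by (intro finite_time_measure) simp
  interpret M: sigma_finite_measure \<mu> by (rule sigma_finite_\<mu>)
  interpret pair_sigma_finite "time_measure T" \<mu> ..
  show ?thesis by (rule sigma_finite_measure_axioms)
qed

text \<open>If a deterministic element is close to a random simple process in mean square, it is as
  close to the section of that process at some \<open>\<omega>\<close>, which is a deterministic simple function.\<close>

lemma P_0d_eq_step_closure:
  assumes T: "0 < T" and P: "prob_space P" and F: "gaussian_noise P \<Gamma> F"
  shows "P_0d P F \<mu> T = step_closure T"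
proof -
  interpret P: prob_space P by fact
  let ?M = "time_measure T \<Otimes>\<^sub>M \<mu>"
  note sf = sigma_finite_time_space[OF T]
  \<comment> \<open>\<open>P\<close> has total mass 1, so regarding a deterministic function as a
    random one preserves the square norm.\<close>
  have const: "L2_sqnorm (P \<Otimes>\<^sub>M ?M) (\<lambda>x. H (snd x)) = L2_sqnorm ?M H" if "H \<in> borel_measurable ?M" for H
    using that by (subst L2_sqnorm_pair(1)[OF sf]) (auto simp: P.emeasure_space_1)
  show ?thesis
  proof (intro equalityI subsetI)
    fix G assume "G \<in> P_0d P F \<mu> T"
    then have G: "G \<in> L2 ?M" "(\<lambda>(\<omega>, s, \<xi>). G (s, \<xi>)) \<in> P_0 P F \<mu> T"
      unfolding P_0d_def by auto
    show "G \<in> step_closure T"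
      unfolding L2_closure_iff
    proof (intro conjI allI impI G(1))
      fix e :: real assume e: "0 < e"
      obtain g where g: "g \<in> simple_processes P F T"
        "L2_sqnorm (P \<Otimes>\<^sub>M ?M) (\<lambda>x. (case x of (\<omega>, s, \<xi>) \<Rightarrow> fourier (g \<omega> s) \<xi>) - (case x of (\<omega>, s, \<xi>) \<Rightarrow> G (s, \<xi>))) < ennreal e"
        using L2_closure_approx[OF G(2)[unfolded P_0_def] e] by blast
      let ?D = "\<lambda>x. (case x of (\<omega>, s, \<xi>) \<Rightarrow> fourier (g \<omega> s) \<xi>) - (case x of (\<omega>, s, \<xi>) \<Rightarrow> G (s, \<xi>))"
      have "(\<lambda>x. G (snd x)) \<in> borel_measurable (P \<Otimes>\<^sub>M ?M)"
        using L2_measurable[OF G(1)] by measurable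
      then have "?D \<in> borel_measurable (P \<Otimes>\<^sub>M ?M)"
        using simple_process_measurable[OF F g(1)] by (intro borel_measurable_diff) (simp_all add: case_prod_unfold)
      then have int: "(\<integral>\<^sup>+\<omega>. L2_sqnorm ?M (\<lambda>y. ?D (\<omega>, y)) \<partial>P) < ennreal e"
        using g(2) by (simp only: L2_sqnorm_pair(1)[OF sf])
      have "\<exists>\<omega>\<in>space P. L2_sqnorm ?M (\<lambda>y. ?D (\<omega>, y)) < ennreal e"
      proof (rule ccontr)
        \<comment> \<open>If every section were at squared distance at least e, so would be the
          mean, again because \<open>P\<close> has mass 1.\<close>
        assume "\<not> ?thesis"
        then have "(\<integral>\<^sup>+\<omega>. ennreal e \<partial>P) \<le> (\<integral>\<^sup>+\<omega>. L2_sqnorm ?M (\<lambda>y. ?D (\<omega>, y)) \<partial>P)"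
          by (intro nn_integral_mono) (auto simp: not_less)
        then show False using int by (simp add: P.emeasure_space_1)
      qed
      then obtain \<omega> where "L2_sqnorm ?M (\<lambda>y. ?D (\<omega>, y)) < ennreal e" by blast
      then have "L2_sqnorm ?M (\<lambda>x. (case x of (t, \<xi>) \<Rightarrow> fourier (g \<omega> t) \<xi>) - G x) < ennreal e"
        by (simp add: case_prod_unfold)
      then show "\<exists>h\<in>step_transforms T. L2_sqnorm ?M (\<lambda>x. h x - G x) < ennreal e"
        using simple_process_section[OF g(1)] by (rule bexI)
    qed
  next
    fix G assume G: "G \<in> step_closure T"
    have G2: "G \<in> L2 ?M" by (rule L2_closure_L2[OF G])
    note Gm = L2_measurable[OF G2]
    have "(\<lambda>x. G (snd x)) \<in> P_0 P F \<mu> T"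
      unfolding P_0_def L2_closure_iff
    proof (intro conjI allI impI)
      have "(\<lambda>x. G (snd x)) \<in> borel_measurable (P \<Otimes>\<^sub>M ?M)" using Gm by measurable
      then show "(\<lambda>x. G (snd x)) \<in> L2 (P \<Otimes>\<^sub>M ?M)"
        using const[OF Gm] G2 by (simp add: L2_def)
      fix e :: real assume "0 < e"
      then obtain h where h: "h \<in> step_transforms T" "L2_sqnorm ?M (\<lambda>x. h x - G x) < ennreal e"
        using L2_closure_approx[OF G] by blast
      obtain g where g: "g \<in> simple_processes P F T" "\<And>\<omega> t \<xi>. fourier (g \<omega> t) \<xi> = h (t, \<xi>)"
        using step_transform_simple_process[OF h(1)] by blast
      have "(\<lambda>x. h x - G x) \<in> borel_measurable ?M"
        using h(1) step_transforms_measurable Gm by (intro borel_measurable_diff) auto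
      from const[OF this] h(2)
      have "L2_sqnorm (P \<Otimes>\<^sub>M ?M) (\<lambda>x. (case x of (\<omega>, s, \<xi>) \<Rightarrow> fourier (g \<omega> s) \<xi>) - G (snd x)) < ennreal e"
        by (simp add: g(2) case_prod_unfold)
      then show "\<exists>f\<in>(\<lambda>g (\<omega>, s, \<xi>). fourier (g \<omega> s) \<xi>) ` simple_processes P F T.
          L2_sqnorm (P \<Otimes>\<^sub>M ?M) (\<lambda>x. f x - G (snd x)) < ennreal e"
        using g(1) by blast
    qed
    then show "G \<in> P_0d P F \<mu> T"
      unfolding P_0d_def using G2 by (simp add: case_prod_unfold)
  qed
qed

end

theorem lemma2p1:
  fixes \<Gamma> \<mu> :: "'a::euclidean_space measure"
    and P :: "'w measure"
    and F :: "(real \<Rightarrow> 'a \<Rightarrow> real) \<Rightarrow> 'w \<Rightarrow> real"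
    and T :: real
  assumes "0 < T"
    and "tempered_measure \<Gamma>" and "nonneg_definite \<Gamma>"
    and "tempered_measure \<mu>" and "is_fourier_transform \<mu> \<Gamma>"
    and "prob_space P" and "gaussian_noise P \<Gamma> F"
  shows "P_0d P F \<mu> T = H_T \<mu> T"
proof -
  interpret spectral_measure \<Gamma> \<mu>
    using assms by unfold_locales
  show ?thesis
    using P_0d_eq_step_closure[OF assms(1,6,7)] step_closure_subset_H_T[OF assms(1)]
      H_T_subset_step_closure[OF assms(1)] by blast
qed

end
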